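(* Let $K=\mathbb R^d\setminus U$ be compact and strongly star-shaped. Suppose that $w$ and $u$ are respectively a viscosity subsolution and a lower semicontinuous (on $[0,T]\times\overline U$) viscosity supersolution of the local stability and dynamic slope conditions in $[0,T]$ with Dirichlet data $F$, with strongly star-shaped initial data $w(0)$, $u(0)$ satisfying $w(0)\le u(0)$. Further suppose that $w$ satisfies the following: (a) $\{w(t)>0\}$ is bounded and strongly star-shaped at each time $t\in[0,T]$, its boundary is uniformly $C^{1,\alpha}$ in space and Lipschitz in time, $w(t)$ is $C^1$ in $\overline{\Omega(w(t))}$, and $\nabla w(t)$ is continuous in time on $\bigcup_{t\in[0,T]}\overline{\Omega(w(t))}$ (i.e. $(t,x)\mapsto\nabla w(t,x)$ is continuous on $\{(t,x):t\in[0,T],\,x\in\overline{\Omega(w(t))}\}$). (b) There is a finite partition $\{t_i\}_{i=0}^n$ of $[0,T]$ such that $w$ is monotone in time on each $[t_i,t_{i+1}]$. Then $w\le u$ on $[0,T]\times\overline U$. Likewise, if $w$ is a viscosity supersolution satisfying (a) and (b) and $u$ is an upper semicontinuous (on $[0,T]\times\overline U$) viscosity subsolution, both with Dirichlet data $F$ and strongly star-shaped initial data satisfying $w(0)\ge u(0)$, then $w\ge u$ on $[0,T]\times\overline U$.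
   Context: Setting. $U\subset\mathbb R^d$ is a connected open set with compact complement $K$; $\mu_-\in(0,1)$, $\mu_+>0$, $T>0$ are fixed. $F\in C^1([0,T])$ is strictly positive and $\{t\in(0,T):F'(t)=0\}$ is discrete. For a nonnegative function $v$ on $\overline U$, $\Omega(v)=\{v>0\}$; when it is called star-shaped, bounded or a $C^{1,\alpha}$ domain it is understood as $\{v>0\}\cup K$, and free boundaries are taken inside $U$. Sub/superdifferentials. For $v\ge0$ continuous and $x_0\in\partial\Omega(v)\cap U$: $D_+v(x_0)=\{p\in\mathbb R^d: v(x)\le p\cdot(x-x_0)+o(|x-x_0|)\text{ in }\overline{\Omega(v)}\}$ and $D_-v(x_0)=\{p\in\mathbb R^d: v(x)\ge p\cdot(x-x_0)-o(|x-x_0|)\}$. Envelopes. $u^*(t,x)=\limsup_{(s,y)\to(t,x)}u(s,y)$, $u_*(t,x)=\liminf_{(s,y)\to(t,x)}u(s,y)$, with $(s,y)\in[0,T]\times\overline U$. $D_\pm u^*(t_0,x_0)$ denotes $D_\pm$ of $u^*(t_0,\cdot)$ at $x_0$, and similarly for $u_*$. Normal velocity. For a time-varying family $\Omega(t)$ and $x_0\in\partial\Omega(t_0)$: $V(t_0,x_0;\Omega)>0$ means that for some $c,r_0>0$, $\{x:|x-x_0|\le c(t_0-t)\}\subset\Omega(t)^{\complement}$ for all $t_0-r_0\le t<t_0$; $V(t_0,x_0;\Omega)<0$ means that for some $c,r_0>0$, $\{x:|x-x_0|\le c(t_0-t)\}\subset\Omega(t)$ for all $t_0-r_0\le t<t_0$.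 Viscosity subsolution of the local stability and dynamic slope conditions with Dirichlet data $F$. A bounded map $u:[0,T]\to C(\overline U)$, $u\ge0$, such that: $u(t)\le F(t)$ on $\partial U$; for each $t$, $u(t)$ is subharmonic in $\Omega(u(t))\cap U$ and $|p|^2\ge1-\mu_-$ for all $p\in D_+u(t)(x)$, $x\in\partial\Omega(u(t))\cap U$; $|p|^2\ge1-\mu_-$ for all $p\in D_+u^*(t_0,x_0)$, $x_0\in\partial\Omega(u^*(t_0))\cap U$; and if $V(t_0,x_0;\Omega(u^* ))>0$ for some $x_0\in\partial\Omega(u^*(t_0))\cap U$, then every $p\in D_+u^*(t_0,x_0)$ satisfies $|p|^2\ge1+\mu_+$. Viscosity supersolution with Dirichlet data $F$. A bounded map $u:[0,T]\to C(\overline U)$, $u\ge0$, such that: $u(t)\ge F(t)$ on $\partial U$; for each $t$, $u(t)$ is superharmonic in $\Omega(u(t))\cap U$ and $|p|^2\le1+\mu_+$ for all $p\in D_-u(t)(x)$, $x\in\partial\Omega(u(t))\cap U$; and if $V(t_0,x_0;\Omega(u_* ))<0$ for some $x_0\in\partial\Omega(u_*(t_0))\cap U$, then every $p\in D_-u_*(t_0,x_0)$ satisfies $|p|^2\le1-\mu_-$. Strongly star-shaped. A set is strongly star-shaped if it is star-shaped with respect to all points in a neighborhood of the origin. A function $v$ on $\overline U$ is strongly star-shaped if each set $\{v>\eta\}\cup K$ is strongly star-shaped. Lipschitz in time for sets refers to the Hausdorff distance.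
   Formalization: In the second half, {u(t)>0} is additionally assumed bounded for each t; without this the claim fails (u may jump to a positive constant on all of U, leaving no free boundary), and w ≥ u forces it anyway since {w(t)>0} is bounded. *)

theory Defs
  imports "HOL-Analysis.Analysis"
begin

text \<open>
  Functions on the closure of \<open>U\<close> are total functions on \<open>'a\<close> whose values outside
  \<open>closure U\<close> are never used; evolutions are maps \<open>u :: real \<Rightarrow> 'a \<Rightarrow> real\<close>, read on
  \<open>{0..T} \<times> closure U\<close>.  The compact set \<open>K\<close> is \<open>- U\<close>.
\<close>

definition pos_set :: "'a::euclidean_space set \<Rightarrow> ('a \<Rightarrow> real) \<Rightarrow> 'a set" where
  "pos_set U v = {x \<in> closure U. v x > 0}"

definition free_bdry :: "'a::euclidean_space set \<Rightarrow> ('a \<Rightarrow> real) \<Rightarrow> 'a set" where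
  "free_bdry U v = frontier (pos_set U v) \<inter> U"


subsection \<open>Sub- and superharmonic continuous functions\<close>

text \<open>Mean value inequality on all closed balls in the (open) set \<open>S\<close>.\<close>

definition subharmonic_on :: "'a::euclidean_space set \<Rightarrow> ('a \<Rightarrow> real) \<Rightarrow> bool" where
  "subharmonic_on S v \<longleftrightarrow> continuous_on S v \<and>
     (\<forall>x r. r > 0 \<and> cball x r \<subseteq> S \<longrightarrow>
        v x \<le> integral (cball x r) v / measure lebesgue (cball x r))"

definition superharmonic_on :: "'a::euclidean_space set \<Rightarrow> ('a \<Rightarrow> real) \<Rightarrow> bool" where
  "superharmonic_on S v \<longleftrightarrow> subharmonic_on S (\<lambda>x. - v x)"


subsection \<open>Sub- and superdifferentials at free boundary points\<close>

definition superdiff :: "'a::euclidean_space set \<Rightarrow> ('a \<Rightarrow> real) \<Rightarrow> 'a \<Rightarrow> 'a set" where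
  "superdiff U v x0 = {p. \<forall>e>0. \<exists>d>0. \<forall>x \<in> closure (pos_set U v). norm (x - x0) < d \<longrightarrow>
       v x \<le> p \<bullet> (x - x0) + e * norm (x - x0)}"

definition subdiff :: "'a::euclidean_space set \<Rightarrow> ('a \<Rightarrow> real) \<Rightarrow> 'a \<Rightarrow> 'a set" where
  "subdiff U v x0 = {p. \<forall>e>0. \<exists>d>0. \<forall>x \<in> closure U. norm (x - x0) < d \<longrightarrow>
       v x \<ge> p \<bullet> (x - x0) - e * norm (x - x0)}"


subsection \<open>Semicontinuity and semicontinuous envelopes\<close>

definition lsc_on :: "'b::topological_space set \<Rightarrow> ('b \<Rightarrow> real) \<Rightarrow> bool" where
  "lsc_on S f \<longleftrightarrow> (\<forall>z\<in>S. \<forall>c < f z. eventually (\<lambda>y. c < f y) (at z within S))"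

definition usc_on :: "'b::topological_space set \<Rightarrow> ('b \<Rightarrow> real) \<Rightarrow> bool" where
  "usc_on S f \<longleftrightarrow> (\<forall>z\<in>S. \<forall>c > f z. eventually (\<lambda>y. f y < c) (at z within S))"

text \<open>
  The envelopes are applied to bounded evolutions only, so the extended-real limits are finite.
  The filter is punctured at \<open>(t,x)\<close>; this makes no difference when each \<open>u t\<close> is continuous
  on \<open>closure U\<close> with \<open>U\<close> open, as then \<open>u t x\<close> is itself a limit of values \<open>u t y\<close>, \<open>y \<noteq> x\<close>.
\<close>

definition upper_env ::
  "'a::euclidean_space set \<Rightarrow> real \<Rightarrow> (real \<Rightarrow> 'a \<Rightarrow> real) \<Rightarrow> real \<Rightarrow> 'a \<Rightarrow> real" where
  "upper_env U T u t x = real_of_ereal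
     (Limsup (at (t, x) within {0..T} \<times> closure U) (\<lambda>(s, y). ereal (u s y)))"

definition lower_env ::
  "'a::euclidean_space set \<Rightarrow> real \<Rightarrow> (real \<Rightarrow> 'a \<Rightarrow> real) \<Rightarrow> real \<Rightarrow> 'a \<Rightarrow> real" where
  "lower_env U T u t x = real_of_ereal
     (Liminf (at (t, x) within {0..T} \<times> closure U) (\<lambda>(s, y). ereal (u s y)))"


subsection \<open>Sign of the normal velocity of a family \<open>D t\<close>, \<open>t \<in> {0..T}\<close>\<close>

text \<open>
  The condition \<open>r0 \<le> t0\<close> keeps the backward time interval inside the time domain; in particular
  neither sign is ever attained at the initial time.
\<close>

definition velocity_pos :: "(real \<Rightarrow> 'a::euclidean_space set) \<Rightarrow> real \<Rightarrow> 'a \<Rightarrow> bool" where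
  "velocity_pos D t0 x0 \<longleftrightarrow> (\<exists>c>0. \<exists>r0>0. r0 \<le> t0 \<and>
     (\<forall>t. t0 - r0 \<le> t \<and> t < t0 \<longrightarrow> cball x0 (c * (t0 - t)) \<subseteq> - D t))"

definition velocity_neg :: "(real \<Rightarrow> 'a::euclidean_space set) \<Rightarrow> real \<Rightarrow> 'a \<Rightarrow> bool" where
  "velocity_neg D t0 x0 \<longleftrightarrow> (\<exists>c>0. \<exists>r0>0. r0 \<le> t0 \<and>
     (\<forall>t. t0 - r0 \<le> t \<and> t < t0 \<longrightarrow> cball x0 (c * (t0 - t)) \<subseteq> D t))"


subsection \<open>Viscosity sub- and supersolutions\<close>

definition bounded_evolution ::
  "'a::euclidean_space set \<Rightarrow> real \<Rightarrow> (real \<Rightarrow> 'a \<Rightarrow> real) \<Rightarrow> bool" where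
  "bounded_evolution U T u \<longleftrightarrow>
     (\<forall>t\<in>{0..T}. continuous_on (closure U) (u t)) \<and>
     (\<forall>t\<in>{0..T}. \<forall>x\<in>closure U. 0 \<le> u t x) \<and>
     (\<exists>M. \<forall>t\<in>{0..T}. \<forall>x\<in>closure U. \<bar>u t x\<bar> \<le> M)"

definition visc_subsolution ::
  "'a::euclidean_space set \<Rightarrow> real \<Rightarrow> real \<Rightarrow> real \<Rightarrow> (real \<Rightarrow> real) \<Rightarrow> (real \<Rightarrow> 'a \<Rightarrow> real) \<Rightarrow> bool"
where
  "visc_subsolution U T \<mu>m \<mu>p F u \<longleftrightarrow>
     bounded_evolution U T u \<and>
     (\<forall>t\<in>{0..T}. \<forall>x\<in>frontier U. u t x \<le> F t) \<and>
     (\<forall>t\<in>{0..T}. subharmonic_on (pos_set U (u t) \<inter> U) (u t)) \<and>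
     (\<forall>t\<in>{0..T}. \<forall>x\<in>free_bdry U (u t). \<forall>p\<in>superdiff U (u t) x. (norm p)\<^sup>2 \<ge> 1 - \<mu>m) \<and>
     (\<forall>t0\<in>{0..T}. \<forall>x0\<in>free_bdry U (upper_env U T u t0).
        \<forall>p\<in>superdiff U (upper_env U T u t0) x0. (norm p)\<^sup>2 \<ge> 1 - \<mu>m) \<and>
     (\<forall>t0\<in>{0..T}. \<forall>x0\<in>free_bdry U (upper_env U T u t0).
        velocity_pos (\<lambda>t. pos_set U (upper_env U T u t)) t0 x0 \<longrightarrow>
        (\<forall>p\<in>superdiff U (upper_env U T u t0) x0. (norm p)\<^sup>2 \<ge> 1 + \<mu>p))"

definition visc_supersolution ::
  "'a::euclidean_space set \<Rightarrow> real \<Rightarrow> real \<Rightarrow> real \<Rightarrow> (real \<Rightarrow> real) \<Rightarrow> (real \<Rightarrow> 'a \<Rightarrow> real) \<Rightarrow> bool"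
where
  "visc_supersolution U T \<mu>m \<mu>p F u \<longleftrightarrow>
     bounded_evolution U T u \<and>
     (\<forall>t\<in>{0..T}. \<forall>x\<in>frontier U. u t x \<ge> F t) \<and>
     (\<forall>t\<in>{0..T}. superharmonic_on (pos_set U (u t) \<inter> U) (u t)) \<and>
     (\<forall>t\<in>{0..T}. \<forall>x\<in>free_bdry U (u t). \<forall>p\<in>subdiff U (u t) x. (norm p)\<^sup>2 \<le> 1 + \<mu>p) \<and>
     (\<forall>t0\<in>{0..T}. \<forall>x0\<in>free_bdry U (lower_env U T u t0).
        velocity_neg (\<lambda>t. pos_set U (lower_env U T u t)) t0 x0 \<longrightarrow>
        (\<forall>p\<in>subdiff U (lower_env U T u t0) x0. (norm p)\<^sup>2 \<le> 1 - \<mu>m))"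


subsection \<open>Strong star-shapedness\<close>

definition star_shaped_wrt :: "'a::euclidean_space \<Rightarrow> 'a set \<Rightarrow> bool" where
  "star_shaped_wrt z S \<longleftrightarrow> z \<in> S \<and> (\<forall>x\<in>S. closed_segment z x \<subseteq> S)"

definition strongly_star_shaped :: "'a::euclidean_space set \<Rightarrow> bool" where
  "strongly_star_shaped S \<longleftrightarrow> (\<exists>r>0. \<forall>z\<in>ball 0 r. star_shaped_wrt z S)"

definition strongly_star_shaped_fun :: "'a::euclidean_space set \<Rightarrow> ('a \<Rightarrow> real) \<Rightarrow> bool" where
  "strongly_star_shaped_fun U v \<longleftrightarrow>
     (\<forall>\<eta>. strongly_star_shaped ({x \<in> closure U. v x > \<eta>} \<union> - U))"


subsection \<open>Regularity of moving domains\<close>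

text \<open>Used for nonempty compact sets, where the suprema are finite.\<close>

definition hausdorff_distance :: "'a::metric_space set \<Rightarrow> 'a set \<Rightarrow> real" where
  "hausdorff_distance A B = max (SUP x\<in>A. infdist x B) (SUP y\<in>B. infdist y A)"

text \<open>
  Near each boundary point the domain is, inside a ball of radius \<open>r\<close>, the region below the graph
  of a \<open>C\<^sup>1\<^sup>,\<^sup>\<alpha>\<close> function \<open>g\<close> over the hyperplane orthogonal to a unit vector \<open>\<nu>\<close>, with bounds \<open>L\<close>
  on the gradient and its Hoelder seminorm.  Here \<open>g\<close> lives on the whole space, but only its
  values on the hyperplane (the points \<open>x - (x \<bullet> \<nu>) *\<^sub>R \<nu>\<close>) enter; a function on
  the hyperplane can be extended independently of \<open>x \<bullet> \<nu>\<close>.  Points on the graph are the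
  boundary points in the ball; they may or may not belong to \<open>D\<close>, since \<open>pos_set U v \<union> - U\<close> is
  not open where \<open>v\<close> vanishes on \<open>frontier U\<close>.
\<close>

definition C1_holder_domain ::
  "real \<Rightarrow> real \<Rightarrow> real \<Rightarrow> 'a::euclidean_space set \<Rightarrow> bool" where
  "C1_holder_domain \<alpha> r L D \<longleftrightarrow>
     (\<forall>x0\<in>frontier D. \<exists>\<nu> g G. norm \<nu> = 1 \<and>
        (\<forall>y. GDERIV g y :> G y) \<and>
        (\<forall>y. norm (G y) \<le> L) \<and>
        (\<forall>y z. norm (G y - G z) \<le> L * norm (y - z) powr \<alpha>) \<and>
        (\<forall>x\<in>ball x0 r. (x \<bullet> \<nu> < g (x - (x \<bullet> \<nu>) *\<^sub>R \<nu>) \<longrightarrow> x \<in> D) \<and>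
                         (x \<bullet> \<nu> > g (x - (x \<bullet> \<nu>) *\<^sub>R \<nu>) \<longrightarrow> x \<notin> D)))"

text \<open>
  Regularity of \<open>w\<close>.  The domain is \<open>pos_set U (w t) \<union> - U\<close>, so that the fixed set \<open>K\<close> is
  filled in.  \<open>C\<^sup>1\<close> in the closure means that the gradient in the open set
  \<open>pos_set U (w t) \<inter> U\<close> has a continuous extension \<open>G t\<close> to the closure; joint continuity of
  \<open>G\<close> in \<open>(t,x)\<close> contains the continuity in \<open>x\<close> for fixed \<open>t\<close>.
\<close>

definition regular_evolution ::
  "'a::euclidean_space set \<Rightarrow> real \<Rightarrow> (real \<Rightarrow> 'a \<Rightarrow> real) \<Rightarrow> bool" where
  "regular_evolution U T w \<longleftrightarrow>
     (\<forall>t\<in>{0..T}. bounded (pos_set U (w t) \<union> - U) \<and>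
                 strongly_star_shaped (pos_set U (w t) \<union> - U)) \<and>
     (\<exists>\<alpha> r L. 0 < \<alpha> \<and> \<alpha> \<le> 1 \<and> 0 < r \<and>
        (\<forall>t\<in>{0..T}. C1_holder_domain \<alpha> r L (pos_set U (w t) \<union> - U))) \<and>
     (\<exists>L. \<forall>s\<in>{0..T}. \<forall>t\<in>{0..T}.
        hausdorff_distance (frontier (pos_set U (w s) \<union> - U)) (frontier (pos_set U (w t) \<union> - U))
          \<le> L * \<bar>s - t\<bar>) \<and>
     (\<exists>G. (\<forall>t\<in>{0..T}. \<forall>x \<in> pos_set U (w t) \<inter> U. GDERIV (w t) x :> G t x) \<and>
          continuous_on {(t, x). t \<in> {0..T} \<and> x \<in> closure (pos_set U (w t))} (\<lambda>(t, x). G t x))"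

definition piecewise_monotone_in_time ::
  "'a::euclidean_space set \<Rightarrow> real \<Rightarrow> (real \<Rightarrow> 'a \<Rightarrow> real) \<Rightarrow> bool" where
  "piecewise_monotone_in_time U T w \<longleftrightarrow>
     (\<exists>(n::nat) \<tau>. \<tau> 0 = 0 \<and> \<tau> n = T \<and> (\<forall>i<n. \<tau> i < \<tau> (Suc i)) \<and>
        (\<forall>i<n. (\<forall>x\<in>closure U. mono_on {\<tau> i..\<tau> (Suc i)} (\<lambda>t. w t x)) \<or>
               (\<forall>x\<in>closure U. antimono_on {\<tau> i..\<tau> (Suc i)} (\<lambda>t. w t x))))"

end

theory Submission
  imports Defs
begin

text \<open>
  Write \<open>D t\<close> for the positivity set of the regular evolution \<open>w\<close> at time \<open>t\<close>, with \<open>K\<close> filled in.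
  Both comparisons are proved by bringing the subsolution and the supersolution into contact
  through a dilation \<open>x \<mapsto> \<Lambda> t *\<^sub>R x\<close> with \<open>\<Lambda> t = 1 + \<epsilon> * (1 + t)\<close>, a factor that is larger than one
  and strictly increasing in time, and letting \<open>\<epsilon>\<close> tend to zero at the end.

  Since \<open>D t\<close> is strongly star-shaped it is described by its radial function (the largest factor by
  which a point can be multiplied without leaving the closure of \<open>D t\<close>), and finite speed of the
  boundaries in Hausdorff distance makes this function jointly continuous (\<open>radial_ratio\<close>).  Continuity
  of the gradient up to the boundary implies that it belongs to both the subdifferential and the
  superdifferential at free boundary points (\<open>gradient_subdiff\<close>, \<open>gradient_superdiff\<close>), that \<open>w\<close> is
  jointly continuous in \<open>U\<close> and hence equal to its envelopes there (\<open>jointly_continuous\<close>), and that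
  near a free boundary point with nonzero gradient the sets \<open>D t\<close> contain a common cone of inward
  directions (\<open>inward_cone\<close>).

  Take \<open>w\<close> to be the subsolution.  As long as the closure of the positivity set of
  \<open>w t (\<Lambda> t *\<^sub>R x)\<close> stays inside that of \<open>u t\<close>, the weak maximum principle gives
  \<open>w t (\<Lambda> t *\<^sub>R x) \<le> u t x\<close>.  At the first time \<open>t0\<close> at which the inclusion fails, the largest
  dilation factor \<open>\<mu> \<ge> \<Lambda> t0\<close> for which it fails yields a free boundary point \<open>x0\<close> of \<open>u t0\<close> at which
  \<open>w t0 (\<mu> *\<^sub>R x)\<close> touches \<open>u t0\<close> from below (\<open>dilation_touching\<close>).  This also covers the case that \<open>u\<close>
  jumps at \<open>t0\<close>.  With \<open>g\<close> the gradient of \<open>w\<close> at \<open>\<mu> *\<^sub>R x0\<close>, the static condition for \<open>u\<close> says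
  \<open>\<mu>\<^sup>2 |g|\<^sup>2 \<le> 1 + \<mu>p\<close>, so \<open>|g|\<^sup>2 < 1 + \<mu>p\<close>.  By continuity the same holds for the gradient at nearby
  free boundary points, the dynamic condition for \<open>w\<close> excludes positive normal velocity there, and so \<open>D t\<close>
  has not expanded through \<open>\<mu> *\<^sub>R x0\<close> shortly before \<open>t0\<close> (\<open>not_expanding\<close>).  The dilated sets
  then recede from \<open>x0\<close> at positive speed, because \<open>\<Lambda>\<close> is strictly increasing, and they lie inside the
  positivity set of \<open>u\<close>; hence \<open>u\<close> has negative normal velocity at \<open>x0\<close>.  The dynamic condition gives
  \<open>\<mu>\<^sup>2 |g|\<^sup>2 \<le> 1 - \<mu>m\<close>, which contradicts \<open>|g|\<^sup>2 \<ge> 1 - \<mu>m\<close>.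

  If \<open>w\<close> is the supersolution, then \<open>u\<close> is dilated instead and the roles of the two dynamic conditions
  are exchanged (\<open>not_contracting\<close>).  The only new point is that the inclusion of the supports could
  fail immediately after a time at which it still holds strictly, since upper semicontinuity
  alone does not control the support of \<open>u\<close>; this is excluded by a barrier with small gradient
  (\<open>support_persists\<close>).
\<close>

section \<open>Mean values and the weak maximum principle\<close>

lemma integrable_on_cball_continuous:
  fixes f :: "'a::euclidean_space \<Rightarrow> real"
  assumes "continuous_on (cball x r) f"
  shows "f integrable_on cball x r"
  using borel_integrable_compact[OF compact_cball assms] set_borel_integral_eq_integral(1)
  unfolding set_integrable_def by blast

lemma has_integral_cball_dilate:
  fixes f :: "'a::euclidean_space \<Rightarrow> real"
  assumes "(f has_integral I) (cball (c *\<^sub>R x) (c * r))" and c: "c > 0"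
  shows "((\<lambda>y. f (c *\<^sub>R y)) has_integral (I / c ^ DIM('a))) (cball x r)"
proof -
  let ?B = "cball (c *\<^sub>R x) (c * r)"
  have mem: "c *\<^sub>R y \<in> ?B \<longleftrightarrow> y \<in> cball x r" for y
  proof -
    have "dist (c *\<^sub>R x) (c *\<^sub>R y) = c * dist x y"
      using c by (metis abs_of_pos dist_norm norm_scaleR scaleR_right_diff_distrib)
    then show ?thesis using c by simp
  qed
  obtain a where a: "?B \<subseteq> cbox (- a) a"
    using bounded_subset_cbox_symmetric[of ?B] by auto
  have "((\<lambda>y. if y \<in> ?B then f y else 0) has_integral I) (cbox (-a) a)"
    using has_integral_restrict[OF a] assms(1) by blast
  from has_integral_affinity'[OF this c, of 0]
  have *: "((\<lambda>y. if y \<in> cball x r then f (c *\<^sub>R y) else 0) has_integral (I / c ^ DIM('a)))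
      (cbox ((- a) /\<^sub>R c) (a /\<^sub>R c))"
    by (simp only: mem add_0_right) (simp add: divide_inverse mult.commute del: mem_cball)
  have "cball x r \<subseteq> cbox ((- a) /\<^sub>R c) (a /\<^sub>R c)"
  proof
    fix y assume "y \<in> cball x r"
    then have "c *\<^sub>R y \<in> cbox (- a) a" using a mem by blast
    then show "y \<in> cbox ((- a) /\<^sub>R c) (a /\<^sub>R c)"
      using c by (auto simp: mem_box field_simps)
  qed
  from has_integral_restrict[OF this, of "\<lambda>y. f (c *\<^sub>R y)"] * show ?thesis by blast
qed

lemma mean_cball_dilate:
  fixes f :: "'a::euclidean_space \<Rightarrow> real"
  assumes "f integrable_on cball (c *\<^sub>R x) (c * r)" and c: "c > 0" and r: "r > 0"
  shows "integral (cball (c *\<^sub>R x) (c * r)) f / measure lebesgue (cball (c *\<^sub>R x) (c * r))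
       = integral (cball x r) (\<lambda>y. f (c *\<^sub>R y)) / measure lebesgue (cball x r)"
proof -
  have "integral (cball x r) (\<lambda>y. f (c *\<^sub>R y))
      = integral (cball (c *\<^sub>R x) (c * r)) f / c ^ DIM('a)"
    using has_integral_cball_dilate[OF integrable_integral[OF assms(1)] c] by (rule integral_unique)
  moreover have "measure lebesgue (cball (c *\<^sub>R x) (c * r)) = c ^ DIM('a) * measure lebesgue (cball x r)"
    using c r by (simp add: content_cball power_mult_distrib)
  ultimately show ?thesis using c by simp
qed

text \<open>
  It is enough to have the mean value inequality on one ball around each point: at a point of the
  compact set where a positive maximum is attained that is extremal in some direction, a ball would
  have to stay in that set.
\<close>

lemma weak_maximum_principle:
  fixes f :: "'a::euclidean_space \<Rightarrow> real"
  assumes "open S" and "bounded S" and cont: "continuous_on (closure S) f"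
    and mv: "\<And>x. x \<in> S \<Longrightarrow> \<exists>r>0. cball x r \<subseteq> S \<and>
               f x \<le> integral (cball x r) f / measure lebesgue (cball x r)"
    and bd: "\<And>x. x \<in> frontier S \<Longrightarrow> f x \<le> 0"
    and x: "x \<in> closure S"
  shows "f x \<le> 0"
proof (rule ccontr)
  assume neg: "\<not> f x \<le> 0"
  have cS: "compact (closure S)" using assms(2) by simp
  obtain m where m: "m \<in> closure S" "\<And>y. y \<in> closure S \<Longrightarrow> f y \<le> f m"
    using continuous_attains_sup[OF cS _ cont] x by (metis empty_iff)
  define A where "A = {y \<in> closure S. f y = f m}"
  have "closed A"
    unfolding A_def using continuous_closed_preimage_constant[OF cont closed_closure] by simp
  then have cA: "compact A"
    using cS by (auto simp: compact_eq_bounded_closed A_def intro: bounded_subset)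
  have AS: "A \<subseteq> S"
  proof
    fix y assume "y \<in> A"
    then have "y \<in> closure S" "f y > 0" using m(2)[OF x] neg by (auto simp: A_def)
    then show "y \<in> S" using bd[of y] \<open>open S\<close> by (force simp: frontier_def interior_open)
  qed
  obtain b :: 'a where b: "b \<in> Basis" using nonempty_Basis by blast
  have "m \<in> A" using m(1) by (simp add: A_def)
  moreover have "continuous_on A (\<lambda>y. y \<bullet> b)" by (intro continuous_intros)
  ultimately obtain z where z: "z \<in> A" "\<And>y. y \<in> A \<Longrightarrow> y \<bullet> b \<le> z \<bullet> b"
    using continuous_attains_sup[OF cA] by (metis empty_iff)
  obtain r where r: "r > 0" "cball z r \<subseteq> S"
    and mean: "f z \<le> integral (cball z r) f / measure lebesgue (cball z r)"
    using mv z(1) AS by blast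
  have rS: "cball z r \<subseteq> closure S" using r(2) closure_subset by blast
  define q where "q = z + (r/2) *\<^sub>R b"
  have q: "q \<in> ball z r" using r b by (simp add: q_def dist_norm)
  have "q \<notin> A"
    using z(2)[of q] r(1) b by (auto simp: q_def inner_add_left)
  moreover have "q \<in> closure S" using q rS by (meson ball_subset_cball subsetD)
  ultimately have fq: "f q < f m" using m(2)[of q] by (auto simp: A_def)
  define e where "e = (f m - f q) / 2"
  have e: "e > 0" using fq by (simp add: e_def)
  have "continuous_on (ball z r) f"
    using cont rS by (meson ball_subset_cball continuous_on_subset order_trans)
  then obtain d where d: "d > 0" "\<And>y. y \<in> ball z r \<Longrightarrow> dist y q < d \<Longrightarrow> dist (f y) (f q) < e"
    using q e unfolding continuous_on_iff by blast
  obtain d' where d': "d' > 0" "cball q d' \<subseteq> ball z r"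
    using q open_contains_cball[of "ball z r"] by (meson open_ball)
  define k where "k = min d' (d/2)"
  have k: "k > 0" "cball q k \<subseteq> ball z r" using d(1) d' by (auto simp: k_def)
  have kz: "cball q k \<subseteq> cball z r" using k(2) by (meson ball_subset_cball order_trans)
  have le: "e \<le> f m - f y" if "y \<in> cball q k" for y
  proof -
    have "y \<in> ball z r" using that k(2) by blast
    moreover have "dist y q < d" using that d(1) by (auto simp: k_def dist_commute)
    ultimately have "dist (f y) (f q) < e" by (rule d(2))
    then have "f y < f q + e" by (simp add: dist_real_def abs_less_iff)
    then show ?thesis by (simp add: e_def field_simps)
  qed
  have cz: "continuous_on (cball z r) f" using cont rS continuous_on_subset by blast
  have iz: "f integrable_on cball z r" using integrable_on_cball_continuous[OF cz] .
  have iz': "(\<lambda>y. f m - f y) integrable_on cball z r"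
    by (intro integrable_on_cball_continuous continuous_intros cz)
  have iq: "(\<lambda>y. f m - f y) integrable_on cball q k"
    by (intro integrable_on_cball_continuous continuous_intros continuous_on_subset[OF cz kz])
  have "e * measure lebesgue (cball q k) = integral (cball q k) (\<lambda>y. e)"
    using integral_mult_right[of "cball q k" e "\<lambda>_. 1"] by (simp add: lmeasure_integral[symmetric] lmeasurable_cball)
  also have "\<dots> \<le> integral (cball q k) (\<lambda>y. f m - f y)"
    using le by (intro integral_le iq integrable_on_cball_continuous continuous_intros) auto
  also have "\<dots> \<le> integral (cball z r) (\<lambda>y. f m - f y)"
    using rS m(2) by (intro integral_subset_le kz iq iz') auto
  also have "\<dots> = f m * measure lebesgue (cball z r) - integral (cball z r) f"
    using iz integral_mult_right[of "cball z r" "f m" "\<lambda>_. 1"]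
    by (subst integral_diff) (auto simp: lmeasure_integral[symmetric] lmeasurable_cball
        intro!: integrable_on_cball_continuous)
  also have "\<dots> \<le> 0"
  proof -
    have "f z = f m" using z(1) by (simp add: A_def)
    moreover have "measure lebesgue (cball z r) > 0" using content_cball_pos[OF r(1), of z] by simp
    ultimately show ?thesis using mean by (simp add: field_simps)
  qed
  finally have "e * measure lebesgue (cball q k) \<le> 0" .
  moreover have "0 < e * measure lebesgue (cball q k)"
    using content_cball_pos[OF k(1), of q] e by simp
  ultimately show False by linarith
qed

section \<open>Touching under dilation\<close>

lemma pos_set_Int_open:
  assumes "open U" and "continuous_on (closure U) v"
  shows "open (pos_set U v \<inter> U)"
proof -
  have "pos_set U v \<inter> U = {x \<in> U. 0 < v x}"
    using closure_subset by (auto simp: pos_set_def)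
  moreover have "openin (top_of_set U) (U \<inter> v -` {0<..})"
    using assms(2) closure_subset by (meson continuous_on_subset continuous_openin_preimage_gen open_greaterThan)
  ultimately show ?thesis
    using openin_open_trans[OF _ assms(1)] by (auto simp: vimage_def Int_def)
qed

lemma pos_set_subset_closure: "pos_set U v \<subseteq> closure U"
  by (auto simp: pos_set_def)

lemma free_bdry_iff:
  assumes "open U" and "continuous_on (closure U) v" and "\<And>x. x \<in> closure U \<Longrightarrow> 0 \<le> v x"
  shows "x \<in> free_bdry U v \<longleftrightarrow> x \<in> U \<and> v x = 0 \<and> x \<in> closure (pos_set U v)"
proof -
  have "x \<in> interior (pos_set U v) \<longleftrightarrow> v x > 0" if "x \<in> U"
  proof
    assume "x \<in> interior (pos_set U v)"
    then show "v x > 0" using interior_subset by (auto simp: pos_set_def)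
  next
    assume "v x > 0"
    then have "x \<in> pos_set U v \<inter> U" using that closure_subset by (auto simp: pos_set_def)
    then show "x \<in> interior (pos_set U v)"
      using pos_set_Int_open[OF assms(1,2)] by (meson Int_lower1 interiorI)
  qed
  moreover have "x \<in> U \<Longrightarrow> 0 \<le> v x" using assms(3) closure_subset by blast
  ultimately show ?thesis unfolding free_bdry_def frontier_def by force
qed

text \<open>
  Open sets whose closure is mapped into the set by every dilation with factor larger than one.
  Comparison is needed in \<open>U\<close> and, for the barrier, in a smaller exterior domain.
\<close>

locale dilation_domain =
  fixes U :: "'a::euclidean_space set" and r :: real
  assumes open_U: "open U" and r_pos: "r > 0" and away: "ball 0 r \<subseteq> - U"
    and dilate: "\<And>x \<mu>. x \<in> closure U \<Longrightarrow> 1 < \<mu> \<Longrightarrow> \<mu> *\<^sub>R x \<in> U"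
begin

lemma closure_away: "x \<in> closure U \<Longrightarrow> r \<le> norm x"
proof -
  assume "x \<in> closure U"
  moreover have "closure U \<subseteq> - ball 0 r"
    using away by (intro closure_minimal) auto
  ultimately show ?thesis by auto
qed

end

text \<open>
  The domain \<open>U\<close> may be unbounded; boundedness of the positivity set is what makes the maximum
  principle applicable.
\<close>

lemma subharmonic_le_boundary:
  assumes U: "open U" and f: "continuous_on (closure U) f" "\<And>x. x \<in> closure U \<Longrightarrow> 0 \<le> f x"
    and sub: "subharmonic_on (pos_set U f \<inter> U) f"
    and "0 \<le> b" and bd: "\<And>x. x \<in> frontier U \<Longrightarrow> f x \<le> b"
    and bdd: "bounded (pos_set U f)" and x: "x \<in> closure U"
  shows "f x \<le> b"
proof (cases "x \<in> pos_set U f \<inter> U")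
  case False
  then consider "x \<in> frontier U" | "f x \<le> 0"
    using x U by (force simp: frontier_def interior_open pos_set_def)
  then show ?thesis using bd \<open>0 \<le> b\<close> by cases auto
next
  case True
  let ?S = "pos_set U f \<inter> U"
  have S: "open ?S" by (rule pos_set_Int_open[OF U f(1)])
  have cl: "closure ?S \<subseteq> closure U" by (simp add: closure_mono)
  have "f x - b \<le> 0"
  proof (rule weak_maximum_principle[OF S])
    show "bounded ?S" using bdd bounded_subset by blast
    show "continuous_on (closure ?S) (\<lambda>x. f x - b)"
      by (intro continuous_intros continuous_on_subset[OF f(1) cl])
    show "\<exists>r>0. cball y r \<subseteq> ?S \<and>
        f y - b \<le> integral (cball y r) (\<lambda>x. f x - b) / measure lebesgue (cball y r)" if y: "y \<in> ?S" for y
    proof -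
      obtain r where r: "r > 0" "cball y r \<subseteq> ?S" using open_contains_cball_eq[OF S] y by metis
      have c: "continuous_on (cball y r) f"
        using r(2) f(1) pos_set_subset_closure by (metis continuous_on_subset le_inf_iff)
      have m: "measure lebesgue (cball y r) > 0" using content_cball_pos[OF r(1), of y] by simp
      have "integral (cball y r) (\<lambda>x. f x - b) = integral (cball y r) f - b * measure lebesgue (cball y r)"
        using integrable_on_cball_continuous[OF c] integral_mult_right[of "cball y r" b "\<lambda>_. 1"]
        by (subst integral_diff) (auto simp: lmeasure_integral[symmetric] lmeasurable_cball
           intro!: integrable_on_cball_continuous)
      moreover have "f y \<le> integral (cball y r) f / measure lebesgue (cball y r)"
        using sub r by (simp add: subharmonic_on_def)
      ultimately show ?thesis using r m by (auto simp: field_simps)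
    qed
    show "f y - b \<le> 0" if y: "y \<in> frontier ?S" for y
    proof (cases "y \<in> U")
      case True
      have "y \<in> closure U" using y cl by (auto simp: frontier_def)
      have "y \<notin> ?S" using y S unfolding frontier_def interior_open[OF S] by blast
      then have "f y \<le> 0" using True closure_subset by (force simp: pos_set_def)
      then show ?thesis using \<open>0 \<le> b\<close> by simp
    next
      case False
      then have "y \<in> frontier U" using y cl U by (auto simp: frontier_def interior_open)
      then show ?thesis using bd by simp
    qed
    show "x \<in> closure ?S" using True closure_subset by blast
  qed
  then show ?thesis by simp
qed


context dilation_domain
begin

text \<open>
  Comparison of a subharmonic function with a superharmonic one after a dilation that puts the
  positivity set of the former inside that of the latter.
\<close>

lemma dilation_comparison:
  assumes f: "continuous_on (closure U) f" "\<And>x. x \<in> closure U \<Longrightarrow> 0 \<le> f x"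
      "subharmonic_on (pos_set U f \<inter> U) f" "bounded (pos_set U f)"
      "\<And>x. x \<in> frontier U \<Longrightarrow> f x \<le> b"
    and h: "continuous_on (closure U) h" "\<And>x. x \<in> closure U \<Longrightarrow> 0 \<le> h x"
      "superharmonic_on (pos_set U h \<inter> U) h" "\<And>x. x \<in> frontier U \<Longrightarrow> b \<le> h x"
    and b: "0 \<le> b" and \<mu>: "1 < \<mu>"
    and sub: "\<And>x. x \<in> U \<Longrightarrow> 0 < f (\<mu> *\<^sub>R x) \<Longrightarrow> 0 < h x"
    and x: "x \<in> closure U"
  shows "f (\<mu> *\<^sub>R x) \<le> h x"
proof (cases "x \<in> U \<and> f (\<mu> *\<^sub>R x) > 0")
  case False
  have dx: "\<mu> *\<^sub>R x \<in> closure U" using dilate[OF x \<mu>] closure_subset by blast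
  consider "x \<in> frontier U" | "f (\<mu> *\<^sub>R x) \<le> 0"
    using False x open_U by (force simp: frontier_def interior_open)
  then show ?thesis
  proof cases
    case 1
    have "f (\<mu> *\<^sub>R x) \<le> b"
      by (rule subharmonic_le_boundary[OF open_U f(1,2,3) b f(5,4) dx])
    then show ?thesis using h(4)[OF 1] by simp
  next
    case 2
    then show ?thesis using h(2)[OF x] by simp
  qed
next
  case True
  let ?S = "{x \<in> U. f (\<mu> *\<^sub>R x) > 0}"
  let ?g = "\<lambda>x. f (\<mu> *\<^sub>R x) - h x"
  have Sf: "\<mu> *\<^sub>R y \<in> pos_set U f \<inter> U" and Sh: "y \<in> pos_set U h \<inter> U" if "y \<in> ?S" for y
    using that dilate[of y \<mu>] \<mu> closure_subset[of U] sub[of y] by (auto simp: pos_set_def)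
  have Of: "open (pos_set U f \<inter> U)" and Oh: "open (pos_set U h \<inter> U)"
    using pos_set_Int_open[OF open_U] f(1) h(1) by auto
  have Seq: "?S = U \<inter> (\<lambda>y. \<mu> *\<^sub>R y) -` (pos_set U f \<inter> U)"
    using Sf by (auto simp: pos_set_def)
  have S: "open ?S"
    unfolding Seq by (intro open_Int open_U open_vimage Of continuous_intros)
  have cl: "closure ?S \<subseteq> closure U" by (intro closure_mono) auto
  have dcl: "\<mu> *\<^sub>R y \<in> closure U" if "y \<in> closure U" for y
    using dilate[OF that \<mu>] closure_subset by blast
  have cg: "continuous_on (closure U) ?g"
    using dcl by (intro continuous_intros h(1) continuous_on_compose2[OF f(1)]) auto
  have "?g x \<le> 0"
  proof (rule weak_maximum_principle[OF S])
    have "?S \<subseteq> (\<lambda>y. y /\<^sub>R \<mu>) ` pos_set U f"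
    proof
      fix y assume "y \<in> ?S"
      then have "\<mu> *\<^sub>R y \<in> pos_set U f" "y = (\<mu> *\<^sub>R y) /\<^sub>R \<mu>" using Sf \<mu> by auto
      then show "y \<in> (\<lambda>y. y /\<^sub>R \<mu>) ` pos_set U f" by blast
    qed
    then show "bounded ?S" using bounded_scaling[OF f(4), of "inverse \<mu>"] bounded_subset by blast
    show "continuous_on (closure ?S) ?g" using cg cl continuous_on_subset by blast
    show "\<exists>r>0. cball y r \<subseteq> ?S \<and>
        ?g y \<le> integral (cball y r) ?g / measure lebesgue (cball y r)" if y: "y \<in> ?S" for y
    proof -
      obtain r where r: "r > 0" "cball y r \<subseteq> ?S"
        using open_contains_cball_eq[OF S] y by metis
      have rh: "cball y r \<subseteq> pos_set U h \<inter> U" using Sh r(2) by blast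
      have rf: "cball (\<mu> *\<^sub>R y) (\<mu> * r) \<subseteq> pos_set U f \<inter> U"
      proof
        fix z assume z: "z \<in> cball (\<mu> *\<^sub>R y) (\<mu> * r)"
        have "norm (\<mu> *\<^sub>R y - z) = \<mu> * norm (y - z /\<^sub>R \<mu>)"
          using \<mu> norm_scaleR[of \<mu> "y - z /\<^sub>R \<mu>"] by (simp add: scaleR_diff_right)
        then have "z /\<^sub>R \<mu> \<in> cball y r" using z \<mu> by (simp add: dist_norm)
        then show "z \<in> pos_set U f \<inter> U" using Sf[of "z /\<^sub>R \<mu>"] r(2) \<mu> by auto
      qed
      have cf: "continuous_on (cball (\<mu> *\<^sub>R y) (\<mu> * r)) f"
        using rf f(1) pos_set_subset_closure by (metis continuous_on_subset le_inf_iff)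
      have ch: "continuous_on (cball y r) h"
        using rh h(1) pos_set_subset_closure by (metis continuous_on_subset le_inf_iff)
      have cf': "continuous_on (cball y r) (\<lambda>x. f (\<mu> *\<^sub>R x))"
      proof (rule continuous_on_compose2[OF f(1)])
        show "(\<lambda>x. \<mu> *\<^sub>R x) ` cball y r \<subseteq> closure U"
          using rh dcl closure_subset[of U] by blast
      qed (intro continuous_intros)
      have "f (\<mu> *\<^sub>R y) \<le> integral (cball (\<mu> *\<^sub>R y) (\<mu> * r)) f / measure lebesgue (cball (\<mu> *\<^sub>R y) (\<mu> * r))"
        using f(3) rf r(1) \<mu> by (simp add: subharmonic_on_def)
      also have "\<dots> = integral (cball y r) (\<lambda>x. f (\<mu> *\<^sub>R x)) / measure lebesgue (cball y r)"
        using mean_cball_dilate[OF integrable_on_cball_continuous[OF cf]] \<mu> r(1) by simp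
      finally have 1: "f (\<mu> *\<^sub>R y) \<le> integral (cball y r) (\<lambda>x. f (\<mu> *\<^sub>R x)) / measure lebesgue (cball y r)" .
      have "- h y \<le> integral (cball y r) (\<lambda>x. - h x) / measure lebesgue (cball y r)"
        using h(3) rh r(1) by (simp add: superharmonic_on_def subharmonic_on_def)
      then have 2: "integral (cball y r) h / measure lebesgue (cball y r) \<le> h y" by simp
      have "integral (cball y r) ?g = integral (cball y r) (\<lambda>x. f (\<mu> *\<^sub>R x)) - integral (cball y r) h"
        by (intro integral_diff integrable_on_cball_continuous cf' ch)
      then show ?thesis using 1 2 r by (auto simp: diff_divide_distrib)
    qed
    show "?g y \<le> 0" if y: "y \<in> frontier ?S" for y
    proof -
      have yc: "y \<in> closure U" using y cl by (auto simp: frontier_def)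
      have "y \<notin> ?S" using y unfolding frontier_def interior_open[OF S] by blast
      then consider "y \<in> frontier U" | "f (\<mu> *\<^sub>R y) \<le> 0"
        using yc open_U by (force simp: frontier_def interior_open)
      then show ?thesis
      proof cases
        case 1
        have "f (\<mu> *\<^sub>R y) \<le> b"
          by (rule subharmonic_le_boundary[OF open_U f(1,2,3) b f(5,4) dcl[OF yc]])
        then show ?thesis using h(4)[OF 1] by simp
      next
        case 2
        then show ?thesis using h(2)[OF yc] by simp
      qed
    qed
    show "x \<in> closure ?S" using True closure_subset[of ?S] by blast
  qed
  then show ?thesis by simp
qed

text \<open>
  If the dilated positivity set of \<open>f\<close> reaches the zero set of \<open>h\<close>, then at the largest dilation
  factor for which this happens the two functions are ordered and touch at a free boundary point
  of both.
\<close>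

lemma dilation_touching:
  assumes f: "continuous_on (closure U) f" "\<And>x. x \<in> closure U \<Longrightarrow> 0 \<le> f x"
      "subharmonic_on (pos_set U f \<inter> U) f" "bounded (pos_set U f)"
      "\<And>x. x \<in> frontier U \<Longrightarrow> f x \<le> b"
    and h: "continuous_on (closure U) h" "\<And>x. x \<in> closure U \<Longrightarrow> 0 \<le> h x"
      "superharmonic_on (pos_set U h \<inter> U) h" "\<And>x. x \<in> frontier U \<Longrightarrow> b \<le> h x"
    and b: "0 < b" and \<kappa>: "1 < \<kappa>"
    and x1: "x1 \<in> closure U" "\<kappa> *\<^sub>R x1 \<in> closure (pos_set U f)" "h x1 \<le> 0"
  obtains \<mu> x0 where "\<kappa> \<le> \<mu>" "x0 \<in> free_bdry U h" "\<mu> *\<^sub>R x0 \<in> free_bdry U f"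
    "\<And>x. x \<in> closure U \<Longrightarrow> f (\<mu> *\<^sub>R x) \<le> h x"
    "\<And>x. x \<in> U \<Longrightarrow> 0 < f (\<mu> *\<^sub>R x) \<Longrightarrow> 0 < h x"
proof -
  define Z where "Z = {x \<in> closure U. h x = 0}"
  define A where "A = {z. fst z \<in> {\<kappa>..} \<and> snd z \<in> Z \<and> fst z *\<^sub>R snd z \<in> closure (pos_set U f)}"
  have cZ: "closed Z"
    unfolding Z_def by (rule continuous_closed_preimage_constant[OF h(1) closed_closure])
  have "closed ((fst -` {\<kappa>..}) \<inter> (snd -` Z) \<inter> (\<lambda>z. fst z *\<^sub>R snd z) -` closure (pos_set U f))"
    by (intro closed_Int closed_vimage cZ closed_closure closed_atLeast continuous_intros)
  also have "(fst -` {\<kappa>..}) \<inter> (snd -` Z) \<inter> (\<lambda>z. fst z *\<^sub>R snd z) -` closure (pos_set U f) = A"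
    by (auto simp: A_def)
  finally have clA: "closed A" .
  obtain M where M: "\<And>y. y \<in> closure (pos_set U f) \<Longrightarrow> norm y \<le> M"
    using bounded_closure[OF f(4)] unfolding bounded_iff by blast
  have "A \<subseteq> {\<kappa>..M / r} \<times> cball 0 M"
  proof (clarsimp simp: A_def Z_def)
    fix s x assume s: "\<kappa> \<le> s" and x: "x \<in> closure U" "s *\<^sub>R x \<in> closure (pos_set U f)"
    have "s * norm x \<le> M" using M[OF x(2)] s \<kappa> by simp
    moreover have "r \<le> norm x" using closure_away x(1) by blast
    moreover have "s * r \<le> s * norm x" using s \<kappa> \<open>r \<le> norm x\<close> by simp
    moreover have "1 * norm x \<le> s * norm x" using s \<kappa> by (intro mult_right_mono) auto
    ultimately show "s \<le> M / r \<and> norm x \<le> M" using r_pos by (simp add: field_simps)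
  qed
  then have "bounded A" using bounded_subset bounded_Times[OF bounded_closed_interval bounded_cball]
    by (metis)
  then have "compact A" using clA by (simp add: compact_eq_bounded_closed)
  moreover have "(\<kappa>, x1) \<in> A" using x1 h(2)[OF x1(1)] by (auto simp: A_def Z_def)
  moreover have "continuous_on A fst" by (intro continuous_intros)
  ultimately obtain z where z: "z \<in> A" "\<And>y. y \<in> A \<Longrightarrow> fst y \<le> fst z"
    using continuous_attains_sup[of A fst] by (metis empty_iff)
  define \<mu> x0 where "\<mu> = fst z" and "x0 = snd z"
  have \<mu>: "\<kappa> \<le> \<mu>" "1 < \<mu>" and x0: "x0 \<in> closure U" "h x0 = 0" "\<mu> *\<^sub>R x0 \<in> closure (pos_set U f)"
    using z(1) \<kappa> by (auto simp: A_def Z_def \<mu>_def x0_def)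
  have max: "s \<le> \<mu>" if "\<kappa> \<le> s" "x \<in> closure U" "h x = 0" "s *\<^sub>R x \<in> closure (pos_set U f)" for s x
    using z(2)[of "(s, x)"] that by (auto simp: A_def Z_def \<mu>_def)
  have pos: "0 < h x" if x: "x \<in> closure U" "0 < f (\<mu> *\<^sub>R x)" for x
  proof (rule ccontr)
    assume "\<not> 0 < h x"
    then have hx: "h x = 0" using h(2)[OF x(1)] by simp
    have O: "open (pos_set U f \<inter> U)" by (rule pos_set_Int_open[OF open_U f(1)])
    have "\<mu> *\<^sub>R x \<in> pos_set U f \<inter> U"
      using dilate[OF x(1) \<mu>(2)] x(2) closure_subset by (auto simp: pos_set_def)
    then have "\<mu> \<in> (\<lambda>s. s *\<^sub>R x) -` (pos_set U f \<inter> U)" by simp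
    moreover have "open ((\<lambda>s. s *\<^sub>R x) -` (pos_set U f \<inter> U))"
      by (intro open_vimage O continuous_intros)
    ultimately obtain e where e: "e > 0" "ball \<mu> e \<subseteq> (\<lambda>s. s *\<^sub>R x) -` (pos_set U f \<inter> U)"
      using open_contains_ball by metis
    have "\<mu> + e/2 \<in> ball \<mu> e" using e(1) by (simp add: dist_real_def)
    then have "(\<mu> + e/2) *\<^sub>R x \<in> pos_set U f" using e(2) by blast
    then show False using max[of "\<mu> + e/2" x] x(1) hx \<mu> e(1) closure_subset by fastforce
  qed
  have x0U: "x0 \<in> U"
    using x0 b h(4)[of x0] open_U by (force simp: frontier_def interior_open)
  have y0U: "\<mu> *\<^sub>R x0 \<in> U" using dilate[OF x0(1) \<mu>(2)] .
  have "f (\<mu> *\<^sub>R x0) = 0"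
    using pos[OF x0(1)] x0(2) f(2)[of "\<mu> *\<^sub>R x0"] y0U closure_subset[of U] by force
  then have "\<mu> *\<^sub>R x0 \<in> free_bdry U f"
    using free_bdry_iff[OF open_U f(1,2)] y0U x0(3) by simp
  moreover have "x0 \<in> closure (pos_set U h)"
    unfolding closure_approachable
  proof (intro allI impI)
    fix e :: real assume e: "e > 0"
    obtain d where d: "d > 0" "ball x0 d \<subseteq> U" using open_U x0U open_contains_ball by metis
    define e' where "e' = min e d"
    have e': "e' > 0" using e d by (simp add: e'_def)
    then have "\<mu> * e' > 0" using \<mu> by simp
    then obtain y where y: "y \<in> pos_set U f" "dist y (\<mu> *\<^sub>R x0) < \<mu> * e'"
      using x0(3) unfolding closure_approachable by blast
    have "norm (y - \<mu> *\<^sub>R x0) = \<mu> * norm (y /\<^sub>R \<mu> - x0)"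
      using \<mu> norm_scaleR[of \<mu> "y /\<^sub>R \<mu> - x0"] by (simp add: scaleR_diff_right)
    then have 1: "dist (y /\<^sub>R \<mu>) x0 < e'" using y(2) \<mu> by (simp add: dist_norm)
    then have "y /\<^sub>R \<mu> \<in> U" using d(2) by (auto simp: e'_def dist_commute)
    then have "y /\<^sub>R \<mu> \<in> pos_set U h"
      using pos[of "y /\<^sub>R \<mu>"] y(1) \<mu> closure_subset[of U] by (auto simp: pos_set_def)
    then show "\<exists>y\<in>pos_set U h. dist y x0 < e" using 1 by (auto simp: e'_def)
  qed
  then have "x0 \<in> free_bdry U h" using free_bdry_iff[OF open_U h(1,2)] x0U x0(2) by simp
  moreover have "f (\<mu> *\<^sub>R x) \<le> h x" if "x \<in> closure U" for x
  proof (rule dilation_comparison[OF f h])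
    show "0 < h x" if "x \<in> U" "0 < f (\<mu> *\<^sub>R x)" for x
      using pos that closure_subset by blast
  qed (use b \<mu> that in auto)
  moreover have "0 < h x" if "x \<in> U" "0 < f (\<mu> *\<^sub>R x)" for x
    using pos that closure_subset by blast
  ultimately show ?thesis using that \<mu>(1) by blast
qed

end

section \<open>Strongly star-shaped sets and their radial function\<close>

lemma strongly_star_shaped_interior:
  fixes D :: "'a::euclidean_space set"
  assumes "strongly_star_shaped D" and x: "x \<in> closure D" and s: "0 \<le> s" "s < 1"
  shows "s *\<^sub>R x \<in> interior D"
proof -
  obtain r where r: "r > 0" and star: "\<And>z y. z \<in> ball 0 r \<Longrightarrow> y \<in> D \<Longrightarrow> closed_segment z y \<subseteq> D"
    using assms(1) unfolding strongly_star_shaped_def star_shaped_wrt_def by metis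
  define d where "d = (1 - s) * r / 2"
  have d: "d > 0" using r s by (simp add: d_def)
  obtain y where y: "y \<in> D" "dist y x < d"
    using x d unfolding closure_approachable by blast
  have "ball (s *\<^sub>R x) d \<subseteq> D"
  proof
    fix z assume z: "z \<in> ball (s *\<^sub>R x) d"
    define b where "b = (z - s *\<^sub>R y) /\<^sub>R (1 - s)"
    have "norm (z - s *\<^sub>R y) \<le> norm (z - s *\<^sub>R x) + norm (s *\<^sub>R x - s *\<^sub>R y)"
      by (metis dist_norm dist_triangle)
    also have "norm (s *\<^sub>R x - s *\<^sub>R y) = s * norm (x - y)"
      using s by (simp flip: scaleR_diff_right)
    also have "norm (z - s *\<^sub>R x) < d" using z by (simp add: dist_norm norm_minus_commute)
    also have "s * norm (x - y) \<le> 1 * d"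
      using y(2) s d by (intro mult_mono) (auto simp: dist_norm norm_minus_commute)
    finally have "norm (z - s *\<^sub>R y) < (1 - s) * r" by (simp add: d_def mult.commute)
    then have "b \<in> ball 0 r" using s unfolding b_def by (simp add: mult.commute[of r] mem_ball dist_norm del: scaleR_diff_right) (simp add: field_simps del: scaleR_diff_right)
    moreover have "z = (1 - s) *\<^sub>R b + s *\<^sub>R y" using s by (simp add: b_def)
    then have "z \<in> closed_segment b y" using s unfolding in_segment by auto
    ultimately show "z \<in> D" using star y(1) by blast
  qed
  then show ?thesis using d by (meson centre_in_ball interior_maximal open_ball subsetD)
qed

text \<open>
  The largest factor by which \<open>x\<close> can be multiplied without leaving the closure of \<open>D\<close>; it is the
  reciprocal of the Minkowski functional.  The value at \<open>x = 0\<close>, where the set of factors is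
  unbounded, is irrelevant.
\<close>

definition radial :: "'a::euclidean_space set \<Rightarrow> 'a \<Rightarrow> real" where
  "radial D x = Sup {s. s *\<^sub>R x \<in> closure D}"

locale star_body =
  fixes D :: "'a::euclidean_space set"
  assumes bounded_D: "bounded D" and star_D: "strongly_star_shaped D"
begin

lemma zero_interior: "0 \<in> interior D"
proof -
  obtain r where r: "r > 0" "\<And>z. z \<in> ball 0 r \<Longrightarrow> z \<in> D"
    using star_D unfolding strongly_star_shaped_def star_shaped_wrt_def by metis
  then have "ball 0 r \<subseteq> D" by blast
  then show ?thesis using r(1) by (meson centre_in_ball interior_maximal open_ball subsetD)
qed

lemma radial_frontier_pos:
  assumes "x \<noteq> 0"
  shows "radial D x *\<^sub>R x \<in> frontier D" and "0 < radial D x"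
    and "\<And>s. s *\<^sub>R x \<in> closure D \<Longrightarrow> s \<le> radial D x"
proof -
  let ?A = "{s. s *\<^sub>R x \<in> closure D}"
  obtain M where M: "\<And>y. y \<in> closure D \<Longrightarrow> norm y \<le> M"
    using bounded_closure[OF bounded_D] unfolding bounded_iff by blast
  have le: "s \<le> M / norm x" if "s \<in> ?A" for s
  proof -
    have "s * norm x \<le> \<bar>s\<bar> * norm x" by (intro mult_right_mono) auto
    also have "\<dots> \<le> M" using M[of "s *\<^sub>R x"] that by simp
    finally show ?thesis using assms by (simp add: field_simps)
  qed
  then have bdd: "bdd_above ?A" by (rule bdd_aboveI)
  have "closed ((\<lambda>s. s *\<^sub>R x) -` closure D)" by (intro closed_vimage continuous_intros) auto
  then have cl: "closed ?A" by (simp add: vimage_def)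
  have ne: "0 \<in> ?A" using zero_interior interior_subset closure_subset by auto
  have k: "radial D x \<in> ?A"
    unfolding radial_def using closed_contains_Sup[OF _ bdd cl] ne by blast
  show up: "s \<le> radial D x" if "s *\<^sub>R x \<in> closure D" for s
    unfolding radial_def using cSup_upper[OF _ bdd] that by simp
  have no: "s *\<^sub>R x \<notin> interior D" if "s \<ge> radial D x" for s
  proof
    assume "s *\<^sub>R x \<in> interior D"
    then have "s \<in> (\<lambda>s. s *\<^sub>R x) -` interior D" by simp
    moreover have "open ((\<lambda>s. s *\<^sub>R x) -` interior D)"
      by (intro open_vimage continuous_intros) auto
    ultimately obtain e where e: "e > 0" "ball s e \<subseteq> (\<lambda>s. s *\<^sub>R x) -` interior D"
      using open_contains_ball by metis
    have "s + e/2 \<in> ball s e" using e(1) by (simp add: dist_real_def)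
    then have "(s + e/2) *\<^sub>R x \<in> closure D" using e(2) interior_subset closure_subset by blast
    then show False using up[of "s + e/2"] e(1) that by simp
  qed
  show "radial D x *\<^sub>R x \<in> frontier D" using k no[of "radial D x"] by (simp add: frontier_def)
  have "0 \<le> radial D x" using up[of 0] ne by simp
  moreover have "radial D x \<noteq> 0" using no[of 0] zero_interior by auto
  ultimately show "0 < radial D x" by simp
qed

lemma in_closure_iff:
  assumes "x \<noteq> 0" shows "x \<in> closure D \<longleftrightarrow> 1 \<le> radial D x"
proof
  show "1 \<le> radial D x" if "x \<in> closure D"
    using radial_frontier_pos(3)[OF assms, of 1] that by simp
next
  assume 1: "1 \<le> radial D x"
  have f: "radial D x *\<^sub>R x \<in> closure D"
    using radial_frontier_pos(1)[OF assms] by (simp add: frontier_def)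
  show "x \<in> closure D"
  proof (cases "radial D x = 1")
    case True then show ?thesis using f by simp
  next
    case False
    then have "(1 / radial D x) *\<^sub>R (radial D x *\<^sub>R x) \<in> interior D"
      using 1 by (intro strongly_star_shaped_interior[OF star_D f]) auto
    then show ?thesis using 1 interior_subset closure_subset by auto
  qed
qed

lemma in_interior_iff:
  assumes "x \<noteq> 0" shows "x \<in> interior D \<longleftrightarrow> 1 < radial D x"
proof
  assume i: "x \<in> interior D"
  then have "x \<in> closure D" using interior_subset closure_subset by blast
  then have "1 \<le> radial D x" using in_closure_iff[OF assms] by simp
  moreover have "radial D x \<noteq> 1"
    using i radial_frontier_pos(1)[OF assms] by (auto simp: frontier_def)
  ultimately show "1 < radial D x" by simp
next
  assume 1: "1 < radial D x"
  have f: "radial D x *\<^sub>R x \<in> closure D"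
    using radial_frontier_pos(1)[OF assms] by (simp add: frontier_def)
  have "(1 / radial D x) *\<^sub>R (radial D x *\<^sub>R x) \<in> interior D"
    using 1 by (intro strongly_star_shaped_interior[OF star_D f]) auto
  then show "x \<in> interior D" using 1 by simp
qed

lemma in_frontier_iff:
  assumes "x \<noteq> 0" shows "x \<in> frontier D \<longleftrightarrow> radial D x = 1"
  using in_closure_iff[OF assms] in_interior_iff[OF assms] by (auto simp: frontier_def)

lemma radial_scale:
  assumes "x \<noteq> 0" "0 < s"
  shows "radial D (s *\<^sub>R x) = radial D x / s"
proof (rule antisym)
  have nz: "s *\<^sub>R x \<noteq> 0" using assms by simp
  have cl: "radial D y *\<^sub>R y \<in> closure D" if "y \<noteq> 0" for y
    using radial_frontier_pos(1)[OF that] by (simp add: frontier_def)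
  have "(radial D x / s) *\<^sub>R (s *\<^sub>R x) \<in> closure D" using cl[OF assms(1)] assms by simp
  then show "radial D x / s \<le> radial D (s *\<^sub>R x)" by (rule radial_frontier_pos(3)[OF nz])
  have "(radial D (s *\<^sub>R x) * s) *\<^sub>R x \<in> closure D" using cl[OF nz] by simp
  then have "radial D (s *\<^sub>R x) * s \<le> radial D x" by (rule radial_frontier_pos(3)[OF assms(1)])
  then show "radial D (s *\<^sub>R x) \<le> radial D x / s" using assms by (simp add: field_simps)
qed

lemma isCont_radial:
  assumes "x \<noteq> 0" shows "isCont (radial D) x"
proof -
  have ev0: "eventually (\<lambda>y. y \<noteq> 0) (nhds x)"
    using assms by (intro eventually_nhds[THEN iffD2]) (auto intro!: exI[of _ "- {0}"])
  have "filterlim (radial D) (nhds (radial D x)) (nhds x)"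
  proof (rule order_tendstoI)
    fix a assume a: "a < radial D x"
    define b where "b = max a (radial D x / 2)"
    have b: "0 < b" "b < radial D x" "a \<le> b"
      using a radial_frontier_pos(2)[OF assms] by (auto simp: b_def)
    have "b *\<^sub>R x \<in> interior D"
      using b assms by (subst in_interior_iff) (auto simp: radial_scale)
    moreover have "open ((\<lambda>y. b *\<^sub>R y) -` interior D)" by (intro open_vimage continuous_intros) auto
    ultimately have "eventually (\<lambda>y. b *\<^sub>R y \<in> interior D) (nhds x)"
      unfolding eventually_nhds by (intro exI[of _ "(\<lambda>y. b *\<^sub>R y) -` interior D"]) auto
    then show "eventually (\<lambda>y. a < radial D y) (nhds x)"
      using ev0
    proof eventually_elim
      case (elim y)
      then have "1 < radial D (b *\<^sub>R y)" using in_interior_iff[of "b *\<^sub>R y"] b(1) by simp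
      then have "b < radial D y" using elim b(1) by (simp add: radial_scale)
      then show ?case using b(3) by simp
    qed
  next
    fix b assume b: "radial D x < b"
    have b0: "0 < b" using b radial_frontier_pos(2)[OF assms] by simp
    have "b *\<^sub>R x \<in> - closure D"
      using b b0 assms by (simp add: in_closure_iff radial_scale)
    moreover have "open ((\<lambda>y. b *\<^sub>R y) -` (- closure D))" by (intro open_vimage continuous_intros) auto
    ultimately have "eventually (\<lambda>y. b *\<^sub>R y \<notin> closure D) (nhds x)"
      unfolding eventually_nhds by (intro exI[of _ "(\<lambda>y. b *\<^sub>R y) -` (- closure D)"]) auto
    then show "eventually (\<lambda>y. radial D y < b) (nhds x)"
      using ev0
    proof eventually_elim
      case (elim y)
      then have "\<not> 1 \<le> radial D (b *\<^sub>R y)" using in_closure_iff[of "b *\<^sub>R y"] b0 by simp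
      then show ?case using elim b0 by (simp add: radial_scale)
    qed
  qed
  then show ?thesis unfolding isCont_def by (rule filterlim_mono) (auto simp: at_within_le_nhds)
qed

lemma continuous_on_radial: "0 \<notin> S \<Longrightarrow> continuous_on S (radial D)"
  by (intro continuous_at_imp_continuous_on ballI isCont_radial) auto

lemma frontier_compact: "compact (frontier D)"
  using bounded_D by (simp add: compact_frontier_bounded)

lemma frontier_nonempty: "frontier D \<noteq> {}"
proof -
  obtain b :: 'a where "b \<in> Basis" using nonempty_Basis by blast
  then have "b \<noteq> 0" by auto
  then show ?thesis using radial_frontier_pos(1) by blast
qed

end

text \<open>
  The infimum defining the distance to \<open>B\<close> is attained, and compactness of \<open>A\<close> keeps the supremum in
  \<open>hausdorff_distance\<close> finite.
\<close>

lemma hausdorff_distance_nearby: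
  fixes A B :: "'a::euclidean_space set"
  assumes "compact A" "compact B" "B \<noteq> {}" "x \<in> A"
  obtains y where "y \<in> B" "dist x y \<le> hausdorff_distance A B"
proof -
  obtain y where y: "y \<in> B" "infdist x B = dist x y"
    using infdist_attains_inf[of B x] assms compact_imp_closed by metis
  have "bdd_above ((\<lambda>x. infdist x B) ` A)"
  proof -
    have "compact ((\<lambda>x. infdist x B) ` A)"
      using assms(1) by (intro compact_continuous_image continuous_intros)
    then show ?thesis by (simp add: bounded_imp_bdd_above compact_imp_bounded)
  qed
  then have "infdist x B \<le> (SUP x\<in>A. infdist x B)" using assms(4) by (intro cSUP_upper)
  also have "\<dots> \<le> hausdorff_distance A B" by (simp add: hausdorff_distance_def)
  finally show ?thesis using that y by metis
qed

section \<open>Evolutions with star-shaped positivity sets\<close>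

text \<open>
  The regularity that is used of the evolution \<open>w\<close>: the positivity sets with \<open>K\<close> filled in are bounded and strongly
  star-shaped, their boundaries move with finite speed, and \<open>G\<close> is the gradient of \<open>w\<close>,
  continuous up to the boundary.
\<close>

locale star_evolution =
  fixes U :: "'a::euclidean_space set" and T :: real and w :: "real \<Rightarrow> 'a \<Rightarrow> real"
    and G :: "real \<Rightarrow> 'a \<Rightarrow> 'a" and L :: real
  assumes open_U: "open U" and star_K: "strongly_star_shaped (- U)" and bounded_K: "bounded (- U)"
    and cont: "\<And>t. t \<in> {0..T} \<Longrightarrow> continuous_on (closure U) (w t)"
    and nonneg: "\<And>t x. t \<in> {0..T} \<Longrightarrow> x \<in> closure U \<Longrightarrow> 0 \<le> w t x"
    and bounded_pos: "\<And>t. t \<in> {0..T} \<Longrightarrow> bounded (pos_set U (w t) \<union> - U)"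
    and star: "\<And>t. t \<in> {0..T} \<Longrightarrow> strongly_star_shaped (pos_set U (w t) \<union> - U)"
    and speed: "\<And>s t. s \<in> {0..T} \<Longrightarrow> t \<in> {0..T} \<Longrightarrow>
        hausdorff_distance (frontier (pos_set U (w s) \<union> - U)) (frontier (pos_set U (w t) \<union> - U))
          \<le> L * \<bar>s - t\<bar>"
    and gradient: "\<And>t x. t \<in> {0..T} \<Longrightarrow> x \<in> pos_set U (w t) \<inter> U \<Longrightarrow> GDERIV (w t) x :> G t x"
    and cont_gradient: "continuous_on {(t, x). t \<in> {0..T} \<and> x \<in> closure (pos_set U (w t))}
        (\<lambda>(t, x). G t x)"
begin

abbreviation D :: "real \<Rightarrow> 'a set" where "D t \<equiv> pos_set U (w t) \<union> - U"
abbreviation \<rho> :: "real \<Rightarrow> 'a \<Rightarrow> real" where "\<rho> t x \<equiv> radial (D t) x"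

lemma body: "t \<in> {0..T} \<Longrightarrow> star_body (D t)"
  using bounded_pos star by (simp add: star_body_def)

lemma dilate_U: "x \<in> closure U \<Longrightarrow> 1 < \<mu> \<Longrightarrow> \<mu> *\<^sub>R x \<in> U"
proof (rule ccontr)
  assume x: "x \<in> closure U" "1 < \<mu>" and "\<mu> *\<^sub>R x \<notin> U"
  then have "\<mu> *\<^sub>R x \<in> closure (- U)" using closure_subset by blast
  then have "(1 / \<mu>) *\<^sub>R (\<mu> *\<^sub>R x) \<in> interior (- U)"
    using x(2) by (intro strongly_star_shaped_interior[OF star_K]) auto
  then show False using x by (simp add: interior_closure)
qed

lemma zero_notin_U: "0 \<notin> closure U"
  using star_body.zero_interior[of "- U"] star_K bounded_K by (simp add: star_body_def interior_closure)

lemma U_away: obtains r where "dilation_domain U r"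
proof -
  have "0 \<in> interior (- U)" using zero_notin_U by (simp add: interior_closure)
  then obtain r where "r > 0" "ball 0 r \<subseteq> - U" unfolding mem_interior by blast
  then show ?thesis using that dilate_U open_U by (simp add: dilation_domain_def)
qed

lemma pos_imp_interior:
  assumes "t \<in> {0..T}" "x \<in> closure U" "0 < w t x"
  shows "x \<in> interior (D t)"
proof -
  obtain d where d: "d > 0" "\<And>y. y \<in> closure U \<Longrightarrow> dist y x < d \<Longrightarrow> dist (w t y) (w t x) < w t x"
    using cont[OF assms(1)] assms(2,3) unfolding continuous_on_iff by blast
  have "ball x d \<subseteq> D t"
  proof
    fix y assume y: "y \<in> ball x d"
    show "y \<in> D t"
    proof (cases "y \<in> closure U")
      case True
      then have "dist (w t y) (w t x) < w t x" using d(2)[OF True] y by (simp add: dist_commute[of y x])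
      then have "w t y > 0" by (simp add: dist_real_def abs_less_iff)
      then show ?thesis using True by (simp add: pos_set_def)
    next
      case False then show ?thesis using closure_subset by blast
    qed
  qed
  then show ?thesis using d(1) by (meson centre_in_ball interior_maximal open_ball subsetD)
qed

lemma pos_iff:
  assumes "t \<in> {0..T}" "x \<in> U"
  shows "0 < w t x \<longleftrightarrow> 1 < \<rho> t x"
proof -
  have x: "x \<noteq> 0" "x \<in> closure U" using assms(2) zero_notin_U closure_subset by auto
  have "x \<in> interior (D t) \<Longrightarrow> 0 < w t x"
    using assms(2) interior_subset by (auto simp: pos_set_def)
  then show ?thesis
    using star_body.in_interior_iff[OF body[OF assms(1)] x(1)] pos_imp_interior[OF assms(1) x(2)]
    by blast
qed

lemma closure_pos_iff:
  assumes "t \<in> {0..T}" "x \<in> U"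
  shows "x \<in> closure (pos_set U (w t)) \<longleftrightarrow> 1 \<le> \<rho> t x"
proof -
  have x: "x \<noteq> 0" using assms(2) zero_notin_U closure_subset by auto
  have "x \<in> closure (D t) \<longleftrightarrow> x \<in> closure (pos_set U (w t))"
    using assms(2) open_U by (simp add: closure_Un closure_closed closed_Compl)
  then show ?thesis using star_body.in_closure_iff[OF body[OF assms(1)] x] by simp
qed

lemma free_bdry_radial:
  assumes "t \<in> {0..T}"
  shows "x \<in> free_bdry U (w t) \<longleftrightarrow> x \<in> U \<and> \<rho> t x = 1"
  using free_bdry_iff[OF open_U cont[OF assms] nonneg[OF assms]] pos_iff[OF assms, of x]
    closure_pos_iff[OF assms, of x] nonneg[OF assms, of x] closure_subset[of U] by fastforce

lemma radial_pos: "t \<in> {0..T} \<Longrightarrow> x \<noteq> 0 \<Longrightarrow> 0 < \<rho> t x"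
  using star_body.radial_frontier_pos(2)[OF body] .

lemma radial_dilate: "t \<in> {0..T} \<Longrightarrow> x \<noteq> 0 \<Longrightarrow> 0 < s \<Longrightarrow> \<rho> t (s *\<^sub>R x) = \<rho> t x / s"
  using star_body.radial_scale[OF body] .

text \<open>
  Finite speed of the boundaries in Hausdorff distance gives continuity in time of the radial
  function, uniformly over all directions.
\<close>

lemma radial_ratio:
  assumes t: "t \<in> {0..T}" and e: "e > 0"
  obtains d where "d > 0"
    "\<And>s x. s \<in> {0..T} \<Longrightarrow> \<bar>s - t\<bar> < d \<Longrightarrow> x \<noteq> 0 \<Longrightarrow> \<bar>\<rho> t x / \<rho> s x - 1\<bar> < e"
proof -
  interpret B: star_body "D t" by (rule body[OF t])
  have fr0: "0 \<notin> frontier (D t)" using B.zero_interior by (simp add: frontier_def)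
  have "\<exists>d>0. \<forall>y\<in>frontier (D t). \<forall>x. dist x y < d \<longrightarrow> x \<noteq> 0 \<longrightarrow> \<bar>\<rho> t x - 1\<bar> < e"
  proof (rule ccontr)
    assume "\<not> ?thesis"
    then have "\<forall>n. \<exists>y x. y \<in> frontier (D t) \<and> dist x y < inverse (Suc n) \<and> x \<noteq> 0 \<and> \<not> \<bar>\<rho> t x - 1\<bar> < e"
      by (metis inverse_positive_iff_positive of_nat_0_less_iff zero_less_Suc)
    then obtain y x where yx: "\<And>n. y n \<in> frontier (D t)" "\<And>n. dist (x n) (y n) < inverse (Suc n)"
      "\<And>n. \<not> \<bar>\<rho> t (x n) - 1\<bar> < e" by metis
    obtain l k where l: "l \<in> frontier (D t)" "strict_mono (k :: nat \<Rightarrow> nat)" "(y \<circ> k) \<longlonglongrightarrow> l"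
      using B.frontier_compact yx(1) unfolding compact_def by metis
    have "(\<lambda>n. dist (x n) (y n)) \<longlonglongrightarrow> 0"
    proof (rule tendsto_sandwich[OF _ _ tendsto_const LIMSEQ_inverse_real_of_nat])
      show "eventually (\<lambda>n. dist (x n) (y n) \<le> inverse (real (Suc n))) sequentially"
        using yx(2) by (intro always_eventually allI less_imp_le)
    qed auto
    from LIMSEQ_subseq_LIMSEQ[OF this l(2)]
    have "(\<lambda>n. norm (x (k n) - y (k n))) \<longlonglongrightarrow> 0" by (simp only: o_def dist_norm)
    then have "(\<lambda>n. x (k n) - y (k n)) \<longlonglongrightarrow> 0" by (rule tendsto_norm_zero_cancel)
    from tendsto_add[OF this l(3)[unfolded o_def]] have "(x \<circ> k) \<longlonglongrightarrow> l"
      by (simp add: o_def)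
    moreover have "isCont (radial (D t)) l" using l(1) fr0 by (intro B.isCont_radial) auto
    ultimately have "(\<lambda>n. \<rho> t ((x \<circ> k) n)) \<longlonglongrightarrow> \<rho> t l" by (rule isCont_tendsto_compose[rotated])
    moreover have "\<rho> t l = 1" using l(1) fr0 B.in_frontier_iff by metis
    ultimately have "eventually (\<lambda>n. dist (\<rho> t ((x \<circ> k) n)) 1 < e) sequentially"
      using e tendstoD by metis
    then obtain n where "dist (\<rho> t ((x \<circ> k) n)) 1 < e" using eventually_happens' by force
    then show False using yx(3)[of "k n"] by (simp add: dist_real_def)
  qed
  then obtain d where d: "d > 0"
    "\<And>y x. y \<in> frontier (D t) \<Longrightarrow> dist x y < d \<Longrightarrow> x \<noteq> 0 \<Longrightarrow> \<bar>\<rho> t x - 1\<bar> < e" by metis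
  show ?thesis
  proof (rule that[of "d / (\<bar>L\<bar> + 1)"])
    show "d / (\<bar>L\<bar> + 1) > 0" using d(1) by (simp add: divide_pos_pos add_nonneg_pos)
    fix s x assume s: "s \<in> {0..T}" "\<bar>s - t\<bar> < d / (\<bar>L\<bar> + 1)" and x: "x \<noteq> (0::'a)"
    interpret C: star_body "D s" by (rule body[OF s(1)])
    let ?p = "\<rho> s x *\<^sub>R x"
    have r: "0 < \<rho> s x" by (rule C.radial_frontier_pos(2)[OF x])
    obtain y where y: "y \<in> frontier (D t)" "dist ?p y \<le> hausdorff_distance (frontier (D s)) (frontier (D t))"
      using hausdorff_distance_nearby[OF C.frontier_compact B.frontier_compact B.frontier_nonempty
          C.radial_frontier_pos(1)[OF x]] by blast
    have "dist ?p y \<le> L * \<bar>s - t\<bar>" using y(2) speed[OF s(1) t] by linarith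
    also have "\<dots> \<le> (\<bar>L\<bar> + 1) * \<bar>s - t\<bar>" by (intro mult_right_mono) auto
    also have "\<dots> < d" using s(2) by (simp add: field_simps add_pos_nonneg)
    finally have "\<bar>\<rho> t ?p - 1\<bar> < e" using d(2)[OF y(1)] x r by simp
    then show "\<bar>\<rho> t x / \<rho> s x - 1\<bar> < e" using B.radial_scale[OF x r] by simp
  qed
qed

lemma radial_joint_lower:
  assumes t: "t \<in> {0..T}" and x: "x \<noteq> 0" and a: "a < \<rho> t x"
  shows "\<exists>d>0. \<forall>s y. s \<in> {0..T} \<and> \<bar>s - t\<bar> < d \<and> dist y x < d \<longrightarrow> a < \<rho> s y"
proof -
  interpret B: star_body "D t" by (rule body[OF t])
  define b where "b = max a (\<rho> t x / 2)"
  have rx: "0 < \<rho> t x" by (rule B.radial_frontier_pos(2)[OF x])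
  have b: "0 < b" "b < \<rho> t x" "a \<le> b" using a rx by (auto simp: b_def)
  define c where "c = (b + \<rho> t x) / 2"
  have c: "b < c" "c < \<rho> t x" using b by (auto simp: c_def)
  have "eventually (\<lambda>y. c < \<rho> t y) (at x)"
    using B.isCont_radial[OF x] c(2) unfolding isCont_def by (rule order_tendstoD)
  then obtain d1 where d1: "d1 > 0" "\<And>y. y \<noteq> x \<Longrightarrow> dist y x < d1 \<Longrightarrow> c < \<rho> t y"
    unfolding eventually_at by blast
  obtain d2 where d2: "d2 > 0"
    "\<And>s y. s \<in> {0..T} \<Longrightarrow> \<bar>s - t\<bar> < d2 \<Longrightarrow> y \<noteq> 0 \<Longrightarrow> \<bar>\<rho> t y / \<rho> s y - 1\<bar> < c / b - 1"
    using radial_ratio[OF t, of "c / b - 1"] b c by (auto simp: field_simps)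
  show ?thesis
  proof (intro exI[of _ "min (min d1 d2) (norm x)"] conjI allI impI)
    fix s y assume as: "s \<in> {0..T} \<and> \<bar>s - t\<bar> < min (min d1 d2) (norm x) \<and> dist y x < min (min d1 d2) (norm x)"
    then have y0: "y \<noteq> 0" by (auto simp: dist_norm)
    have cy: "c < \<rho> t y" using d1(2)[of y] as c(2) by (cases "y = x") auto
    have rs: "0 < \<rho> s y" using radial_pos y0 as by blast
    have "\<bar>\<rho> t y / \<rho> s y - 1\<bar> < c / b - 1" using d2(2) as y0 by simp
    then have "\<rho> t y / \<rho> s y < c / b" by linarith
    then have "\<rho> t y * b < c * \<rho> s y" using rs b by (simp add: field_simps)
    moreover have "c * b < \<rho> t y * b" using cy b by simp
    ultimately have "c * b < c * \<rho> s y" by linarith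
    then have "b < \<rho> s y" using b c by simp
    then show "a < \<rho> s y" using b by simp
  qed (use d1 d2 x in auto)
qed

lemma radial_joint_upper:
  assumes t: "t \<in> {0..T}" and x: "x \<noteq> 0" and a: "\<rho> t x < a"
  shows "\<exists>d>0. \<forall>s y. s \<in> {0..T} \<and> \<bar>s - t\<bar> < d \<and> dist y x < d \<longrightarrow> \<rho> s y < a"
proof -
  interpret B: star_body "D t" by (rule body[OF t])
  have rx: "0 < \<rho> t x" by (rule B.radial_frontier_pos(2)[OF x])
  define c where "c = (a + \<rho> t x) / 2"
  have c: "c < a" "\<rho> t x < c" "0 < c" using a rx by (auto simp: c_def)
  have "eventually (\<lambda>y. \<rho> t y < c) (at x)"
    using B.isCont_radial[OF x] c(2) unfolding isCont_def by (rule order_tendstoD)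
  then obtain d1 where d1: "d1 > 0" "\<And>y. y \<noteq> x \<Longrightarrow> dist y x < d1 \<Longrightarrow> \<rho> t y < c"
    unfolding eventually_at by blast
  obtain d2 where d2: "d2 > 0"
    "\<And>s y. s \<in> {0..T} \<Longrightarrow> \<bar>s - t\<bar> < d2 \<Longrightarrow> y \<noteq> 0 \<Longrightarrow> \<bar>\<rho> t y / \<rho> s y - 1\<bar> < 1 - c / a"
    using radial_ratio[OF t, of "1 - c / a"] c by (auto simp: field_simps)
  show ?thesis
  proof (intro exI[of _ "min (min d1 d2) (norm x)"] conjI allI impI)
    fix s y assume as: "s \<in> {0..T} \<and> \<bar>s - t\<bar> < min (min d1 d2) (norm x) \<and> dist y x < min (min d1 d2) (norm x)"
    then have y0: "y \<noteq> 0" by (auto simp: dist_norm)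
    have cy: "\<rho> t y < c" using d1(2)[of y] as c(2) by (cases "y = x") auto
    have rs: "0 < \<rho> s y" using radial_pos y0 as by blast
    have "\<bar>\<rho> t y / \<rho> s y - 1\<bar> < 1 - c / a" using d2(2) as y0 by simp
    then have "c / a < \<rho> t y / \<rho> s y" by linarith
    then have "c * \<rho> s y < \<rho> t y * a" using rs c by (simp add: field_simps)
    moreover have "\<rho> t y * a < c * a" using cy c by simp
    ultimately have "c * \<rho> s y < c * a" by linarith
    then show "\<rho> s y < a" using c by simp
  qed (use d1 d2 x in auto)
qed

end

context star_evolution
begin

lemma continuous_on_radial_joint:
  "continuous_on ({0..T} \<times> (- {0})) (\<lambda>(s, y). \<rho> s y)"
  unfolding continuous_on_eq_continuous_within
proof
  fix z :: "real \<times> 'a" assume z: "z \<in> {0..T} \<times> - {0}"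
  obtain t x where tx: "z = (t, x)" by (cases z)
  then have t: "t \<in> {0..T}" and x: "x \<noteq> 0" using z by auto
  have near: "\<bar>fst p - t\<bar> < d \<and> dist (snd p) x < d" if "dist p z < d" for p d
    using that dist_fst_le[of p z] dist_snd_le[of p z] by (simp add: tx dist_real_def)
  show "continuous (at z within {0..T} \<times> - {0}) (\<lambda>(s, y). \<rho> s y)"
    unfolding continuous_within
  proof (rule order_tendstoI)
    fix a assume "a < (case z of (s, y) \<Rightarrow> \<rho> s y)"
    then have "a < \<rho> t x" by (simp add: tx)
    then obtain d where "d > 0" "\<forall>s y. s \<in> {0..T} \<and> \<bar>s - t\<bar> < d \<and> dist y x < d \<longrightarrow> a < \<rho> s y"
      using radial_joint_lower[OF t x] by metis
    then show "\<forall>\<^sub>F p in at z within {0..T} \<times> - {0}. a < (case p of (s, y) \<Rightarrow> \<rho> s y)"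
      unfolding eventually_at using near by (intro exI[of _ d]) (auto simp: case_prod_beta)
  next
    fix a assume "(case z of (s, y) \<Rightarrow> \<rho> s y) < a"
    then have "\<rho> t x < a" by (simp add: tx)
    then obtain d where "d > 0" "\<forall>s y. s \<in> {0..T} \<and> \<bar>s - t\<bar> < d \<and> dist y x < d \<longrightarrow> \<rho> s y < a"
      using radial_joint_upper[OF t x] by metis
    then show "\<forall>\<^sub>F p in at z within {0..T} \<times> - {0}. (case p of (s, y) \<Rightarrow> \<rho> s y) < a"
      unfolding eventually_at using near by (intro exI[of _ d]) (auto simp: case_prod_beta)
  qed
qed

lemma continuous_on_radial_time:
  assumes "x \<noteq> 0" shows "continuous_on {0..T} (\<lambda>s. \<rho> s x)"
proof -
  have "continuous_on {0..T} (\<lambda>s. (\<lambda>(s, y). \<rho> s y) (s, x))"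
    by (rule continuous_on_compose2[OF continuous_on_radial_joint])
      (use assms in \<open>auto intro!: continuous_intros\<close>)
  then show ?thesis by simp
qed

subsection \<open>Behaviour at the free boundary\<close>

text \<open>The mean value theorem along a segment whose interior lies in the positivity set.\<close>

lemma mvt_segment:
  assumes t: "t \<in> {0..T}" and U: "\<And>s. s \<in> {0..1} \<Longrightarrow> x + s *\<^sub>R e \<in> U"
    and pos: "\<And>s. s \<in> {0<..<1} \<Longrightarrow> 0 < w t (x + s *\<^sub>R e)"
  obtains s where "s \<in> {0<..<1}" "w t (x + e) - w t x = G t (x + s *\<^sub>R e) \<bullet> e"
proof -
  have "\<exists>s\<in>{0<..<1}. (\<lambda>s. w t (x + s *\<^sub>R e)) 1 - (\<lambda>s. w t (x + s *\<^sub>R e)) 0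
      = (\<lambda>h. (h *\<^sub>R e) \<bullet> G t (x + s *\<^sub>R e)) (1 - 0)"
  proof (rule mvt)
    show "continuous_on {0..1} (\<lambda>s. w t (x + s *\<^sub>R e))"
    proof (rule continuous_on_compose2[OF cont[OF t]])
      show "(\<lambda>s. x + s *\<^sub>R e) ` {0..1} \<subseteq> closure U"
        by (auto intro!: subsetD[OF closure_subset] U)
    qed (intro continuous_intros)
    fix s :: real assume s: "0 < s" "s < 1"
    then have "x + s *\<^sub>R e \<in> pos_set U (w t) \<inter> U"
      using U[of s] pos[of s] closure_subset by (auto simp: pos_set_def)
    then have "(w t has_derivative (\<lambda>h. h \<bullet> G t (x + s *\<^sub>R e))) (at (x + s *\<^sub>R e))"
      using gradient[OF t] by (simp add: gderiv_def)
    moreover have "((\<lambda>s. x + s *\<^sub>R e) has_derivative (\<lambda>h. h *\<^sub>R e)) (at s)"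
      by (auto intro!: derivative_eq_intros)
    ultimately show "((\<lambda>s. w t (x + s *\<^sub>R e)) has_derivative (\<lambda>h. (h *\<^sub>R e) \<bullet> G t (x + s *\<^sub>R e))) (at s)"
      by (rule has_derivative_compose[rotated])
  next
    fix s :: real
    assume "0 < s" "s < 1" "w t (x + 1 *\<^sub>R e) - w t (x + 0 *\<^sub>R e) = (1 - 0) *\<^sub>R e \<bullet> G t (x + s *\<^sub>R e)"
    then show "\<exists>s\<in>{0<..<1}. w t (x + 1 *\<^sub>R e) - w t (x + 0 *\<^sub>R e) = (1 - 0) *\<^sub>R e \<bullet> G t (x + s *\<^sub>R e)"
      by (intro bexI[of _ s]) auto
  qed simp
  then show ?thesis using that by (auto simp: inner_commute)
qed

lemma gradient_near:
  assumes t: "t0 \<in> {0..T}" and y: "y0 \<in> U" "y0 \<in> closure (pos_set U (w t0))"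
    and Q: "open Q" "G t0 y0 \<in> Q"
  obtains d where "d > 0" "ball y0 d \<subseteq> U"
    "\<And>t x. t \<in> {0..T} \<Longrightarrow> \<bar>t - t0\<bar> < d \<Longrightarrow> x \<in> ball y0 d \<Longrightarrow> x \<in> closure (pos_set U (w t)) \<Longrightarrow> G t x \<in> Q"
proof -
  let ?S = "{(t, x). t \<in> {0..T} \<and> x \<in> closure (pos_set U (w t))}"
  obtain e where e: "e > 0" "ball (G t0 y0) e \<subseteq> Q" using Q open_contains_ball by metis
  have "(t0, y0) \<in> ?S" using t y by simp
  with cont_gradient e(1) obtain d where d: "d > 0"
    "\<And>z. z \<in> ?S \<Longrightarrow> dist z (t0, y0) < d \<Longrightarrow> dist ((\<lambda>(t, x). G t x) z) ((\<lambda>(t, x). G t x) (t0, y0)) < e"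
    unfolding continuous_on_iff by meson
  obtain d' where d': "d' > 0" "ball y0 d' \<subseteq> U" using y(1) open_U open_contains_ball by metis
  show ?thesis
  proof (rule that[of "min d' (d/2)"])
    fix t x assume *: "t \<in> {0..T}" "\<bar>t - t0\<bar> < min d' (d/2)" "x \<in> ball y0 (min d' (d/2))"
      "x \<in> closure (pos_set U (w t))"
    have "dist (t, x) (t0, y0) \<le> dist t t0 + dist x y0"
      by (simp add: dist_Pair_Pair sqrt_sum_squares_le_sum)
    also have "\<dots> < d" using * by (simp add: dist_real_def dist_commute)
    finally have "dist (G t x) (G t0 y0) < e" using d(2)[of "(t, x)"] * by simp
    then show "G t x \<in> Q" using e(2) by (auto simp: dist_commute)
  qed (use d(1) d' in auto)
qed

text \<open>
  Moving from a point of positivity in a direction in which \<open>w\<close> increases, one cannot leave the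
  positivity set.
\<close>

lemma increase_in_cone:
  assumes t: "t0 \<in> {0..T}" and y: "y0 \<in> U" "y0 \<in> closure (pos_set U (w t0))" and \<eta>: "\<eta> > 0"
  obtains d where "d > 0" "ball y0 d \<subseteq> U"
    "\<And>t x e. t \<in> {0..T} \<Longrightarrow> \<bar>t - t0\<bar> < d \<Longrightarrow> x \<in> ball y0 d \<Longrightarrow> x + e \<in> ball y0 d \<Longrightarrow> 0 < w t x \<Longrightarrow>
       \<eta> * norm e \<le> G t0 y0 \<bullet> e \<Longrightarrow> w t x + G t0 y0 \<bullet> e - \<eta> * norm e \<le> w t (x + e)"
proof -
  obtain d where d: "d > 0" "ball y0 d \<subseteq> U"
    "\<And>t x. t \<in> {0..T} \<Longrightarrow> \<bar>t - t0\<bar> < d \<Longrightarrow> x \<in> ball y0 d \<Longrightarrow> x \<in> closure (pos_set U (w t)) \<Longrightarrow>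
       G t x \<in> ball (G t0 y0) \<eta>"
    using gradient_near[OF t y, of "ball (G t0 y0) \<eta>"] \<eta> by auto
  show ?thesis
  proof (rule that[OF d(1,2)])
    fix t x e
    assume t: "t \<in> {0..T}" "\<bar>t - t0\<bar> < d" and x: "x \<in> ball y0 d" "x + e \<in> ball y0 d" "0 < w t x"
      and e: "\<eta> * norm e \<le> G t0 y0 \<bullet> e"
    have seg: "x + s *\<^sub>R e \<in> ball y0 d" if "s \<in> {0..1}" for s
    proof -
      have "(1 - s) *\<^sub>R x + s *\<^sub>R (x + e) \<in> ball y0 d"
        using that x by (intro convexD[OF convex_ball]) auto
      then show ?thesis by (simp add: algebra_simps)
    qed
    have incr: "w t x + c * (G t0 y0 \<bullet> e - \<eta> * norm e) \<le> w t (x + c *\<^sub>R e)"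
      if c: "c \<in> {0..1}" and pos: "\<And>s. s \<in> {0<..<1} \<Longrightarrow> 0 < w t (x + s *\<^sub>R (c *\<^sub>R e))" for c
    proof -
      have in_ball: "x + s *\<^sub>R (c *\<^sub>R e) \<in> ball y0 d" if "s \<in> {0..1}" for s
        using seg[of "s * c"] that c by (simp add: mult_le_one)
      obtain s where s: "s \<in> {0<..<1}"
        "w t (x + c *\<^sub>R e) - w t x = G t (x + s *\<^sub>R (c *\<^sub>R e)) \<bullet> (c *\<^sub>R e)"
        using mvt_segment[OF t(1), of x "c *\<^sub>R e"] in_ball d(2) pos by blast
      let ?z = "x + s *\<^sub>R (c *\<^sub>R e)"
      have z: "?z \<in> ball y0 d" using in_ball s(1) by simp
      have "?z \<in> pos_set U (w t)"
        using z d(2) pos[OF s(1)] closure_subset[of U] by (auto simp: pos_set_def)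
      then have "G t ?z \<in> ball (G t0 y0) \<eta>" using d(3)[OF t z] closure_subset by blast
      then have "norm (G t0 y0 - G t ?z) \<le> \<eta>" by (simp add: dist_norm)
      then have "norm (G t0 y0 - G t ?z) * norm e \<le> \<eta> * norm e" by (intro mult_right_mono) auto
      moreover have "(G t0 y0 - G t ?z) \<bullet> e \<le> norm (G t0 y0 - G t ?z) * norm e"
        by (rule norm_cauchy_schwarz)
      ultimately have "G t0 y0 \<bullet> e - \<eta> * norm e \<le> G t ?z \<bullet> e" by (simp add: inner_diff_left)
      then have "c * (G t0 y0 \<bullet> e - \<eta> * norm e) \<le> c * (G t ?z \<bullet> e)" using c by (intro mult_left_mono) auto
      then show ?thesis using s(2) by simp
    qed
    define A where "A = {s \<in> {0..1}. w t (x + s *\<^sub>R e) \<le> 0}"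
    have segU: "(\<lambda>s. x + s *\<^sub>R e) ` {0..1} \<subseteq> closure U" using seg d(2) closure_subset[of U] by blast
    have "A = {}"
    proof (rule ccontr)
      assume "A \<noteq> {}"
      have "continuous_on {0..1} (\<lambda>s. w t (x + s *\<^sub>R e))"
        by (rule continuous_on_compose2[OF cont[OF t(1)] _ segU]) (intro continuous_intros)
      then have "closed A"
        unfolding A_def using continuous_on_closed_Collect_le[of "{0..1}" _ "\<lambda>_. 0"] by force
      moreover have bdd: "bdd_below A" unfolding A_def by (rule bdd_belowI[of _ 0]) auto
      ultimately obtain c where c: "c \<in> A" "\<And>s. s \<in> A \<Longrightarrow> c \<le> s"
        using \<open>A \<noteq> {}\<close> closed_contains_Inf cInf_lower by metis
      have "c \<noteq> 0" using c(1) x(3) by (auto simp: A_def)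
      then have c01: "0 < c" "c \<le> 1" using c(1) by (auto simp: A_def)
      have "0 < w t (x + s *\<^sub>R (c *\<^sub>R e))" if s: "s \<in> {0<..<1}" for s
      proof (rule ccontr)
        assume "\<not> ?thesis"
        then have "s * c \<in> A" using s c01 by (auto simp: A_def mult_le_one)
        then have "c \<le> s * c" by (rule c(2))
        then show False using s c01 by auto
      qed
      then have "w t x + c * (G t0 y0 \<bullet> e - \<eta> * norm e) \<le> w t (x + c *\<^sub>R e)"
        using c01 by (intro incr) auto
      moreover have "0 \<le> c * (G t0 y0 \<bullet> e - \<eta> * norm e)"
        using c01 e by auto
      ultimately show False using c(1) x(3) by (auto simp: A_def)
    qed
    then have "0 < w t (x + s *\<^sub>R (1 *\<^sub>R e))" if "s \<in> {0<..<1}" for s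
    proof -
      have "s \<notin> A" using \<open>A = {}\<close> by simp
      then show ?thesis using that by (simp add: A_def not_le)
    qed
    from incr[OF _ this] show "w t x + G t0 y0 \<bullet> e - \<eta> * norm e \<le> w t (x + e)" by simp
  qed
qed

text \<open>
  No regularity of the boundary is needed here: where the gradient predicts growth at a definite
  rate, points of positivity near \<open>y0\<close> can be moved in that direction; elsewhere \<open>w \<ge> 0\<close> suffices.
\<close>

lemma gradient_subdiff:
  assumes t: "t0 \<in> {0..T}" and y: "y0 \<in> free_bdry U (w t0)"
  shows "G t0 y0 \<in> subdiff U (w t0) y0"
  unfolding subdiff_def
proof (intro CollectI allI impI)
  fix \<epsilon> :: real assume \<epsilon>: "\<epsilon> > 0"
  have y': "y0 \<in> U" "y0 \<in> closure (pos_set U (w t0))" "w t0 y0 = 0"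
    using y free_bdry_iff[OF open_U cont[OF t] nonneg[OF t]] by auto
  obtain d where d: "d > 0" "ball y0 d \<subseteq> U"
    "\<And>t x e. t \<in> {0..T} \<Longrightarrow> \<bar>t - t0\<bar> < d \<Longrightarrow> x \<in> ball y0 d \<Longrightarrow> x + e \<in> ball y0 d \<Longrightarrow> 0 < w t x \<Longrightarrow>
       \<epsilon> * norm e \<le> G t0 y0 \<bullet> e \<Longrightarrow> w t x + G t0 y0 \<bullet> e - \<epsilon> * norm e \<le> w t (x + e)"
    using increase_in_cone[OF t y'(1,2) \<epsilon>] by blast
  obtain z where z: "\<And>n. z n \<in> pos_set U (w t0)" "z \<longlonglongrightarrow> y0"
    using y'(2) unfolding closure_sequential by blast
  have "w t0 x \<ge> G t0 y0 \<bullet> (x - y0) - \<epsilon> * norm (x - y0)" if x: "x \<in> closure U" "norm (x - y0) < d" for x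
  proof (cases "\<epsilon> * norm (x - y0) \<le> G t0 y0 \<bullet> (x - y0)")
    case False
    then show ?thesis using nonneg[OF t x(1)] by simp
  next
    case True
    have xb: "x \<in> ball y0 d" using x(2) by (simp add: dist_norm norm_minus_commute)
    have zx: "(\<lambda>n. z n + (x - y0)) \<longlonglongrightarrow> x" using tendsto_add[OF z(2) tendsto_const, of "x - y0"] by simp
    have "isCont (w t0) x"
      using cont[OF t] xb d(2) open_U
      by (meson closure_subset continuous_on_eq_continuous_at continuous_on_subset subsetD)
    then have lim: "(\<lambda>n. w t0 (z n + (x - y0))) \<longlonglongrightarrow> w t0 x" by (rule isCont_tendsto_compose[OF _ zx])
    have "eventually (\<lambda>n. z n \<in> ball y0 d) sequentially"
      using topological_tendstoD[OF z(2) open_ball, of y0 d] d(1) by simp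
    moreover have "eventually (\<lambda>n. z n + (x - y0) \<in> ball y0 d) sequentially"
      by (rule topological_tendstoD[OF zx open_ball xb])
    ultimately have "eventually (\<lambda>n. G t0 y0 \<bullet> (x - y0) - \<epsilon> * norm (x - y0) \<le> w t0 (z n + (x - y0))) sequentially"
    proof eventually_elim
      case (elim n)
      have "0 < w t0 (z n)" using z(1) by (auto simp: pos_set_def)
      then show ?case using d(3)[OF t _ elim(1,2) _ True] d(1) by simp
    qed
    then show ?thesis using lim by (intro tendsto_lowerbound[OF lim]) auto
  qed
  then show "\<exists>d>0. \<forall>x\<in>closure U. norm (x - y0) < d \<longrightarrow>
      w t0 x \<ge> G t0 y0 \<bullet> (x - y0) - \<epsilon> * norm (x - y0)" using d(1) by blast
qed

text \<open>
  Follow the segment from a point of positivity towards \<open>y0\<close> until \<open>w\<close> vanishes for the first time.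
\<close>

lemma gradient_superdiff:
  assumes t: "t0 \<in> {0..T}" and y: "y0 \<in> free_bdry U (w t0)"
  shows "G t0 y0 \<in> superdiff U (w t0) y0"
  unfolding superdiff_def
proof (intro CollectI allI impI)
  fix \<epsilon> :: real assume \<epsilon>: "\<epsilon> > 0"
  let ?P = "pos_set U (w t0)"
  have y': "y0 \<in> U" "y0 \<in> closure ?P" "w t0 y0 = 0"
    using y free_bdry_iff[OF open_U cont[OF t] nonneg[OF t]] by auto
  obtain d where d: "d > 0" "ball y0 d \<subseteq> U"
    "\<And>t x. t \<in> {0..T} \<Longrightarrow> \<bar>t - t0\<bar> < d \<Longrightarrow> x \<in> ball y0 d \<Longrightarrow> x \<in> closure (pos_set U (w t)) \<Longrightarrow>
       G t x \<in> ball (G t0 y0) \<epsilon>"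
    using gradient_near[OF t y'(1,2), of "ball (G t0 y0) \<epsilon>"] \<epsilon> by auto
  have pos_case: "w t0 x \<le> G t0 y0 \<bullet> (x - y0) + \<epsilon> * norm (x - y0)"
    if x: "x \<in> ball y0 d" "0 < w t0 x" for x
  proof -
    define A where "A = {s \<in> {0..1}. w t0 (x + s *\<^sub>R (y0 - x)) \<le> 0}"
    have seg: "x + s *\<^sub>R (y0 - x) \<in> ball y0 d" if "s \<in> {0..1}" for s
    proof -
      have "(1 - s) *\<^sub>R x + s *\<^sub>R y0 \<in> ball y0 d"
        using that x d(1) by (intro convexD[OF convex_ball]) auto
      then show ?thesis by (simp add: algebra_simps)
    qed
    have segU: "(\<lambda>s. x + s *\<^sub>R (y0 - x)) ` {0..1} \<subseteq> closure U"
      using seg d(2) closure_subset[of U] by blast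
    have "continuous_on {0..1} (\<lambda>s. w t0 (x + s *\<^sub>R (y0 - x)))"
      by (rule continuous_on_compose2[OF cont[OF t] _ segU]) (intro continuous_intros)
    then have "closed A"
      unfolding A_def using continuous_on_closed_Collect_le[of "{0..1}" _ "\<lambda>_. 0"] by force
    moreover have bdd: "bdd_below A" unfolding A_def by (rule bdd_belowI[of _ 0]) auto
    moreover have "1 \<in> A" using y'(3) by (simp add: A_def)
    ultimately obtain c where c: "c \<in> A" "\<And>s. s \<in> A \<Longrightarrow> c \<le> s"
      using closed_contains_Inf cInf_lower by (metis empty_iff)
    have "c \<noteq> 0" using c(1) x(2) by (auto simp: A_def)
    then have c01: "0 < c" "c \<le> 1" using c(1) by (auto simp: A_def)
    have pos: "0 < w t0 (x + s *\<^sub>R (c *\<^sub>R (y0 - x)))" if s: "s \<in> {0<..<1}" for s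
    proof (rule ccontr)
      assume "\<not> ?thesis"
      then have "s * c \<in> A" using s c01 by (auto simp: A_def mult_le_one)
      then have "c \<le> s * c" by (rule c(2))
      then show False using s c01 by auto
    qed
    have in_ball: "x + s *\<^sub>R (c *\<^sub>R (y0 - x)) \<in> ball y0 d" if "s \<in> {0..1}" for s
      using seg[of "s * c"] that c01 by (simp add: mult_le_one)
    obtain s where s: "s \<in> {0<..<1}"
      "w t0 (x + c *\<^sub>R (y0 - x)) - w t0 x
         = G t0 (x + s *\<^sub>R (c *\<^sub>R (y0 - x))) \<bullet> (c *\<^sub>R (y0 - x))"
      using mvt_segment[OF t, of x "c *\<^sub>R (y0 - x)"] in_ball d(2) pos by blast
    let ?z = "x + s *\<^sub>R (c *\<^sub>R (y0 - x))"
    have "w t0 (x + c *\<^sub>R (y0 - x)) = 0"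
      using c(1) nonneg[OF t, of "x + c *\<^sub>R (y0 - x)"] segU by (fastforce simp: A_def)
    then have eq: "w t0 x = c * (G t0 ?z \<bullet> (x - y0))" using s(2) by (simp add: inner_diff_right algebra_simps)
    have z: "?z \<in> ball y0 d" using in_ball s(1) by simp
    have "?z \<in> ?P" using z d(2) pos[OF s(1)] closure_subset[of U] by (auto simp: pos_set_def)
    then have "G t0 ?z \<in> ball (G t0 y0) \<epsilon>" using d(3)[OF t _ z] d(1) closure_subset by fastforce
    then have "norm (G t0 ?z - G t0 y0) \<le> \<epsilon>" by (simp add: dist_norm norm_minus_commute)
    then have "norm (G t0 ?z - G t0 y0) * norm (x - y0) \<le> \<epsilon> * norm (x - y0)" by (intro mult_right_mono) auto
    moreover have "(G t0 ?z - G t0 y0) \<bullet> (x - y0) \<le> norm (G t0 ?z - G t0 y0) * norm (x - y0)"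
      by (rule norm_cauchy_schwarz)
    ultimately have "G t0 ?z \<bullet> (x - y0) \<le> G t0 y0 \<bullet> (x - y0) + \<epsilon> * norm (x - y0)"
      by (simp add: inner_diff_left)
    moreover have "0 < G t0 ?z \<bullet> (x - y0)" using eq x(2) c01 by (metis zero_less_mult_pos)
    then have "w t0 x \<le> 1 * (G t0 ?z \<bullet> (x - y0))" unfolding eq using c01 by (intro mult_right_mono) auto
    ultimately show ?thesis by simp
  qed
  have "w t0 x \<le> G t0 y0 \<bullet> (x - y0) + \<epsilon> * norm (x - y0)" if x: "x \<in> closure ?P" "norm (x - y0) < d" for x
  proof -
    have xb: "x \<in> ball y0 d" using x(2) by (simp add: dist_norm norm_minus_commute)
    obtain z where z: "\<And>n. z n \<in> ?P" "z \<longlonglongrightarrow> x"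
      using x(1) unfolding closure_sequential by blast
    have "isCont (w t0) x"
      using cont[OF t] xb d(2) open_U
      by (meson closure_subset continuous_on_eq_continuous_at continuous_on_subset subsetD)
    then have l1: "(\<lambda>n. w t0 (z n)) \<longlonglongrightarrow> w t0 x" by (rule isCont_tendsto_compose[OF _ z(2)])
    have l2: "(\<lambda>n. G t0 y0 \<bullet> (z n - y0) + \<epsilon> * norm (z n - y0)) \<longlonglongrightarrow> G t0 y0 \<bullet> (x - y0) + \<epsilon> * norm (x - y0)"
      by (intro tendsto_intros z(2))
    have "eventually (\<lambda>n. z n \<in> ball y0 d) sequentially"
      by (rule topological_tendstoD[OF z(2) open_ball xb])
    then have "eventually (\<lambda>n. w t0 (z n) \<le> G t0 y0 \<bullet> (z n - y0) + \<epsilon> * norm (z n - y0)) sequentially"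
      by (rule eventually_mono) (use z(1) in \<open>auto simp: pos_set_def intro: pos_case\<close>)
    then show ?thesis by (rule tendsto_le[OF trivial_limit_sequentially l2 l1])
  qed
  then show "\<exists>d>0. \<forall>x\<in>closure ?P. norm (x - y0) < d \<longrightarrow>
      w t0 x \<le> G t0 y0 \<bullet> (x - y0) + \<epsilon> * norm (x - y0)" using d(1) by blast
qed

text \<open>
  If the gradient did not point strictly towards the origin, \<open>w\<close> would be positive at some points
  beyond \<open>y0\<close>, and strong star-shapedness would make \<open>y0\<close> an interior point.
\<close>

lemma gradient_inward:
  assumes t: "t0 \<in> {0..T}" and y: "y0 \<in> free_bdry U (w t0)" and g: "G t0 y0 \<noteq> 0"
  shows "G t0 y0 \<bullet> y0 < 0"
proof (rule ccontr)
  assume nonneg: "\<not> G t0 y0 \<bullet> y0 < 0"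
  let ?g = "G t0 y0"
  obtain r where r: "r > 0" and star: "\<And>z y. z \<in> ball 0 r \<Longrightarrow> y \<in> D t0 \<Longrightarrow> closed_segment z y \<subseteq> D t0"
    using star[OF t] unfolding strongly_star_shaped_def star_shaped_wrt_def by metis
  have yU: "y0 \<in> U" using y by (simp add: free_bdry_def)
  define b where "b = (r / (2 * norm ?g)) *\<^sub>R ?g"
  have nb: "norm b = r / 2" using g r by (simp add: b_def)
  define e where "e = y0 + b"
  have gb: "?g \<bullet> b = (r / 2) * norm ?g"
    using g by (simp add: b_def power2_norm_eq_inner[symmetric] power2_eq_square)
  have "0 < ?g \<bullet> b" unfolding gb using r g by simp
  then have ge: "0 < ?g \<bullet> e" using nonneg by (simp add: e_def inner_add_right)
  then have e0: "e \<noteq> 0" by auto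
  have "0 < ?g \<bullet> e / (2 * norm e)" using ge e0 by simp
  then obtain d where d: "d > 0" "\<And>x. x \<in> closure U \<Longrightarrow> norm (x - y0) < d \<Longrightarrow>
      ?g \<bullet> (x - y0) - (?g \<bullet> e / (2 * norm e)) * norm (x - y0) \<le> w t0 x"
    using gradient_subdiff[OF t y] unfolding subdiff_def mem_Collect_eq by meson
  obtain d' where d': "d' > 0" "ball y0 d' \<subseteq> U" using yU open_U open_contains_ball by metis
  define s where "s = min d d' / (2 * norm e)"
  have s: "s > 0" using d(1) d'(1) e0 by (simp add: s_def)
  let ?p = "y0 + s *\<^sub>R e"
  have n: "norm (?p - y0) = min d d' / 2" using s e0 d(1) d'(1) by (simp add: s_def)
  then have pU: "?p \<in> U" using d' d(1) by (intro subsetD[OF d'(2)]) (simp add: dist_norm norm_minus_commute del: norm_scaleR)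
  have "?g \<bullet> (s *\<^sub>R e) - (?g \<bullet> e / (2 * norm e)) * norm (s *\<^sub>R e) \<le> w t0 ?p"
    using d(2)[of ?p] pU closure_subset[of U] n d(1) d'(1) by fastforce
  moreover have "?g \<bullet> (s *\<^sub>R e) - (?g \<bullet> e / (2 * norm e)) * norm (s *\<^sub>R e) = s * (?g \<bullet> e) / 2"
    using s e0 by (simp add: field_simps)
  moreover have "0 < s * (?g \<bullet> e) / 2" using s ge by simp
  ultimately have "0 < w t0 ?p" by linarith
  then have pD: "?p \<in> D t0" using pU closure_subset[of U] by (auto simp: pos_set_def)
  have "ball y0 (s * r / (2 * (1 + s))) \<subseteq> D t0"
  proof
    fix z assume z: "z \<in> ball y0 (s * r / (2 * (1 + s)))"
    define b' where "b' = ((1 + s) / s) *\<^sub>R (z - y0) - b"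
    have "norm (z - y0) < s * r / (2 * (1 + s))" using z by (simp add: dist_norm norm_minus_commute)
    then have "(1 + s) / s * norm (z - y0) < r / 2" using s by (simp add: field_simps)
    moreover have "norm (((1 + s) / s) *\<^sub>R (z - y0)) = (1 + s) / s * norm (z - y0)"
      using s by (simp only: norm_scaleR) simp
    ultimately have "norm (((1 + s) / s) *\<^sub>R (z - y0)) < r / 2" by simp
    then have "norm b' < r" using nb norm_triangle_ineq4[of "((1 + s) / s) *\<^sub>R (z - y0)" b]
      unfolding b'_def by linarith
    then have "b' \<in> ball 0 r" by simp
    moreover have "z = (1 - 1 / (1 + s)) *\<^sub>R b' + (1 / (1 + s)) *\<^sub>R ?p"
    proof -
      have "(1 - 1 / (1 + s)) *\<^sub>R b' = (z - y0) - (s / (1 + s)) *\<^sub>R b"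
      proof -
        have k: "1 - 1 / (1 + s) = s / (1 + s)" using s by (simp add: field_simps)
        have kk: "s / (1 + s) * ((1 + s) / s) = 1" using s by simp
        show ?thesis
          by (simp only: b'_def k scaleR_diff_right scaleR_scaleR kk scaleR_one)
      qed
      moreover have "(1 / (1 + s)) *\<^sub>R ?p = y0 + (s / (1 + s)) *\<^sub>R b"
      proof -
        have "?p = (1 + s) *\<^sub>R y0 + s *\<^sub>R b" by (simp add: e_def algebra_simps)
        then show ?thesis using s by (simp add: scaleR_add_right)
      qed
      ultimately show ?thesis by simp
    qed
    then have "z \<in> closed_segment b' ?p" using s unfolding in_segment by (intro exI[of _ "1 / (1 + s)"]) auto
    ultimately show "z \<in> D t0" using star pD by blast
  qed
  moreover have "0 < s * r / (2 * (1 + s))" using s r by simp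
  ultimately have "y0 \<in> interior (D t0)" by (meson centre_in_ball interior_maximal open_ball subsetD)
  moreover have "y0 \<noteq> 0" using yU zero_notin_U closure_subset[of U] by auto
  ultimately have "1 < \<rho> t0 y0" using star_body.in_interior_iff[OF body[OF t]] by simp
  then show False using y free_bdry_radial[OF t] by simp
qed

text \<open>
  A cone of directions around \<open>- y0\<close>, uniform in time near \<open>t0\<close>, in which the positivity sets cannot
  be left.
\<close>

lemma inward_cone:
  assumes t: "t0 \<in> {0..T}" and y: "y0 \<in> free_bdry U (w t0)" and g: "G t0 y0 \<noteq> 0"
  obtains d c where "d > 0" "c > 0" "ball y0 d \<subseteq> U"
    "\<And>t x h b. t \<in> {0..T} \<Longrightarrow> \<bar>t - t0\<bar> < d \<Longrightarrow> x \<in> ball y0 d \<Longrightarrow> x - h *\<^sub>R y0 + b \<in> ball y0 d \<Longrightarrow>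
       0 < w t x \<Longrightarrow> 0 < h \<Longrightarrow> norm b \<le> c * h \<Longrightarrow> 0 < w t (x - h *\<^sub>R y0 + b)"
proof -
  let ?g = "G t0 y0"
  define \<gamma> where "\<gamma> = - (?g \<bullet> y0)"
  have \<gamma>: "\<gamma> > 0" using gradient_inward[OF assms] by (simp add: \<gamma>_def)
  define c where "c = min 1 (\<gamma> / (4 * norm ?g))"
  define n where "n = norm y0 + 1"
  have ny: "0 < n" by (simp add: n_def add_nonneg_pos)
  define \<eta> where "\<eta> = \<gamma> / (4 * n)"
  have c: "0 < c" "c \<le> 1" "norm ?g * c \<le> \<gamma> / 4"
    using \<gamma> g by (auto simp: c_def min_def field_simps)
  have \<eta>: "0 < \<eta>" "\<eta> * n = \<gamma> / 4" using \<gamma> ny by (auto simp: \<eta>_def)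
  have y': "y0 \<in> U" "y0 \<in> closure (pos_set U (w t0))"
    using y free_bdry_iff[OF open_U cont[OF t] nonneg[OF t]] by auto
  obtain d where d: "d > 0" "ball y0 d \<subseteq> U"
    "\<And>t x e. t \<in> {0..T} \<Longrightarrow> \<bar>t - t0\<bar> < d \<Longrightarrow> x \<in> ball y0 d \<Longrightarrow> x + e \<in> ball y0 d \<Longrightarrow> 0 < w t x \<Longrightarrow>
       \<eta> * norm e \<le> G t0 y0 \<bullet> e \<Longrightarrow> w t x + G t0 y0 \<bullet> e - \<eta> * norm e \<le> w t (x + e)"
    using increase_in_cone[OF t y' \<eta>(1)] by blast
  show ?thesis
  proof (rule that[OF d(1) c(1) d(2)])
    fix t x h b
    assume *: "t \<in> {0..T}" "\<bar>t - t0\<bar> < d" "x \<in> ball y0 d" "x - h *\<^sub>R y0 + b \<in> ball y0 d"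
      "0 < w t x" "0 < h" "norm b \<le> c * h"
    define e where "e = b - h *\<^sub>R y0"
    have xe: "x - h *\<^sub>R y0 + b = x + e" by (simp add: e_def)
    have "- (?g \<bullet> b) \<le> norm ?g * norm b" using norm_cauchy_schwarz[of "- ?g" b] by simp
    also have "\<dots> \<le> norm ?g * (c * h)" using *(7) by (intro mult_left_mono) auto
    also have "\<dots> = (norm ?g * c) * h" by simp
    also have "\<dots> \<le> (\<gamma> / 4) * h" using c(3) *(6) by (intro mult_right_mono) auto
    finally have "- (?g \<bullet> b) \<le> (\<gamma> / 4) * h" .
    moreover have "?g \<bullet> e = ?g \<bullet> b + h * \<gamma>" by (simp add: e_def \<gamma>_def inner_diff_right)
    ultimately have 1: "?g \<bullet> e \<ge> h * \<gamma> - \<gamma> / 4 * h" by linarith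
    have "norm e \<le> norm b + norm (h *\<^sub>R y0)" unfolding e_def by (rule norm_triangle_ineq4)
    also have "\<dots> \<le> h * n"
    proof -
      have "c * h \<le> 1 * h" using c(2) *(6) by (intro mult_right_mono) auto
      then have "norm b \<le> h" using *(7) by simp
      then show ?thesis using *(6) by (simp add: n_def algebra_simps)
    qed
    finally have "\<eta> * norm e \<le> \<eta> * (h * n)" using \<eta> by (intro mult_left_mono) auto
    also have "\<dots> = h * (\<eta> * n)" by simp
    also have "\<dots> = h * \<gamma> / 4" using \<eta>(2) by simp
    finally have 2: "\<eta> * norm e \<le> h * \<gamma> / 4" .
    have "0 < h * \<gamma>" using *(6) \<gamma> by simp
    with 1 2 have ge: "\<eta> * norm e \<le> ?g \<bullet> e" by (simp add: algebra_simps)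
    have "w t x + ?g \<bullet> e - \<eta> * norm e \<le> w t (x + e)"
      using d(3)[OF *(1,2,3) _ *(5) ge] *(4) unfolding xe by simp
    then show "0 < w t (x - h *\<^sub>R y0 + b)" unfolding xe using *(5) ge by linarith
  qed
qed

end

context star_evolution
begin

subsection \<open>Joint continuity\<close>

text \<open>
  The mean value theorem along a ray that ends on the boundary, where \<open>w\<close> vanishes.
\<close>

lemma ray_estimate:
  assumes s: "s \<in> {0..T}" and y: "y \<in> U" and a: "1 \<le> a" "a \<le> \<rho> s y"
    and B: "\<And>q. 1 \<le> q \<Longrightarrow> q \<le> \<rho> s y \<Longrightarrow> norm (G s (q *\<^sub>R y)) \<le> B"
  shows "w s (a *\<^sub>R y) \<le> B * norm y * (\<rho> s y - a)"
proof (cases "a = \<rho> s y")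
  case True
  have "\<not> 0 < w s (a *\<^sub>R y)"
  proof -
    have aU: "a *\<^sub>R y \<in> U" using dilate_U[of y a] y a closure_subset[of U] by (cases "a = 1") auto
    have "y \<noteq> 0" using y zero_notin_U closure_subset[of U] by auto
    then have "\<rho> s (a *\<^sub>R y) = 1" using radial_dilate[OF s, of y a] a True by simp
    then show ?thesis using pos_iff[OF s aU] by simp
  qed
  then show ?thesis using True by simp
next
  case False
  let ?k = "\<rho> s y"
  let ?e = "(?k - a) *\<^sub>R y"
  have y0: "y \<noteq> 0" using y zero_notin_U closure_subset[of U] by auto
  have dU: "q *\<^sub>R y \<in> U" if "1 \<le> q" for q
    using dilate_U[of y q] y that closure_subset[of U] by (cases "q = 1") auto
  have pt: "a *\<^sub>R y + r *\<^sub>R ?e = (a + r * (?k - a)) *\<^sub>R y" for r by (simp add: algebra_simps)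
  have mid: "1 \<le> a + r * (?k - a) \<and> a + r * (?k - a) \<le> ?k" if "r \<in> {0..1}" for r
  proof -
    have "0 \<le> r * (?k - a)" using that a by simp
    moreover have "r * (?k - a) \<le> 1 * (?k - a)" using that a by (intro mult_right_mono) auto
    ultimately show ?thesis using a by simp
  qed
  have mid': "a + r * (?k - a) < ?k" if "r \<in> {0<..<1}" for r
  proof -
    have "r * (?k - a) < 1 * (?k - a)" using that a False by (intro mult_strict_right_mono) auto
    then show ?thesis by simp
  qed
  obtain r where r: "r \<in> {0<..<1}"
    "w s (a *\<^sub>R y + ?e) - w s (a *\<^sub>R y) = G s (a *\<^sub>R y + r *\<^sub>R ?e) \<bullet> ?e"
  proof (rule mvt_segment[OF s, of "a *\<^sub>R y" ?e])
    show "a *\<^sub>R y + r *\<^sub>R ?e \<in> U" if "r \<in> {0..1}" for r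
      unfolding pt using dU mid[OF that] by blast
    show "0 < w s (a *\<^sub>R y + r *\<^sub>R ?e)" if r: "r \<in> {0<..<1}" for r
    proof -
      let ?q = "a + r * (?k - a)"
      have q: "1 \<le> ?q" "?q < ?k" using mid[of r] mid'[OF r] r by auto
      then have "1 < \<rho> s (?q *\<^sub>R y)" using radial_dilate[OF s y0, of ?q] by simp
      then show ?thesis unfolding pt using pos_iff[OF s dU[OF q(1)]] by simp
    qed
  qed
  have "a *\<^sub>R y + ?e = ?k *\<^sub>R y" by (simp add: algebra_simps)
  moreover have "w s (?k *\<^sub>R y) \<le> 0"
  proof -
    have "1 \<le> ?k" using a by simp
    moreover have "\<rho> s (?k *\<^sub>R y) = 1" using radial_dilate[OF s y0, of ?k] \<open>1 \<le> ?k\<close> by simp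
    ultimately show ?thesis using pos_iff[OF s dU[of ?k]] by simp
  qed
  moreover have "w s (?k *\<^sub>R y) \<ge> 0"
    using dU[of ?k] a nonneg[OF s] closure_subset[of U] by auto
  ultimately have "w s (a *\<^sub>R y) = - (G s (a *\<^sub>R y + r *\<^sub>R ?e) \<bullet> ?e)" using r(2) by simp
  also have "\<dots> \<le> norm (G s (a *\<^sub>R y + r *\<^sub>R ?e)) * norm ?e"
    using norm_cauchy_schwarz[of "- G s (a *\<^sub>R y + r *\<^sub>R ?e)" ?e] by simp
  also have "\<dots> \<le> B * norm ?e"
    unfolding pt using mid[of r] r(1) by (intro mult_right_mono B) auto
  also have "\<dots> = B * norm y * (?k - a)" using a by simp
  finally show ?thesis .
qed

text \<open>
  Along nearby rays at nearby times the derivatives are uniformly close up to the nearer of the two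
  endpoints, and there both values are small.  Near \<open>frontier U\<close> the positivity sets could
  collapse onto \<open>K\<close> with unbounded gradients, so only points of \<open>U\<close> are considered.
\<close>

lemma jointly_continuous:
  assumes t: "t \<in> {0..T}" and x: "x \<in> U" and \<epsilon>: "\<epsilon> > 0"
  shows "\<exists>d>0. \<forall>s y. s \<in> {0..T} \<and> \<bar>s - t\<bar> < d \<and> dist y x < d \<longrightarrow> y \<in> U \<and> \<bar>w s y - w t x\<bar> < \<epsilon>"
proof (cases "\<rho> t x < 1")
  case True
  have x0: "x \<noteq> 0" using x zero_notin_U closure_subset[of U] by auto
  obtain d where d: "d > 0"
    "\<And>s y. s \<in> {0..T} \<Longrightarrow> \<bar>s - t\<bar> < d \<Longrightarrow> dist y x < d \<Longrightarrow> \<rho> s y < 1"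
    using radial_joint_upper[OF t x0 True] by metis
  obtain d' where d': "d' > 0" "ball x d' \<subseteq> U" using x open_U open_contains_ball by metis
  have z: "w s y = 0" if "s \<in> {0..T}" "y \<in> U" "\<rho> s y < 1" for s y
    using pos_iff[OF that(1,2)] that nonneg[OF that(1), of y] closure_subset[of U] by force
  show ?thesis
  proof (intro exI[of _ "min d d'"] conjI allI impI)
    fix s y assume *: "s \<in> {0..T} \<and> \<bar>s - t\<bar> < min d d' \<and> dist y x < min d d'"
    then show yU: "y \<in> U" using d'(2) by (auto simp: dist_commute)
    show "\<bar>w s y - w t x\<bar> < \<epsilon>" using z[OF t x True] z[of s y] yU d(2)[of s y] * \<epsilon> by simp
  qed (use d d' in auto)
next
  case False
  define \<kappa> where "\<kappa> = \<rho> t x"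
  define M where "M = \<kappa> + 1"
  have \<kappa>: "1 \<le> \<kappa>" using False by (simp add: \<kappa>_def)
  have x0: "x \<noteq> 0" using x zero_notin_U closure_subset[of U] by auto
  obtain r where r: "r > 0" "cball x r \<subseteq> U" using x open_U open_contains_cball by metis
  define E where "E = (\<lambda>(q, y). q *\<^sub>R y) ` ({1..M} \<times> cball x r)"
  have EU: "E \<subseteq> U"
  proof
    fix z assume "z \<in> E"
    then obtain q y where "z = q *\<^sub>R y" "1 \<le> q" "y \<in> U" using r(2) by (auto simp: E_def)
    then show "z \<in> U" using dilate_U[of y q] closure_subset[of U] by (cases "q = 1") auto
  qed
  have cE: "compact E"
    unfolding E_def case_prod_beta
    by (intro compact_continuous_image compact_Times compact_Icc compact_cball continuous_intros)
  have "{0..T} \<times> E \<subseteq> {0..T} \<times> (- {0})" using EU zero_notin_U closure_subset[of U] by auto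
  then have cr: "continuous_on ({0..T} \<times> E) (\<lambda>(s, y). \<rho> s y)"
    using continuous_on_radial_joint continuous_on_subset by blast
  define C where "C = {z \<in> {0..T} \<times> E. 1 \<le> (\<lambda>(s, y). \<rho> s y) z}"
  have cTE: "compact ({0..T} \<times> E)" by (intro compact_Times compact_Icc cE)
  have "closed C"
    unfolding C_def using continuous_on_closed_Collect_le[OF continuous_on_const cr] cTE compact_imp_closed
    by auto
  then have cC: "compact C"
    using compact_Int_closed[OF cTE] by (metis (no_types, lifting) C_def Int_absorb1 mem_Collect_eq subsetI inf_commute)
  have "C \<subseteq> {(t, x). t \<in> {0..T} \<and> x \<in> closure (pos_set U (w t))}"
    using closure_pos_iff EU by (auto simp: C_def)
  then have cG: "continuous_on C (\<lambda>(s, y). G s y)" using cont_gradient continuous_on_subset by blast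
  have inC: "(s, q *\<^sub>R y) \<in> C" if "s \<in> {0..T}" "y \<in> cball x r" "1 \<le> q" "q \<le> M" "q \<le> \<rho> s y" for s q y
  proof -
    have "q *\<^sub>R y \<in> E" unfolding E_def using that by (intro image_eqI[of _ _ "(q, y)"]) auto
    moreover have "y \<noteq> 0" using subsetD[OF r(2) that(2)] zero_notin_U closure_subset[of U] by auto
    then have "1 \<le> \<rho> s (q *\<^sub>R y)" using radial_dilate[OF that(1), of y q] that by simp
    ultimately show ?thesis using that(1) by (simp add: C_def)
  qed
  obtain B0 where B0: "\<And>z. z \<in> C \<Longrightarrow> norm ((\<lambda>(s, y). G s y) z) \<le> B0"
    using compact_imp_bounded[OF compact_continuous_image[OF cG cC]] unfolding bounded_iff by blast
  define B where "B = \<bar>B0\<bar> + 1"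
  have B: "B > 0" "\<And>s y. (s, y) \<in> C \<Longrightarrow> norm (G s y) \<le> B" using B0 by (force simp: B_def)+
  define R where "R = norm x + r"
  have R: "R > 0" "\<And>y. y \<in> cball x r \<Longrightarrow> norm y \<le> R"
  proof -
    show "R > 0" using r by (simp add: R_def add_nonneg_pos)
    fix y assume "y \<in> cball x r"
    then have "norm (y - x) \<le> r" by (simp add: dist_norm norm_minus_commute)
    then show "norm y \<le> R" unfolding R_def using norm_triangle_sub[of y x] by linarith
  qed
  have M: "M \<ge> 2" using \<kappa> by (simp add: M_def)
  define \<eta> where "\<eta> = \<epsilon> / (4 * M * R)"
  have \<eta>: "\<eta> > 0" using \<epsilon> M R by (simp add: \<eta>_def)
  obtain du where du: "du > 0" "\<And>z z'. z \<in> C \<Longrightarrow> z' \<in> C \<Longrightarrow> dist z' z < du \<Longrightarrow>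
      dist ((\<lambda>(s, y). G s y) z') ((\<lambda>(s, y). G s y) z) < \<eta>"
    using compact_uniformly_continuous[OF cG cC] \<eta> unfolding uniformly_continuous_on_def by meson
  define \<xi> where "\<xi> = min (1/2) (\<epsilon> / (8 * B * R))"
  have \<xi>: "\<xi> > 0" "\<xi> < 1" "B * R * \<xi> \<le> \<epsilon> / 8"
    using \<epsilon> B R by (auto simp: \<xi>_def min_def field_simps)
  obtain d1 where d1: "d1 > 0"
    "\<And>s y. s \<in> {0..T} \<Longrightarrow> \<bar>s - t\<bar> < d1 \<Longrightarrow> dist y x < d1 \<Longrightarrow> \<kappa> - \<xi> < \<rho> s y"
    using radial_joint_lower[OF t x0, of "\<kappa> - \<xi>"] \<xi>(1) by (auto simp: \<kappa>_def)
  obtain d2 where d2: "d2 > 0"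
    "\<And>s y. s \<in> {0..T} \<Longrightarrow> \<bar>s - t\<bar> < d2 \<Longrightarrow> dist y x < d2 \<Longrightarrow> \<rho> s y < \<kappa> + \<xi>"
    using radial_joint_upper[OF t x0, of "\<kappa> + \<xi>"] \<xi>(1) by (auto simp: \<kappa>_def)
  define d where "d = Min {r, d1, d2, du / (2 * M), \<epsilon> / (4 * M * B)}"
  have d: "d > 0" "d \<le> r" "d \<le> d1" "d \<le> d2" "d \<le> du / (2 * M)" "d \<le> \<epsilon> / (4 * M * B)"
    using r d1(1) d2(1) du(1) \<epsilon> M B by (auto simp: d_def)
  show ?thesis
  proof (intro exI[of _ d] conjI allI impI)
    fix s y assume *: "s \<in> {0..T} \<and> \<bar>s - t\<bar> < d \<and> dist y x < d"
    have s: "s \<in> {0..T}" using * by simp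
    have yr: "y \<in> cball x r" using * d(2) by (simp add: dist_commute)
    then show yU: "y \<in> U" using r(2) by blast
    have xr: "x \<in> cball x r" using r(1) by simp
    have y0: "y \<noteq> 0" using yU zero_notin_U closure_subset[of U] by auto
    define k where "k = \<rho> s y"
    have k: "\<kappa> - \<xi> < k" "k < \<kappa> + \<xi>" using d1(2)[OF s] d2(2)[OF s] * d by (auto simp: k_def)
    have kM: "k \<le> M" "\<kappa> \<le> M" using k \<xi> by (auto simp: M_def)
    have Bx: "norm (G t (q *\<^sub>R x)) \<le> B" if "1 \<le> q" "q \<le> \<kappa>" for q
      using that kM by (intro B inC t xr) (auto simp: \<kappa>_def)
    have By: "norm (G s (q *\<^sub>R y)) \<le> B" if "1 \<le> q" "q \<le> k" for q
      using that kM by (intro B inC s yr) (auto simp: k_def)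
    have endx: "w t (a *\<^sub>R x) \<le> \<epsilon> / 8" if "1 \<le> a" "a \<le> \<kappa>" "\<kappa> - a \<le> \<xi>" for a
    proof -
      have "w t (a *\<^sub>R x) \<le> B * norm x * (\<kappa> - a)"
        unfolding \<kappa>_def by (rule ray_estimate[OF t x]) (use that Bx in \<open>auto simp: \<kappa>_def\<close>)
      also have "\<dots> \<le> B * R * \<xi>"
        using that B R(1) R(2)[OF xr] by (intro mult_mono) auto
      finally show ?thesis using \<xi>(3) by simp
    qed
    have endy: "w s (a *\<^sub>R y) \<le> \<epsilon> / 8" if "1 \<le> a" "a \<le> k" "k - a \<le> \<xi>" for a
    proof -
      have "w s (a *\<^sub>R y) \<le> B * norm y * (k - a)"
        unfolding k_def by (rule ray_estimate[OF s yU]) (use that By in \<open>auto simp: k_def\<close>)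
      also have "\<dots> \<le> B * R * \<xi>"
        using that B R(1) R(2)[OF yr] by (intro mult_mono) auto
      finally show ?thesis using \<xi>(3) by simp
    qed
    have nx: "0 \<le> w t (a *\<^sub>R x)" and ny: "0 \<le> w s (a *\<^sub>R y)" if "1 \<le> a" for a
    proof -
      have "a *\<^sub>R x \<in> closure U" "a *\<^sub>R y \<in> closure U"
        using dilate_U[of x a] dilate_U[of y a] x yU that closure_subset[of U] by (cases "a = 1"; auto)+
      then show "0 \<le> w t (a *\<^sub>R x)" "0 \<le> w s (a *\<^sub>R y)" using nonneg t s by auto
    qed
    show "\<bar>w s y - w t x\<bar> < \<epsilon>"
    proof (cases "1 \<le> k")
      case False
      then have "\<not> 0 < w s y" using pos_iff[OF s yU] by (simp add: k_def)
      moreover have "w t x \<le> \<epsilon> / 8" using endx[of 1] \<kappa> k False by simp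
      ultimately show ?thesis using nx[of 1] ny[of 1] \<epsilon> by simp
    next
      case True
      \<comment> \<open>both rays stay in the positivity sets up to the factor \<open>a\<close>\<close>
      define a where "a = min \<kappa> k"
      have a: "1 \<le> a" "a \<le> \<kappa>" "a \<le> k" "\<kappa> - a \<le> \<xi>" "k - a \<le> \<xi>" "a \<le> M"
        using \<kappa> True k \<xi> kM by (auto simp: a_def)
      have ends: "w t (a *\<^sub>R x) \<le> \<epsilon> / 8" "w s (a *\<^sub>R y) \<le> \<epsilon> / 8"
        using endx[OF a(1,2,4)] endy[OF a(1,3,5)] by auto
      have diff: "\<bar>(w t (a *\<^sub>R x) - w s (a *\<^sub>R y)) - (w t x - w s y)\<bar> \<le> \<epsilon> / 2"
      proof (cases "a = 1")
        case True then show ?thesis using \<epsilon> by simp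
      next
        case False
        have deriv: "((\<lambda>q. w s' (q *\<^sub>R y')) has_derivative (\<lambda>h. (h *\<^sub>R y') \<bullet> G s' (q *\<^sub>R y'))) (at q)"
          if "s' \<in> {0..T}" "y' \<in> U" "1 \<le> q" "q < \<rho> s' y'" for s' y' q
        proof -
          have qU: "q *\<^sub>R y' \<in> U" using dilate_U[of y' q] that closure_subset[of U] by (cases "q = 1") auto
          have "y' \<noteq> 0" using that(2) zero_notin_U closure_subset[of U] by auto
          then have "1 < \<rho> s' (q *\<^sub>R y')" using radial_dilate[OF that(1), of y' q] that by simp
          then have "q *\<^sub>R y' \<in> pos_set U (w s') \<inter> U"
            using pos_iff[OF that(1) qU] qU closure_subset[of U] by (auto simp: pos_set_def)
          then have "(w s' has_derivative (\<lambda>h. h \<bullet> G s' (q *\<^sub>R y'))) (at (q *\<^sub>R y'))"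
            using gradient[OF that(1)] by (simp add: gderiv_def)
          moreover have "((\<lambda>q. q *\<^sub>R y') has_derivative (\<lambda>h. h *\<^sub>R y')) (at q)"
            by (auto intro!: derivative_eq_intros)
          ultimately show ?thesis by (rule has_derivative_compose[rotated])
        qed
        have ray_cont: "continuous_on {1..a} (\<lambda>q. w s' (q *\<^sub>R y'))" if "s' \<in> {0..T}" "y' \<in> U" for s' y'
        proof (rule continuous_on_compose2[OF cont[OF that(1)]])
          show "(\<lambda>q. q *\<^sub>R y') ` {1..a} \<subseteq> closure U"
          proof (clarify)
            fix q assume "q \<in> {1..a}"
            then show "q *\<^sub>R y' \<in> closure U"
              using dilate_U[of y' q] that(2) closure_subset[of U] by (cases "q = 1") auto
          qed
        qed (intro continuous_intros)
        let ?h = "\<lambda>q. w t (q *\<^sub>R x) - w s (q *\<^sub>R y)"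
        have "1 < a" using False a by simp
        moreover have "continuous_on {1..a} ?h"
          by (intro continuous_on_diff ray_cont t s x yU)
        moreover have "(?h has_derivative (\<lambda>h. (h *\<^sub>R x) \<bullet> G t (q *\<^sub>R x) - (h *\<^sub>R y) \<bullet> G s (q *\<^sub>R y))) (at q)"
          if "1 < q" "q < a" for q
          using that a by (intro has_derivative_diff deriv t s x yU) (auto simp: \<kappa>_def k_def)
        ultimately obtain q where q: "1 < q" "q < a"
          "?h a - ?h 1 = ((a - 1) *\<^sub>R x) \<bullet> G t (q *\<^sub>R x) - ((a - 1) *\<^sub>R y) \<bullet> G s (q *\<^sub>R y)"
          using mvt[of 1 a ?h "\<lambda>q h. (h *\<^sub>R x) \<bullet> G t (q *\<^sub>R x) - (h *\<^sub>R y) \<bullet> G s (q *\<^sub>R y)"] by blast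
        define X Y where "X = G t (q *\<^sub>R x)" and "Y = G s (q *\<^sub>R y)"
        have c1: "(t, q *\<^sub>R x) \<in> C" by (rule inC[OF t xr]) (use q a in \<open>auto simp: \<kappa>_def\<close>)
        have c2: "(s, q *\<^sub>R y) \<in> C" by (rule inC[OF s yr]) (use q a in \<open>auto simp: k_def\<close>)
        have "dist (t, q *\<^sub>R x) (s, q *\<^sub>R y) \<le> dist t s + dist (q *\<^sub>R x) (q *\<^sub>R y)"
          by (simp add: dist_Pair_Pair sqrt_sum_squares_le_sum)
        also have "dist (q *\<^sub>R x) (q *\<^sub>R y) = q * dist x y"
          using q(1) by (simp add: dist_norm flip: scaleR_diff_right)
        also have "\<dots> \<le> (M - 1/2) * dist x y + dist x y / 2"
          using q a mult_right_mono[of q M "dist x y"] by (simp add: algebra_simps)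
        also have "dist t s + ((M - 1/2) * dist x y + dist x y / 2) \<le> d + M * d"
        proof -
          have "M * dist x y \<le> M * d" using * M by (intro mult_left_mono) (auto simp: dist_commute)
          moreover have "dist t s \<le> d" using * by (simp add: dist_real_def abs_minus_commute)
          ultimately show ?thesis by (simp add: algebra_simps)
        qed
        also have "d + M * d < 2 * (M * d)" using M d(1) by simp
        also have "2 * (M * d) \<le> du" using d(5) M by (simp add: field_simps)
        finally have "dist X Y < \<eta>"
          using du(2)[OF c2 c1] by (simp add: X_def Y_def)
        then have XY: "norm (X - Y) \<le> \<eta>" by (simp add: dist_norm)
        have YB: "norm Y \<le> B" unfolding Y_def by (rule B(2)[OF c2])
        have "\<bar>x \<bullet> X - y \<bullet> Y\<bar> = \<bar>x \<bullet> (X - Y) + (x - y) \<bullet> Y\<bar>"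
          by (simp add: inner_diff_left inner_diff_right)
        also have "\<dots> \<le> \<bar>x \<bullet> (X - Y)\<bar> + \<bar>(x - y) \<bullet> Y\<bar>" by (rule abs_triangle_ineq)
        also have "\<dots> \<le> norm x * norm (X - Y) + norm (x - y) * norm Y"
          by (intro add_mono Cauchy_Schwarz_ineq2)
        also have "\<dots> \<le> R * \<eta> + d * B"
          using R(1) R(2)[OF xr] XY YB * d(1) B(1)
          by (intro add_mono mult_mono) (auto simp: dist_norm norm_minus_commute)
        finally have in1: "\<bar>x \<bullet> X - y \<bullet> Y\<bar> \<le> R * \<eta> + d * B" .
        have "?h a - ?h 1 = (a - 1) * (x \<bullet> X - y \<bullet> Y)"
          unfolding q(3) X_def Y_def by (simp add: algebra_simps)
        then have "\<bar>?h a - ?h 1\<bar> = (a - 1) * \<bar>x \<bullet> X - y \<bullet> Y\<bar>" using a by (simp add: abs_mult)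
        also have "\<dots> \<le> M * (R * \<eta> + d * B)" using a in1 by (intro mult_mono) auto
        also have "\<dots> = M * R * \<eta> + M * (d * B)" by (simp add: algebra_simps)
        also have "M * R * \<eta> = \<epsilon> / 4" using M R by (simp add: \<eta>_def)
        also have "M * (d * B) \<le> \<epsilon> / 4" using d(6) M B(1) by (simp add: field_simps)
        finally show ?thesis by simp
      qed
      have "0 \<le> w t (a *\<^sub>R x)" "0 \<le> w s (a *\<^sub>R y)" using nx ny a by auto
      then show ?thesis using diff ends \<epsilon> by linarith
    qed
  qed (rule d(1))
qed

end

section \<open>Envelopes and normal velocities\<close>

text \<open>
  A property that holds in a punctured neighbourhood holds at points of the same time slice with
  values arbitrarily close to \<open>u t x\<close>.
\<close>

lemma slice_frequently:
  fixes U :: "'a::euclidean_space set" and u :: "real \<Rightarrow> 'a \<Rightarrow> real"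
  assumes U: "open U" and t: "t \<in> {0..T}" and x: "x \<in> closure U"
    and c: "continuous_on (closure U) (u t)"
    and ev: "eventually P (at (t, x) within {0..T} \<times> closure U)" and e: "(e::real) > 0"
  shows "\<exists>y\<in>closure U. \<bar>u t y - u t x\<bar> < e \<and> P (t, y)"
proof -
  obtain d where d: "d > 0"
    "\<And>z. z \<in> {0..T} \<times> closure U \<Longrightarrow> z \<noteq> (t, x) \<Longrightarrow> dist z (t, x) < d \<Longrightarrow> P z"
    using ev unfolding eventually_at by blast
  obtain d' where d': "d' > 0" "\<And>y. y \<in> closure U \<Longrightarrow> dist y x < d' \<Longrightarrow> dist (u t y) (u t x) < e"
    using c x e unfolding continuous_on_iff by blast
  have "x islimpt U"
    using x U interior_limit_point[of x U] by (auto simp: closure_def interior_open)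
  then obtain y where y: "y \<in> U" "y \<noteq> x" "dist y x < min d d'"
    unfolding islimpt_approachable using d(1) d'(1) by (metis min_less_iff_conj)
  then have yc: "y \<in> closure U" using closure_subset[of U] by auto
  have "P (t, y)" using y t yc by (intro d(2)) (auto simp: dist_Pair_Pair)
  moreover have "\<bar>u t y - u t x\<bar> < e" using d'(2)[OF yc] y(3) by (simp add: dist_real_def)
  ultimately show ?thesis using yc by blast
qed

lemma lower_env_eq:
  fixes U :: "'a::euclidean_space set" and u :: "real \<Rightarrow> 'a \<Rightarrow> real"
  assumes U: "open U" and t: "t \<in> {0..T}" and x: "x \<in> closure U"
    and c: "continuous_on (closure U) (u t)"
    and lsc: "\<And>c. c < u t x \<Longrightarrow> eventually (\<lambda>(s, y). c < u s y) (at (t, x) within {0..T} \<times> closure U)"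
  shows "lower_env U T u t x = u t x"
proof -
  let ?F = "at (t, x) within {0..T} \<times> closure U"
  let ?X = "\<lambda>(s, y). ereal (u s y)"
  have "Liminf ?F ?X = ereal (u t x)"
  proof (rule antisym)
    show "ereal (u t x) \<le> Liminf ?F ?X"
      unfolding le_Liminf_iff
    proof (intro allI impI)
      fix b assume b: "b < ereal (u t x)"
      then obtain b' where b': "b < ereal b'" "b' < u t x"
        using ereal_dense2 by (metis less_ereal.simps(1))
      show "eventually (\<lambda>z. b < ?X z) ?F"
        using lsc[OF b'(2)]
      proof eventually_elim
        case (elim z)
        then show ?case using b'(1) less_trans[of b "ereal b'"] by (cases z) auto
      qed
    qed
    show "Liminf ?F ?X \<le> ereal (u t x)"
    proof (rule ccontr)
      assume "\<not> ?thesis"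
      then obtain b where b: "ereal (u t x) < ereal b" "ereal b < Liminf ?F ?X"
        using ereal_dense2 by (metis not_le)
      have "eventually (\<lambda>z. ereal b < ?X z) ?F" using less_LiminfD[OF b(2)] .
      from slice_frequently[where u = u, OF U t x c this, of "b - u t x"] b(1)
      show False by auto
    qed
  qed
  then show ?thesis by (simp add: lower_env_def)
qed

lemma upper_env_eq:
  fixes U :: "'a::euclidean_space set" and u :: "real \<Rightarrow> 'a \<Rightarrow> real"
  assumes U: "open U" and t: "t \<in> {0..T}" and x: "x \<in> closure U"
    and c: "continuous_on (closure U) (u t)"
    and usc: "\<And>c. u t x < c \<Longrightarrow> eventually (\<lambda>(s, y). u s y < c) (at (t, x) within {0..T} \<times> closure U)"
  shows "upper_env U T u t x = u t x"
proof -
  let ?F = "at (t, x) within {0..T} \<times> closure U"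
  let ?X = "\<lambda>(s, y). ereal (u s y)"
  have "Limsup ?F ?X = ereal (u t x)"
  proof (rule antisym)
    show "Limsup ?F ?X \<le> ereal (u t x)"
      unfolding Limsup_le_iff
    proof (intro allI impI)
      fix b assume b: "ereal (u t x) < b"
      then obtain b' where b': "ereal b' < b" "u t x < b'"
        using ereal_dense2 by (metis less_ereal.simps(1))
      show "eventually (\<lambda>z. ?X z < b) ?F"
        using usc[OF b'(2)]
      proof eventually_elim
        case (elim z)
        then show ?case using b'(1) less_trans[of _ "ereal b'" b] by (cases z) auto
      qed
    qed
    show "ereal (u t x) \<le> Limsup ?F ?X"
    proof (rule ccontr)
      assume "\<not> ?thesis"
      then obtain b where b: "ereal b < ereal (u t x)" "Limsup ?F ?X < ereal b"
        using ereal_dense2 by (metis not_le)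
      have "eventually (\<lambda>z. ?X z < ereal b) ?F"
        using Limsup_lessD[OF b(2)] .
      from slice_frequently[where u = u, OF U t x c this, of "u t x - b"] b(1)
      show False by auto
    qed
  qed
  then show ?thesis by (simp add: upper_env_def)
qed

text \<open>
  A continuous function whose lower left Dini derivative is nowhere positive cannot increase.
  Slopes \<open>v\<close> need only be considered as far as the increments \<open>v * (t - a)\<close> are small.
\<close>

lemma no_increase:
  fixes f :: "real \<Rightarrow> real"
  assumes ab: "a \<le> b" and f: "continuous_on {a..b} f" and H: "0 < H"
    and step: "\<And>t v. a < t \<Longrightarrow> t \<le> b \<Longrightarrow> 0 < v \<Longrightarrow> v * (t - a) \<le> H \<Longrightarrow>
      \<exists>s\<ge>a. s < t \<and> f t - v * (t - s) \<le> f s"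
  shows "f b \<le> f a"
proof (rule ccontr)
  assume neg: "\<not> f b \<le> f a"
  then have "a < b" using ab by (cases "a = b") auto
  define v where "v = min H ((f b - f a) / 2) / (b - a)"
  have v: "v > 0" using H neg \<open>a < b\<close> by (simp add: v_def)
  have va: "v * (b - a) = min H ((f b - f a) / 2)" using \<open>a < b\<close> by (simp add: v_def)
  define A where "A = {s \<in> {a..b}. f b - v * (b - s) \<le> f s}"
  have "closed A"
    unfolding A_def by (rule continuous_on_closed_Collect_le) (auto intro!: continuous_intros f)
  moreover have "bdd_below A" unfolding A_def by (rule bdd_belowI[of _ a]) auto
  moreover have "b \<in> A" using ab by (simp add: A_def)
  ultimately obtain t where t: "t \<in> A" "\<And>s. s \<in> A \<Longrightarrow> t \<le> s"
    using closed_contains_Inf cInf_lower by (metis empty_iff)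
  have "a \<notin> A"
  proof
    assume "a \<in> A"
    then have "f b - v * (b - a) \<le> f a" by (simp add: A_def)
    moreover have "v * (b - a) \<le> (f b - f a) / 2" unfolding va by (rule min.cobounded2)
    ultimately show False using neg by argo
  qed
  then have at: "a < t" "t \<le> b" using t(1) by (auto simp: A_def intro: le_neq_trans)
  have "v * (t - a) \<le> v * (b - a)" using at v by simp
  then obtain s where s: "a \<le> s" "s < t" "f t - v * (t - s) \<le> f s"
    using step[OF at v] va by auto
  moreover have "f b - v * (b - t) \<le> f t" using t(1) by (simp add: A_def)
  ultimately have "s \<in> A" using at by (simp add: A_def right_diff_distrib)
  then show False using t(2)[of s] s(2) by simp
qed

context star_evolution
begin

text \<open>
  Along the ray through a free boundary point with nonzero gradient, the boundary can be located at
  nearby times from single points: a point \<open>x\<close> of positivity forces the boundary to be beyond the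
  points of the ray that are closer to the origin than \<open>x\<close> by a definite amount, and a point
  outside the positivity set bounds it from the other side.
\<close>

lemma radial_near_free_bdry:
  assumes t0: "t0 \<in> {0<..T}" and y: "y0 \<in> free_bdry U (w t0)" and g: "G t0 y0 \<noteq> 0"
    and Q: "open Q" "G t0 y0 \<in> Q"
  obtains d c H where "0 < d" "d < t0" "0 < c" "0 < H" "H \<le> 1/2"
    "\<And>t. t0 - d \<le> t \<Longrightarrow> t \<le> t0 \<Longrightarrow> \<bar>\<rho> t y0 - 1\<bar> \<le> H"
    "\<And>t. t0 - d \<le> t \<Longrightarrow> t \<le> t0 \<Longrightarrow> \<rho> t y0 *\<^sub>R y0 \<in> free_bdry U (w t) \<and> G t (\<rho> t y0 *\<^sub>R y0) \<in> Q"
    "\<And>t k h x. t0 - d \<le> t \<Longrightarrow> t \<le> t0 \<Longrightarrow> \<bar>k - 1\<bar> \<le> H \<Longrightarrow> 0 < h \<Longrightarrow> h \<le> H \<Longrightarrow>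
       x \<in> cball (k *\<^sub>R y0) (c * h) \<Longrightarrow> x \<in> pos_set U (w t) \<Longrightarrow> k - h < \<rho> t y0"
    "\<And>t k h x. t0 - d \<le> t \<Longrightarrow> t \<le> t0 \<Longrightarrow> \<bar>k - 1\<bar> \<le> H \<Longrightarrow> 0 < h \<Longrightarrow> h \<le> H \<Longrightarrow>
       x \<in> cball (k *\<^sub>R y0) (c * h) \<Longrightarrow> x \<notin> pos_set U (w t) \<Longrightarrow> \<rho> t y0 \<le> k + h"
proof -
  have t0': "t0 \<in> {0..T}" using t0 by auto
  have yU: "y0 \<in> U" and \<rho>0: "\<rho> t0 y0 = 1" using y free_bdry_radial[OF t0'] by auto
  have ycl: "y0 \<in> closure (pos_set U (w t0))" using closure_pos_iff[OF t0' yU] \<rho>0 by simp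
  have y0: "y0 \<noteq> 0" using yU zero_notin_U closure_subset[of U] by auto
  obtain d1 c where d1: "d1 > 0" "c > 0" "ball y0 d1 \<subseteq> U"
    "\<And>t x h b. t \<in> {0..T} \<Longrightarrow> \<bar>t - t0\<bar> < d1 \<Longrightarrow> x \<in> ball y0 d1 \<Longrightarrow> x - h *\<^sub>R y0 + b \<in> ball y0 d1 \<Longrightarrow>
       0 < w t x \<Longrightarrow> 0 < h \<Longrightarrow> norm b \<le> c * h \<Longrightarrow> 0 < w t (x - h *\<^sub>R y0 + b)"
    using inward_cone[OF t0' y g] by blast
  obtain d2 where d2: "d2 > 0" "ball y0 d2 \<subseteq> U"
    "\<And>t x. t \<in> {0..T} \<Longrightarrow> \<bar>t - t0\<bar> < d2 \<Longrightarrow> x \<in> ball y0 d2 \<Longrightarrow> x \<in> closure (pos_set U (w t)) \<Longrightarrow> G t x \<in> Q"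
    using gradient_near[OF t0' yU ycl Q] by blast
  define R where "R = min d1 d2"
  define N where "N = norm y0 + c"
  define H where "H = min (1/2) (R / (4 * N))"
  have R: "R > 0" "R \<le> d1" "R \<le> d2" using d1(1) d2(1) by (auto simp: R_def)
  have N: "0 < N" using d1(2) by (simp add: N_def add_nonneg_pos)
  have H: "H > 0" "H \<le> 1/2" "H * N \<le> R / 4"
  proof -
    have "H * N \<le> R / (4 * N) * N" using N by (intro mult_right_mono) (auto simp: H_def)
    then show "H * N \<le> R / 4" using N by simp
  qed (use R N in \<open>auto simp: H_def\<close>)
  have H': "H * norm y0 \<le> R / 4" "H * c \<le> R / 4"
  proof -
    have "0 \<le> H * norm y0" "0 \<le> H * c" using H d1(2) by auto
    then show "H * norm y0 \<le> R / 4" "H * c \<le> R / 4" using H(3) by (auto simp: N_def distrib_left)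
  qed
  obtain d3 where d3: "d3 > 0" "\<And>s y. s \<in> {0..T} \<Longrightarrow> \<bar>s - t0\<bar> < d3 \<Longrightarrow> dist y y0 < d3 \<Longrightarrow> \<rho> s y < 1 + H"
    using radial_joint_upper[OF t0' y0, of "1 + H"] \<rho>0 H by auto
  obtain d4 where d4: "d4 > 0" "\<And>s y. s \<in> {0..T} \<Longrightarrow> \<bar>s - t0\<bar> < d4 \<Longrightarrow> dist y y0 < d4 \<Longrightarrow> 1 - H < \<rho> s y"
    using radial_joint_lower[OF t0' y0, of "1 - H"] \<rho>0 H by auto
  define d where "d = Min {R, d3, d4, t0} / 2"
  have d: "0 < d" "d < R" "d < d3" "d < d4" "d < t0"
    using R d3(1) d4(1) t0 by (auto simp: d_def min_less_iff_disj)
  have time: "t \<in> {0..T}" "\<bar>t - t0\<bar> < R" "\<bar>t - t0\<bar> < d3" "\<bar>t - t0\<bar> < d4"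
    if "t0 - d \<le> t" "t \<le> t0" for t
    using that d t0 by auto
  have on_ray: "norm (k *\<^sub>R y0 - y0) \<le> R / 2" if k: "\<bar>k - 1\<bar> \<le> 2 * H" for k
  proof -
    have "norm (k *\<^sub>R y0 - y0) = \<bar>k - 1\<bar> * norm y0"
      by (metis norm_scaleR scaleR_left_diff_distrib scaleR_one)
    also have "\<dots> \<le> 2 * H * norm y0" using k by (intro mult_right_mono) auto
    also have "\<dots> \<le> R / 2" using H' by simp
    finally show ?thesis .
  qed
  have ray_ball: "k *\<^sub>R y0 \<in> ball y0 R" if "\<bar>k - 1\<bar> \<le> 2 * H" for k
    using on_ray[OF that] R(1) by (simp add: dist_norm norm_minus_commute)
  have ball_U: "z \<in> U" if "z \<in> ball y0 R" for z using that d1(3) R(2) by auto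
  have near: "\<bar>\<rho> t y0 - 1\<bar> \<le> H" if t: "t0 - d \<le> t" "t \<le> t0" for t
    using d3(2)[OF time(1,3)[OF t], of y0] d4(2)[OF time(1,4)[OF t], of y0] d3(1) d4(1) by simp
  have cone_points: "x \<in> ball y0 R" "norm (x - k *\<^sub>R y0) \<le> c * h"
    if k: "\<bar>k - 1\<bar> \<le> H" and h: "0 < h" "h \<le> H" and x: "x \<in> cball (k *\<^sub>R y0) (c * h)" for k h x
  proof -
    show xk: "norm (x - k *\<^sub>R y0) \<le> c * h" using x by (simp add: dist_norm norm_minus_commute)
    have "c * h \<le> c * H" using h d1(2) by simp
    then have "c * h \<le> R / 4" using H'(2) by (simp only: mult.commute)
    moreover have "norm (x - y0) \<le> norm (x - k *\<^sub>R y0) + norm (k *\<^sub>R y0 - y0)"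
      by (metis dist_norm dist_triangle)
    ultimately have "norm (x - y0) < R" using xk on_ray[of k] k R(1) H(1) by auto
    then show "x \<in> ball y0 R" by (simp add: dist_norm norm_minus_commute)
  qed
  show ?thesis
  proof (rule that[OF d(1,5) d1(2) H(1,2) near])
    fix t assume t: "t0 - d \<le> t" "t \<le> t0"
    let ?k = "\<rho> t y0"
    note tT = time[OF t]
    have k: "\<bar>?k - 1\<bar> \<le> 2 * H" "0 < ?k" using near[OF t] H by auto
    have zU: "?k *\<^sub>R y0 \<in> U" by (rule ball_U[OF ray_ball[OF k(1)]])
    have \<rho>z: "\<rho> t (?k *\<^sub>R y0) = 1" using radial_dilate[OF tT(1) y0 k(2)] k(2) by simp
    have "?k *\<^sub>R y0 \<in> closure (pos_set U (w t))" using closure_pos_iff[OF tT(1) zU] \<rho>z by simp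
    then have "G t (?k *\<^sub>R y0) \<in> Q" using d2(3)[OF tT(1)] tT(2) ray_ball[OF k(1)] R by auto
    then show "?k *\<^sub>R y0 \<in> free_bdry U (w t) \<and> G t (?k *\<^sub>R y0) \<in> Q"
      using free_bdry_radial[OF tT(1)] zU \<rho>z by simp
  next
    fix t k h x
    assume t: "t0 - d \<le> t" "t \<le> t0" and k: "\<bar>k - 1\<bar> \<le> H" and h: "0 < h" "h \<le> H"
      and x: "x \<in> cball (k *\<^sub>R y0) (c * h)" "x \<in> pos_set U (w t)"
    note tT = time[OF t] and xb = cone_points[OF k h x(1)]
    have q: "x - h *\<^sub>R y0 + (k *\<^sub>R y0 - x) = (k - h) *\<^sub>R y0" by (simp add: algebra_simps)
    have kh: "\<bar>(k - h) - 1\<bar> \<le> 2 * H" "0 < k - h \<or> k - h \<le> 0" using k h by auto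
    have qb: "(k - h) *\<^sub>R y0 \<in> ball y0 R" by (rule ray_ball[OF kh(1)])
    have "0 < w t (x - h *\<^sub>R y0 + (k *\<^sub>R y0 - x))"
      using d1(4)[OF tT(1), of x h "k *\<^sub>R y0 - x"] tT(2) xb qb x(2) h(1) R(2)
      unfolding q by (auto simp: pos_set_def norm_minus_commute)
    then have "1 < \<rho> t ((k - h) *\<^sub>R y0)" unfolding q using pos_iff[OF tT(1) ball_U[OF qb]] by simp
    then show "k - h < \<rho> t y0"
      using radial_dilate[OF tT(1) y0, of "k - h"] radial_pos[OF tT(1) y0] by (cases "0 < k - h") auto
  next
    fix t k h x
    assume t: "t0 - d \<le> t" "t \<le> t0" and k: "\<bar>k - 1\<bar> \<le> H" and h: "0 < h" "h \<le> H"
      and x: "x \<in> cball (k *\<^sub>R y0) (c * h)" "x \<notin> pos_set U (w t)"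
    note tT = time[OF t] and xb = cone_points[OF k h x(1)]
    have q: "(k + h) *\<^sub>R y0 - h *\<^sub>R y0 + (x - k *\<^sub>R y0) = x" by (simp add: algebra_simps)
    have kh: "\<bar>(k + h) - 1\<bar> \<le> 2 * H" "0 < k + h" using k h H(2) by auto
    have qb: "(k + h) *\<^sub>R y0 \<in> ball y0 R" by (rule ray_ball[OF kh(1)])
    have "\<not> 0 < w t x" using x(2) ball_U[OF xb(1)] closure_subset[of U] by (auto simp: pos_set_def)
    then have "\<not> 0 < w t ((k + h) *\<^sub>R y0)"
      using d1(4)[OF tT(1), of "(k + h) *\<^sub>R y0" h "x - k *\<^sub>R y0"] tT(2) xb qb h(1) R(2)
      unfolding q by auto
    then have "\<not> 1 < \<rho> t ((k + h) *\<^sub>R y0)" using pos_iff[OF tT(1) ball_U[OF qb]] by simp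
    then show "\<rho> t y0 \<le> k + h" using radial_dilate[OF tT(1) y0 kh(2)] kh(2) by simp
  qed
qed

text \<open>
  If the normal velocity is not positive at free boundary points near \<open>(t0, y0)\<close>, then the domain
  cannot have expanded through \<open>y0\<close>: a positive lower left Dini derivative of the radial function
  would be a positive normal velocity.  The conclusion is stated for balls in a cone
  at \<open>y0\<close> that opens towards the origin.
\<close>

lemma not_expanding:
  assumes t0: "t0 \<in> {0<..T}" and y: "y0 \<in> free_bdry U (w t0)" and g: "G t0 y0 \<noteq> 0"
    and Q: "open Q" "G t0 y0 \<in> Q"
    and no_vel: "\<And>t z. t \<in> {0<..T} \<Longrightarrow> z \<in> free_bdry U (w t) \<Longrightarrow> G t z \<in> Q \<Longrightarrow>
      \<not> velocity_pos (\<lambda>s. pos_set U (w s)) t z"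
  obtains d c H where "0 < d" "d < t0" "0 < c" "0 < H"
    "\<And>t h. t0 - d \<le> t \<Longrightarrow> t \<le> t0 \<Longrightarrow> 0 < h \<Longrightarrow> h \<le> H \<Longrightarrow>
       cball ((1 - h) *\<^sub>R y0) (c * h) \<subseteq> pos_set U (w t)"
proof -
  have t0': "t0 \<in> {0..T}" using t0 by auto
  have \<rho>0: "\<rho> t0 y0 = 1" "y0 \<noteq> 0"
    using y free_bdry_radial[OF t0'] zero_notin_U closure_subset[of U] by auto
  obtain d c H where d: "0 < d" "d < t0" and c: "0 < c" and H: "0 < H" "H \<le> 1/2"
    and near: "\<And>t. t0 - d \<le> t \<Longrightarrow> t \<le> t0 \<Longrightarrow> \<bar>\<rho> t y0 - 1\<bar> \<le> H"
    and fb: "\<And>t. t0 - d \<le> t \<Longrightarrow> t \<le> t0 \<Longrightarrow> \<rho> t y0 *\<^sub>R y0 \<in> free_bdry U (w t) \<and> G t (\<rho> t y0 *\<^sub>R y0) \<in> Q"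
    and beyond: "\<And>t k h x. t0 - d \<le> t \<Longrightarrow> t \<le> t0 \<Longrightarrow> \<bar>k - 1\<bar> \<le> H \<Longrightarrow> 0 < h \<Longrightarrow> h \<le> H \<Longrightarrow>
       x \<in> cball (k *\<^sub>R y0) (c * h) \<Longrightarrow> x \<in> pos_set U (w t) \<Longrightarrow> k - h < \<rho> t y0"
    and before: "\<And>t k h x. t0 - d \<le> t \<Longrightarrow> t \<le> t0 \<Longrightarrow> \<bar>k - 1\<bar> \<le> H \<Longrightarrow> 0 < h \<Longrightarrow> h \<le> H \<Longrightarrow>
       x \<in> cball (k *\<^sub>R y0) (c * h) \<Longrightarrow> x \<notin> pos_set U (w t) \<Longrightarrow> \<rho> t y0 \<le> k + h"
    by (rule radial_near_free_bdry[OF t0 y g Q]) (rule that)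
  have radial: "1 \<le> \<rho> a y0" if a: "t0 - d \<le> a" "a \<le> t0" for a
  proof -
    have a0: "0 < a" using a d by simp
    then have sub: "{a..t0} \<subseteq> {0..T}" using t0 by auto
    have "(\<lambda>s. \<rho> s y0) t0 \<le> (\<lambda>s. \<rho> s y0) a"
    proof (rule no_increase[OF a(2) _ H(1)])
      show "continuous_on {a..t0} (\<lambda>s. \<rho> s y0)"
        by (intro continuous_intros continuous_on_subset[OF continuous_on_radial_time[OF \<rho>0(2)] sub])
      fix t v :: real
      assume at: "a < t" "t \<le> t0" and v: "0 < v" "v * (t - a) \<le> H"
      have tT: "t \<in> {0<..T}" and td: "t0 - d \<le> t" using at a0 t0 a by auto
      let ?z = "\<rho> t y0 *\<^sub>R y0"
      have "\<not> velocity_pos (\<lambda>s. pos_set U (w s)) t ?z" using no_vel[OF tT] fb[OF td at(2)] by simp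
      moreover have "0 < c * v" "0 < t - a" "t - a \<le> t" using c v at a0 by auto
      ultimately obtain s where s: "t - (t - a) \<le> s" "s < t" "\<not> cball ?z (c * v * (t - s)) \<subseteq> - pos_set U (w s)"
        unfolding velocity_pos_def by blast
      then obtain x where x: "x \<in> cball ?z (c * (v * (t - s)))" "x \<in> pos_set U (w s)"
        unfolding mult.assoc by blast
      have "v * (t - s) \<le> v * (t - a)" using s v by simp
      then have "v * (t - s) \<le> H" using v(2) by (rule order_trans)
      moreover have "0 < v * (t - s)" using v s by simp
      ultimately have h: "0 < v * (t - s)" "v * (t - s) \<le> H" by auto
      have sd: "t0 - d \<le> s" "s \<le> t0" using s a at by auto
      have "\<rho> t y0 - v * (t - s) < \<rho> s y0" by (rule beyond[OF sd near[OF td at(2)] h x])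
      then show "\<exists>s\<ge>a. s < t \<and> \<rho> t y0 - v * (t - s) \<le> \<rho> s y0" using s by (intro exI[of _ s]) simp
    qed
    then show ?thesis using \<rho>0 by simp
  qed
  show ?thesis
  proof (rule that[OF d _ H(1)])
    show "0 < c / 2" using c by simp
    fix t h assume t: "t0 - d \<le> t" "t \<le> t0" and h: "0 < h" "h \<le> H"
    show "cball ((1 - h) *\<^sub>R y0) (c / 2 * h) \<subseteq> pos_set U (w t)"
    proof (rule subsetI, rule ccontr)
      fix x assume "x \<in> cball ((1 - h) *\<^sub>R y0) (c / 2 * h)" "x \<notin> pos_set U (w t)"
      then have "\<rho> t y0 \<le> (1 - h) + h / 2" using h by (intro before[OF t]) auto
      then show False using radial[OF t] h by simp
    qed
  qed
qed

text \<open>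
  The counterpart of \<open>not_expanding\<close>, with balls in a cone that opens away from the origin.
\<close>

lemma not_contracting:
  assumes t0: "t0 \<in> {0<..T}" and y: "y0 \<in> free_bdry U (w t0)" and g: "G t0 y0 \<noteq> 0"
    and Q: "open Q" "G t0 y0 \<in> Q"
    and no_vel: "\<And>t z. t \<in> {0<..T} \<Longrightarrow> z \<in> free_bdry U (w t) \<Longrightarrow> G t z \<in> Q \<Longrightarrow>
      \<not> velocity_neg (\<lambda>s. pos_set U (w s)) t z"
  obtains d c H where "0 < d" "d < t0" "0 < c" "0 < H"
    "\<And>t h. t0 - d \<le> t \<Longrightarrow> t \<le> t0 \<Longrightarrow> 0 < h \<Longrightarrow> h \<le> H \<Longrightarrow>
       cball ((1 + h) *\<^sub>R y0) (c * h) \<inter> pos_set U (w t) = {}"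
proof -
  have t0': "t0 \<in> {0..T}" using t0 by auto
  have \<rho>0: "\<rho> t0 y0 = 1" "y0 \<noteq> 0"
    using y free_bdry_radial[OF t0'] zero_notin_U closure_subset[of U] by auto
  obtain d c H where d: "0 < d" "d < t0" and c: "0 < c" and H: "0 < H" "H \<le> 1/2"
    and near: "\<And>t. t0 - d \<le> t \<Longrightarrow> t \<le> t0 \<Longrightarrow> \<bar>\<rho> t y0 - 1\<bar> \<le> H"
    and fb: "\<And>t. t0 - d \<le> t \<Longrightarrow> t \<le> t0 \<Longrightarrow> \<rho> t y0 *\<^sub>R y0 \<in> free_bdry U (w t) \<and> G t (\<rho> t y0 *\<^sub>R y0) \<in> Q"
    and beyond: "\<And>t k h x. t0 - d \<le> t \<Longrightarrow> t \<le> t0 \<Longrightarrow> \<bar>k - 1\<bar> \<le> H \<Longrightarrow> 0 < h \<Longrightarrow> h \<le> H \<Longrightarrow>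
       x \<in> cball (k *\<^sub>R y0) (c * h) \<Longrightarrow> x \<in> pos_set U (w t) \<Longrightarrow> k - h < \<rho> t y0"
    and before: "\<And>t k h x. t0 - d \<le> t \<Longrightarrow> t \<le> t0 \<Longrightarrow> \<bar>k - 1\<bar> \<le> H \<Longrightarrow> 0 < h \<Longrightarrow> h \<le> H \<Longrightarrow>
       x \<in> cball (k *\<^sub>R y0) (c * h) \<Longrightarrow> x \<notin> pos_set U (w t) \<Longrightarrow> \<rho> t y0 \<le> k + h"
    by (rule radial_near_free_bdry[OF t0 y g Q]) (rule that)
  have radial: "\<rho> a y0 \<le> 1" if a: "t0 - d \<le> a" "a \<le> t0" for a
  proof -
    have a0: "0 < a" using a d by simp
    then have sub: "{a..t0} \<subseteq> {0..T}" using t0 by auto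
    have "(\<lambda>s. - \<rho> s y0) t0 \<le> (\<lambda>s. - \<rho> s y0) a"
    proof (rule no_increase[OF a(2) _ H(1)])
      show "continuous_on {a..t0} (\<lambda>s. - \<rho> s y0)"
        by (intro continuous_intros continuous_on_subset[OF continuous_on_radial_time[OF \<rho>0(2)] sub])
      fix t v :: real
      assume at: "a < t" "t \<le> t0" and v: "0 < v" "v * (t - a) \<le> H"
      have tT: "t \<in> {0<..T}" and td: "t0 - d \<le> t" using at a0 t0 a by auto
      let ?z = "\<rho> t y0 *\<^sub>R y0"
      have "\<not> velocity_neg (\<lambda>s. pos_set U (w s)) t ?z" using no_vel[OF tT] fb[OF td at(2)] by simp
      moreover have "0 < c * v" "0 < t - a" "t - a \<le> t" using c v at a0 by auto
      ultimately obtain s where s: "t - (t - a) \<le> s" "s < t" "\<not> cball ?z (c * v * (t - s)) \<subseteq> pos_set U (w s)"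
        unfolding velocity_neg_def by blast
      then obtain x where x: "x \<in> cball ?z (c * (v * (t - s)))" "x \<notin> pos_set U (w s)"
        unfolding mult.assoc by blast
      have "v * (t - s) \<le> v * (t - a)" using s v by simp
      then have "v * (t - s) \<le> H" using v(2) by (rule order_trans)
      moreover have "0 < v * (t - s)" using v s by simp
      ultimately have h: "0 < v * (t - s)" "v * (t - s) \<le> H" by auto
      have sd: "t0 - d \<le> s" "s \<le> t0" using s a at by auto
      have "\<rho> s y0 \<le> \<rho> t y0 + v * (t - s)" by (rule before[OF sd near[OF td at(2)] h x])
      then show "\<exists>s\<ge>a. s < t \<and> - \<rho> t y0 - v * (t - s) \<le> - \<rho> s y0" using s by (intro exI[of _ s]) simp
    qed
    then show ?thesis using \<rho>0 by simp
  qed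
  show ?thesis
  proof (rule that[OF d _ H(1)])
    show "0 < c / 2" using c by simp
    fix t h assume t: "t0 - d \<le> t" "t \<le> t0" and h: "0 < h" "h \<le> H"
    show "cball ((1 + h) *\<^sub>R y0) (c / 2 * h) \<inter> pos_set U (w t) = {}"
    proof (rule ccontr)
      assume "\<not> ?thesis"
      then obtain x where "x \<in> cball ((1 + h) *\<^sub>R y0) (c / 2 * h)" "x \<in> pos_set U (w t)" by blast
      then have "(1 + h) - h / 2 < \<rho> t y0" using h by (intro beyond[OF t]) auto
      then show False using radial[OF t] h by simp
    qed
  qed
qed

end

section \<open>Dynamic slope conditions for evolutions equal to their envelopes\<close>

lemma closure_pos_set_cong:
  assumes U: "open U" and eq: "\<And>x. x \<in> U \<Longrightarrow> v x = v' x" and x: "x \<in> U"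
  shows "x \<in> closure (pos_set U v) \<longleftrightarrow> x \<in> closure (pos_set U v')"
    and "x \<in> interior (pos_set U v) \<longleftrightarrow> x \<in> interior (pos_set U v')"
proof -
  have i: "pos_set U v \<inter> U = pos_set U v' \<inter> U" using eq by (auto simp: pos_set_def)
  have "y \<in> closure S \<longleftrightarrow> y \<in> closure (S \<inter> U)" if "y \<in> U" for y S
    using open_Int_closure_subset[OF U, of S] that closure_mono[of "S \<inter> U" S] by (auto simp: Int_commute)
  then show "x \<in> closure (pos_set U v) \<longleftrightarrow> x \<in> closure (pos_set U v')" using i x by metis
  have "y \<in> interior S \<longleftrightarrow> y \<in> interior (S \<inter> U)" if "y \<in> U" for y S
    using that by (simp add: interior_open[OF U])
  then show "x \<in> interior (pos_set U v) \<longleftrightarrow> x \<in> interior (pos_set U v')" using i x by metis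
qed

lemma free_bdry_cong:
  assumes "open U" and "\<And>x. x \<in> U \<Longrightarrow> v x = v' x"
  shows "free_bdry U v = free_bdry U v'"
proof -
  have "x \<in> free_bdry U v \<longleftrightarrow> x \<in> free_bdry U v'" for x
    using closure_pos_set_cong[where v = v and v' = v', OF assms, of x]
    unfolding free_bdry_def frontier_def by auto
  then show ?thesis by blast
qed

lemma superdiff_cong:
  assumes U: "open U" and eq: "\<And>x. x \<in> U \<Longrightarrow> v x = v' x" and x0: "x0 \<in> U"
    and p: "p \<in> superdiff U v x0"
  shows "p \<in> superdiff U v' x0"
  unfolding superdiff_def
proof (intro CollectI allI impI)
  fix e :: real assume "e > 0"
  then obtain d where d: "d > 0" "\<And>x. x \<in> closure (pos_set U v) \<Longrightarrow> norm (x - x0) < d \<Longrightarrow>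
      v x \<le> p \<bullet> (x - x0) + e * norm (x - x0)"
    using p unfolding superdiff_def mem_Collect_eq by meson
  obtain r where r: "r > 0" "ball x0 r \<subseteq> U" using x0 U open_contains_ball by metis
  have "v' x \<le> p \<bullet> (x - x0) + e * norm (x - x0)"
    if "x \<in> closure (pos_set U v')" "norm (x - x0) < min d r" for x
  proof -
    have "x \<in> U" using that(2) r(2) by (auto simp: dist_norm norm_minus_commute)
    then show ?thesis
      using closure_pos_set_cong(1)[where v = v and v' = v', OF U eq, of x] d(2)[of x] eq[of x] that by simp
  qed
  then show "\<exists>d>0. \<forall>x\<in>closure (pos_set U v'). norm (x - x0) < d \<longrightarrow>
      v' x \<le> p \<bullet> (x - x0) + e * norm (x - x0)"
    using d(1) r(1) by (intro exI[of _ "min d r"]) auto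
qed

lemma subdiff_cong:
  assumes U: "open U" and eq: "\<And>x. x \<in> U \<Longrightarrow> v x = v' x" and x0: "x0 \<in> U"
    and p: "p \<in> subdiff U v x0"
  shows "p \<in> subdiff U v' x0"
  unfolding subdiff_def
proof (intro CollectI allI impI)
  fix e :: real assume "e > 0"
  then obtain d where d: "d > 0" "\<And>x. x \<in> closure U \<Longrightarrow> norm (x - x0) < d \<Longrightarrow>
      v x \<ge> p \<bullet> (x - x0) - e * norm (x - x0)"
    using p unfolding subdiff_def mem_Collect_eq by meson
  obtain r where r: "r > 0" "ball x0 r \<subseteq> U" using x0 U open_contains_ball by metis
  have "v' x \<ge> p \<bullet> (x - x0) - e * norm (x - x0)"
    if "x \<in> closure U" "norm (x - x0) < min d r" for x
  proof -
    have "x \<in> U" using that(2) r(2) by (auto simp: dist_norm norm_minus_commute)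
    then show ?thesis using d(2)[of x] eq[of x] that by simp
  qed
  then show "\<exists>d>0. \<forall>x\<in>closure U. norm (x - x0) < d \<longrightarrow>
      v' x \<ge> p \<bullet> (x - x0) - e * norm (x - x0)"
    using d(1) r(1) by (intro exI[of _ "min d r"]) auto
qed

text \<open>
  The balls in the definition of the normal velocity may be assumed to lie in \<open>U\<close>.  Envelopes thus
  only have to be known at points of \<open>U\<close>.
\<close>

lemma shrink_velocity_interval:
  assumes "open U" "x0 \<in> U" "c > 0" "r0 > (0::real)"
  obtains r1 where "0 < r1" "r1 \<le> r0"
    "\<And>t. t0 - r1 \<le> t \<Longrightarrow> cball x0 (c * (t0 - t)) \<subseteq> (U :: 'a::euclidean_space set)"
proof -
  obtain r where r: "r > 0" "cball x0 r \<subseteq> U" using assms(1,2) open_contains_cball by metis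
  show ?thesis
  proof (rule that[of "min r0 (r / c)"])
    fix t assume "t0 - min r0 (r / c) \<le> t"
    then have "t0 - t \<le> r / c" by simp
    then have "c * (t0 - t) \<le> r" using assms(3) by (simp add: field_simps)
    then show "cball x0 (c * (t0 - t)) \<subseteq> U" using r(2) subset_cball by blast
  qed (use assms r in auto)
qed

lemma subsolution_dynamic_slope:
  assumes U: "open U" and sub: "visc_subsolution U T \<mu>m \<mu>p F u"
    and env: "\<And>t x. t \<in> {0..T} \<Longrightarrow> x \<in> U \<Longrightarrow> upper_env U T u t x = u t x"
    and t0: "t0 \<in> {0..T}" and x0: "x0 \<in> free_bdry U (u t0)"
    and vel: "velocity_pos (\<lambda>t. pos_set U (u t)) t0 x0" and p: "p \<in> superdiff U (u t0) x0"
  shows "1 + \<mu>p \<le> (norm p)\<^sup>2"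
proof -
  have xU: "x0 \<in> U" using x0 by (simp add: free_bdry_def)
  obtain c r0 where c: "c > 0" "r0 > 0" "r0 \<le> t0"
    "\<And>t. t0 - r0 \<le> t \<Longrightarrow> t < t0 \<Longrightarrow> cball x0 (c * (t0 - t)) \<subseteq> - pos_set U (u t)"
    using vel unfolding velocity_pos_def by blast
  obtain r1 where r1: "0 < r1" "r1 \<le> r0" "\<And>t. t0 - r1 \<le> t \<Longrightarrow> cball x0 (c * (t0 - t)) \<subseteq> U"
    using shrink_velocity_interval[OF U xU c(1,2)] by blast
  have "cball x0 (c * (t0 - t)) \<subseteq> - pos_set U (upper_env U T u t)" if t: "t0 - r1 \<le> t" "t < t0" for t
  proof
    fix x assume x: "x \<in> cball x0 (c * (t0 - t))"
    have "x \<in> U" using r1(3)[OF t(1)] x by blast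
    moreover have "x \<notin> pos_set U (u t)" using c(4)[of t] x t r1 by auto
    moreover have "t \<in> {0..T}" using t t0 c r1 by auto
    ultimately show "x \<in> - pos_set U (upper_env U T u t)" using env by (auto simp: pos_set_def)
  qed
  then have "velocity_pos (\<lambda>t. pos_set U (upper_env U T u t)) t0 x0"
    unfolding velocity_pos_def using c r1 by (intro exI[of _ c] conjI exI[of _ r1]) auto
  moreover have "x0 \<in> free_bdry U (upper_env U T u t0)"
    using free_bdry_cong[OF U, of "upper_env U T u t0" "u t0"] env[OF t0] x0 by simp
  moreover have "p \<in> superdiff U (upper_env U T u t0) x0"
    by (rule superdiff_cong[OF U _ xU p]) (simp add: env[OF t0])
  ultimately show ?thesis using sub t0 unfolding visc_subsolution_def by blast
qed

lemma supersolution_dynamic_slope: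
  assumes U: "open U" and super: "visc_supersolution U T \<mu>m \<mu>p F u"
    and env: "\<And>t x. t \<in> {0..T} \<Longrightarrow> x \<in> U \<Longrightarrow> lower_env U T u t x = u t x"
    and t0: "t0 \<in> {0..T}" and x0: "x0 \<in> free_bdry U (u t0)"
    and vel: "velocity_neg (\<lambda>t. pos_set U (u t)) t0 x0" and p: "p \<in> subdiff U (u t0) x0"
  shows "(norm p)\<^sup>2 \<le> 1 - \<mu>m"
proof -
  have xU: "x0 \<in> U" using x0 by (simp add: free_bdry_def)
  obtain c r0 where c: "c > 0" "r0 > 0" "r0 \<le> t0"
    "\<And>t. t0 - r0 \<le> t \<Longrightarrow> t < t0 \<Longrightarrow> cball x0 (c * (t0 - t)) \<subseteq> pos_set U (u t)"
    using vel unfolding velocity_neg_def by blast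
  obtain r1 where r1: "0 < r1" "r1 \<le> r0" "\<And>t. t0 - r1 \<le> t \<Longrightarrow> cball x0 (c * (t0 - t)) \<subseteq> U"
    using shrink_velocity_interval[OF U xU c(1,2)] by blast
  have "cball x0 (c * (t0 - t)) \<subseteq> pos_set U (lower_env U T u t)" if t: "t0 - r1 \<le> t" "t < t0" for t
  proof
    fix x assume x: "x \<in> cball x0 (c * (t0 - t))"
    have "x \<in> U" using r1(3)[OF t(1)] x by blast
    moreover have "x \<in> pos_set U (u t)" using c(4)[of t] x t r1 by auto
    moreover have "t \<in> {0..T}" using t t0 c r1 by auto
    ultimately show "x \<in> pos_set U (lower_env U T u t)" using env by (auto simp: pos_set_def)
  qed
  then have "velocity_neg (\<lambda>t. pos_set U (lower_env U T u t)) t0 x0"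
    unfolding velocity_neg_def using c r1 by (intro exI[of _ c] conjI exI[of _ r1]) auto
  moreover have "x0 \<in> free_bdry U (lower_env U T u t0)"
    using free_bdry_cong[OF U, of "lower_env U T u t0" "u t0"] env[OF t0] x0 by simp
  moreover have "p \<in> subdiff U (lower_env U T u t0) x0"
    by (rule subdiff_cong[OF U _ xU p]) (simp add: env[OF t0])
  ultimately show ?thesis using super t0 unfolding visc_supersolution_def by blast
qed

lemma subdiff_dilate:
  assumes p: "p \<in> subdiff U f (\<mu> *\<^sub>R x0)" and \<mu>: "\<mu> > 0"
    and dil: "\<And>x. x \<in> closure U \<Longrightarrow> \<mu> *\<^sub>R x \<in> closure U"
    and le: "\<And>x. x \<in> closure U \<Longrightarrow> f (\<mu> *\<^sub>R x) \<le> h x"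
  shows "\<mu> *\<^sub>R p \<in> subdiff U h x0"
  unfolding subdiff_def
proof (intro CollectI allI impI)
  fix e :: real assume "e > 0"
  then have "e / \<mu> > 0" using \<mu> by simp
  then obtain d where d: "d > 0" "\<And>x. x \<in> closure U \<Longrightarrow> norm (x - \<mu> *\<^sub>R x0) < d \<Longrightarrow>
      f x \<ge> p \<bullet> (x - \<mu> *\<^sub>R x0) - (e / \<mu>) * norm (x - \<mu> *\<^sub>R x0)"
    using p unfolding subdiff_def mem_Collect_eq by meson
  have "h x \<ge> (\<mu> *\<^sub>R p) \<bullet> (x - x0) - e * norm (x - x0)"
    if x: "x \<in> closure U" "norm (x - x0) < d / \<mu>" for x
  proof -
    have eq: "\<mu> *\<^sub>R x - \<mu> *\<^sub>R x0 = \<mu> *\<^sub>R (x - x0)" by (simp add: scaleR_diff_right)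
    have n: "norm (\<mu> *\<^sub>R x - \<mu> *\<^sub>R x0) = \<mu> * norm (x - x0)" unfolding eq using \<mu> by simp
    have "norm (\<mu> *\<^sub>R x - \<mu> *\<^sub>R x0) < d" unfolding n using x(2) \<mu> by (simp add: field_simps)
    from d(2)[OF dil[OF x(1)] this] have "p \<bullet> (\<mu> *\<^sub>R (x - x0)) - (e / \<mu>) * (\<mu> * norm (x - x0)) \<le> f (\<mu> *\<^sub>R x)"
      unfolding n unfolding eq .
    then show ?thesis using le[OF x(1)] \<mu> by simp
  qed
  then show "\<exists>d>0. \<forall>x\<in>closure U. norm (x - x0) < d \<longrightarrow> h x \<ge> (\<mu> *\<^sub>R p) \<bullet> (x - x0) - e * norm (x - x0)"
    using d(1) \<mu> by (intro exI[of _ "d / \<mu>"]) auto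
qed

context star_evolution
begin

lemma jointly_continuous_eventually:
  assumes t: "t \<in> {0..T}" and x: "x \<in> U" and \<epsilon>: "\<epsilon> > 0"
  shows "eventually (\<lambda>(s, y). \<bar>w s y - w t x\<bar> < \<epsilon>) (at (t, x) within {0..T} \<times> closure U)"
proof -
  obtain d where d: "d > 0" "\<And>s y. s \<in> {0..T} \<Longrightarrow> \<bar>s - t\<bar> < d \<Longrightarrow> dist y x < d \<Longrightarrow> \<bar>w s y - w t x\<bar> < \<epsilon>"
    using jointly_continuous[OF assms] by metis
  have "\<bar>w s y - w t x\<bar> < \<epsilon>" if "s \<in> {0..T}" "dist (s, y) (t, x) < d" for s y
    using d(2)[OF that(1), of y] that(2) dist_fst_le[of "(s, y)" "(t, x)"] dist_snd_le[of "(s, y)" "(t, x)"]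
    by (simp add: dist_real_def)
  then show ?thesis unfolding eventually_at using d(1) by (intro exI[of _ d]) auto
qed

lemma upper_env_w:
  assumes t: "t \<in> {0..T}" and x: "x \<in> U"
  shows "upper_env U T w t x = w t x"
proof (rule upper_env_eq[where u = w, OF open_U t _ cont[OF t]])
  show "x \<in> closure U" using x closure_subset by blast
  fix c assume "w t x < c"
  then have "eventually (\<lambda>(s, y). \<bar>w s y - w t x\<bar> < c - w t x) (at (t, x) within {0..T} \<times> closure U)"
    by (intro jointly_continuous_eventually t x) simp
  then show "eventually (\<lambda>(s, y). w s y < c) (at (t, x) within {0..T} \<times> closure U)"
    by (rule eventually_mono) auto
qed

lemma lower_env_w:
  assumes t: "t \<in> {0..T}" and x: "x \<in> U"
  shows "lower_env U T w t x = w t x"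
proof (rule lower_env_eq[where u = w, OF open_U t _ cont[OF t]])
  show "x \<in> closure U" using x closure_subset by blast
  fix c assume "c < w t x"
  then have "eventually (\<lambda>(s, y). \<bar>w s y - w t x\<bar> < w t x - c) (at (t, x) within {0..T} \<times> closure U)"
    by (intro jointly_continuous_eventually t x) simp
  then show "eventually (\<lambda>(s, y). c < w s y) (at (t, x) within {0..T} \<times> closure U)"
    by (rule eventually_mono) auto
qed

lemma nonzero_on_closure: "x \<in> closure U \<Longrightarrow> x \<noteq> 0"
  using zero_notin_U by auto

text \<open>
  The sets \<open>closure (D s)\<close> are bounded uniformly for \<open>s\<close> near \<open>t\<close>.
\<close>

lemma radial_large_bounded:
  assumes t: "t \<in> {0..T}"
  obtains d M where "d > 0"
    "\<And>s x. s \<in> {0..T} \<Longrightarrow> \<bar>s - t\<bar> < d \<Longrightarrow> x \<noteq> 0 \<Longrightarrow> 1 \<le> \<rho> s x \<Longrightarrow> norm x \<le> M"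
proof -
  obtain d where d: "d > 0"
    "\<And>s x. s \<in> {0..T} \<Longrightarrow> \<bar>s - t\<bar> < d \<Longrightarrow> x \<noteq> 0 \<Longrightarrow> \<bar>\<rho> t x / \<rho> s x - 1\<bar> < 1/2"
    using radial_ratio[OF t, of "1/2"] by auto
  obtain M where M: "\<And>y. y \<in> closure (D t) \<Longrightarrow> norm y \<le> M"
    using bounded_closure[OF bounded_pos[OF t]] unfolding bounded_iff by blast
  have "norm x \<le> 2 * M" if x: "s \<in> {0..T}" "\<bar>s - t\<bar> < d" "x \<noteq> 0" "1 \<le> \<rho> s x" for s x
  proof -
    have "1/2 < \<rho> t x / \<rho> s x" using d(2)[OF x(1-3)] by linarith
    then have "\<rho> s x < 2 * \<rho> t x" using x(4) by (simp add: field_simps)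
    then have "1 \<le> \<rho> t ((1/2) *\<^sub>R x)" using radial_dilate[OF t x(3), of "1/2"] x(4) by simp
    then have "(1/2) *\<^sub>R x \<in> closure (D t)"
      using star_body.in_closure_iff[OF body[OF t]] x(3) by simp
    then show ?thesis using M by fastforce
  qed
  then show ?thesis using that d(1) by blast
qed

end

lemma star_evolutionI:
  assumes "open U" and "compact (- U)" and "strongly_star_shaped (- U)"
    and "bounded_evolution U T w" and "regular_evolution U T w"
  obtains G L where "star_evolution U T w G L"
proof -
  obtain L where L: "\<forall>s\<in>{0..T}. \<forall>t\<in>{0..T}.
        hausdorff_distance (frontier (pos_set U (w s) \<union> - U)) (frontier (pos_set U (w t) \<union> - U))
          \<le> L * \<bar>s - t\<bar>"
    using assms(5) unfolding regular_evolution_def by blast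
  obtain G where G: "\<forall>t\<in>{0..T}. \<forall>x \<in> pos_set U (w t) \<inter> U. GDERIV (w t) x :> G t x"
    "continuous_on {(t, x). t \<in> {0..T} \<and> x \<in> closure (pos_set U (w t))} (\<lambda>(t, x). G t x)"
    using assms(5) unfolding regular_evolution_def by blast
  have 1: "\<forall>t\<in>{0..T}. bounded (pos_set U (w t) \<union> - U) \<and> strongly_star_shaped (pos_set U (w t) \<union> - U)"
    using assms(5) unfolding regular_evolution_def by blast
  have "star_evolution U T w G L"
    by unfold_locales
      (use assms(1-4) L G 1 in \<open>auto simp: bounded_evolution_def compact_imp_bounded\<close>)
  then show ?thesis using that by blast
qed

section \<open>Comparison with a regular subsolution\<close>

context star_evolution
begin

lemma regular_subsolution_below:
  assumes sub: "visc_subsolution U T \<mu>m \<mu>p F w" and super: "visc_supersolution U T \<mu>m \<mu>p F u"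
    and lsc: "lsc_on ({0..T} \<times> closure U) (\<lambda>(t, x). u t x)"
    and star0: "strongly_star_shaped_fun U (u 0)"
    and init: "\<And>x. x \<in> closure U \<Longrightarrow> w 0 x \<le> u 0 x"
    and \<mu>m: "\<mu>m < 1" and F: "\<And>t. t \<in> {0..T} \<Longrightarrow> 0 < F t"
    and t1: "t1 \<in> {0..T}" and x1: "x1 \<in> closure U"
  shows "w t1 x1 \<le> u t1 x1"
proof -
  obtain r where "dilation_domain U r" using U_away by blast
  then interpret dd: dilation_domain U r .
  have contu: "continuous_on (closure U) (u t)" and nonnegu: "\<And>x. x \<in> closure U \<Longrightarrow> 0 \<le> u t x"
    and bdu: "\<And>x. x \<in> frontier U \<Longrightarrow> F t \<le> u t x"
    and superh: "superharmonic_on (pos_set U (u t) \<inter> U) (u t)" if "t \<in> {0..T}" for t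
    using super that unfolding visc_supersolution_def bounded_evolution_def by blast+
  have bdw: "\<And>x. x \<in> frontier U \<Longrightarrow> w t x \<le> F t"
    and subh: "subharmonic_on (pos_set U (w t) \<inter> U) (w t)" if "t \<in> {0..T}" for t
    using sub that unfolding visc_subsolution_def by blast+
  have bpos: "bounded (pos_set U (w t))" if "t \<in> {0..T}" for t
    using bounded_pos[OF that] bounded_subset by blast
  have lsc': "eventually (\<lambda>(s, y). c < u s y) (at (t, x) within {0..T} \<times> closure U)"
    if "t \<in> {0..T}" "x \<in> closure U" "c < u t x" for t x c
  proof -
    have "(t, x) \<in> {0..T} \<times> closure U" "c < (\<lambda>(t, x). u t x) (t, x)" using that by auto
    with lsc have "eventually (\<lambda>z. c < (\<lambda>(t, x). u t x) z) (at (t, x) within {0..T} \<times> closure U)"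
      unfolding lsc_on_def by blast
    then show ?thesis by (rule eventually_mono) auto
  qed
  have envu: "lower_env U T u t x = u t x" if "t \<in> {0..T}" "x \<in> U" for t x
    by (rule lower_env_eq[where u = u, OF open_U that(1) _ contu[OF that(1)] lsc'[OF that(1)]])
      (use that(2) closure_subset in auto)
  have dU: "\<mu> *\<^sub>R x \<in> U" "\<mu> *\<^sub>R x \<in> closure U" if "x \<in> closure U" "1 < \<mu>" for x \<mu>
    using dilate_U[OF that] closure_subset by auto
  have cl_iff: "\<mu> *\<^sub>R x \<in> closure (pos_set U (w t)) \<longleftrightarrow> \<mu> \<le> \<rho> t x"
    and pos_iff': "0 < w t (\<mu> *\<^sub>R x) \<longleftrightarrow> \<mu> < \<rho> t x" if "t \<in> {0..T}" "x \<in> closure U" "1 < \<mu>" for t x \<mu>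
    using closure_pos_iff[OF that(1) dU(1)[OF that(2,3)]] pos_iff[OF that(1) dU(1)[OF that(2,3)]]
      radial_dilate[OF that(1) nonzero_on_closure[OF that(2)], of \<mu>] that(3) by (auto simp: field_simps)
  have main: "w t1 ((1 + \<epsilon> * (1 + t1)) *\<^sub>R x1) \<le> u t1 x1" if \<epsilon>: "\<epsilon> > 0" for \<epsilon> :: real
  proof -
    define \<Lambda> where "\<Lambda> t = 1 + \<epsilon> * (1 + t)" for t
    have \<Lambda>1: "1 < \<Lambda> t" if "0 \<le> t" for t using \<epsilon> that by (simp add: \<Lambda>_def add_pos_nonneg)
    \<comment> \<open>times at which the support of the dilation of \<open>w\<close> reaches the zero set of \<open>u\<close>\<close>
    define B where "B = {t \<in> {0..T}. \<exists>x\<in>closure U. \<Lambda> t \<le> \<rho> t x \<and> u t x \<le> 0}"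
    have "B = {}"
    proof (rule ccontr)
      assume "B \<noteq> {}"
      \<comment> \<open>so that there is a first such time; this uses lower semicontinuity of \<open>u\<close>\<close>
      have "closed B"
        unfolding closed_sequential_limits
      proof (intro allI impI)
        fix s t assume "(\<forall>n. s n \<in> B) \<and> s \<longlonglongrightarrow> t"
        then have sB: "\<And>n. s n \<in> B" and st: "s \<longlonglongrightarrow> t" by auto
        have sT: "s n \<in> {0..T}" for n using sB[of n] by (simp add: B_def)
        have tT: "t \<in> {0..T}" using closed_sequentially[OF closed_atLeastAtMost _ st, of 0 T] sT by blast
        have "\<exists>y. \<forall>n. y n \<in> closure U \<and> \<Lambda> (s n) \<le> \<rho> (s n) (y n) \<and> u (s n) (y n) \<le> 0"
          using sB unfolding B_def by (intro choice) blast
        then obtain y where y: "\<And>n. y n \<in> closure U" "\<And>n. \<Lambda> (s n) \<le> \<rho> (s n) (y n)" "\<And>n. u (s n) (y n) \<le> 0"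
          by blast
        obtain d M where d: "d > 0"
          "\<And>s x. s \<in> {0..T} \<Longrightarrow> \<bar>s - t\<bar> < d \<Longrightarrow> x \<noteq> 0 \<Longrightarrow> 1 \<le> \<rho> s x \<Longrightarrow> norm x \<le> M"
          using radial_large_bounded[OF tT] by blast
        obtain N where N: "\<And>n. n \<ge> N \<Longrightarrow> \<bar>s n - t\<bar> < d"
          using st d(1) unfolding LIMSEQ_def dist_real_def by blast
        have yM: "y (n + N) \<in> cball 0 M" for n
        proof -
          have "1 \<le> \<rho> (s (n + N)) (y (n + N))" using y(2)[of "n + N"] \<Lambda>1[of "s (n + N)"] sT[of "n + N"] by simp
          then show ?thesis using d(2)[OF sT[of "n + N"] N[of "n + N"] nonzero_on_closure[OF y(1)[of "n + N"]]]
            by simp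
        qed
        then obtain x k where xk: "strict_mono (k :: nat \<Rightarrow> nat)" "((\<lambda>n. y (n + N)) \<circ> k) \<longlonglongrightarrow> x"
          using compact_cball[of 0 M] unfolding compact_def by meson
        define s' y' where "s' n = s (k n + N)" and "y' n = y (k n + N)" for n
        have y'x: "y' \<longlonglongrightarrow> x" using xk(2) by (simp add: y'_def[abs_def] o_def)
        have s't: "s' \<longlonglongrightarrow> t"
          using LIMSEQ_subseq_LIMSEQ[OF LIMSEQ_ignore_initial_segment[OF st, of N] xk(1)]
          by (simp add: s'_def[abs_def] o_def)
        have props: "s' n \<in> {0..T}" "y' n \<in> closure U" "\<Lambda> (s' n) \<le> \<rho> (s' n) (y' n)" "u (s' n) (y' n) \<le> 0" for n
          using sT y by (auto simp: s'_def y'_def)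
        have xU: "x \<in> closure U" using closed_sequentially[OF closed_closure _ y'x] props(2) by blast
        have zl: "(\<lambda>n. (s' n, y' n)) \<longlonglongrightarrow> (t, x)" by (intro tendsto_Pair s't y'x)
        have "(\<lambda>n. (\<lambda>(s, y). \<rho> s y) (s' n, y' n)) \<longlonglongrightarrow> (\<lambda>(s, y). \<rho> s y) (t, x)"
          by (rule continuous_on_tendsto_compose[OF continuous_on_radial_joint zl])
            (use tT props nonzero_on_closure xU in auto)
        then have "(\<lambda>n. \<rho> (s' n) (y' n)) \<longlonglongrightarrow> \<rho> t x" by simp
        moreover have "(\<lambda>n. \<Lambda> (s' n)) \<longlonglongrightarrow> \<Lambda> t" unfolding \<Lambda>_def by (intro tendsto_intros s't)
        ultimately have "\<Lambda> t \<le> \<rho> t x" using props(3) by (intro LIMSEQ_le) auto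
        moreover have "u t x \<le> 0"
        proof (rule ccontr)
          assume "\<not> u t x \<le> 0"
          then have "eventually (\<lambda>(s, y). 0 < u s y) (at (t, x) within {0..T} \<times> closure U)"
            using lsc'[OF tT xU] by simp
          then obtain e where e: "e > 0" "\<And>z. z \<in> {0..T} \<times> closure U \<Longrightarrow> z \<noteq> (t, x) \<Longrightarrow> dist z (t, x) < e \<Longrightarrow>
              (case z of (s, y) \<Rightarrow> 0 < u s y)" unfolding eventually_at by blast
          obtain n where "dist (s' n, y' n) (t, x) < e"
            using zl e(1) unfolding LIMSEQ_def by blast
          then have "0 < u (s' n) (y' n)"
            using e(2)[of "(s' n, y' n)"] props(1,2)[of n] \<open>\<not> u t x \<le> 0\<close> by (cases "(s' n, y' n) = (t, x)") auto
          then show False using props(4)[of n] by simp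
        qed
        ultimately show "t \<in> B" using tT xU by (auto simp: B_def)
      qed
      moreover have bB: "bdd_below B" unfolding B_def by (rule bdd_belowI[of _ 0]) auto
      ultimately obtain t0 where t0: "t0 \<in> B" "\<And>s. s \<in> B \<Longrightarrow> t0 \<le> s"
        using closed_contains_Inf cInf_lower \<open>B \<noteq> {}\<close> by metis
      obtain xb where tT: "t0 \<in> {0..T}" and xb: "xb \<in> closure U" "\<Lambda> t0 \<le> \<rho> t0 xb" "u t0 xb \<le> 0"
        using t0(1) by (auto simp: B_def)
      have good: "0 < u t x" if "0 \<le> t" "t < t0" "x \<in> closure U" "\<Lambda> t \<le> \<rho> t x" for t x
        using t0(2)[of t] that tT by (force simp: B_def)
      have "t0 \<noteq> 0"
      proof
        assume t00: "t0 = 0"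
        let ?S = "{x \<in> closure U. 0 < u 0 x} \<union> - U"
        have "\<Lambda> 0 *\<^sub>R xb \<in> closure (pos_set U (w 0))"
          using cl_iff[of 0 xb "\<Lambda> 0"] xb tT t00 \<Lambda>1[of 0] by simp
        moreover have "pos_set U (w 0) \<subseteq> ?S" using init by (force simp: pos_set_def)
        ultimately have cl: "\<Lambda> 0 *\<^sub>R xb \<in> closure ?S" using closure_mono by blast
        have "strongly_star_shaped ?S" using star0 unfolding strongly_star_shaped_fun_def by blast
        then have "(1 / \<Lambda> 0) *\<^sub>R (\<Lambda> 0 *\<^sub>R xb) \<in> interior ?S"
          using \<Lambda>1[of 0] by (intro strongly_star_shaped_interior[OF _ cl]) auto
        then have "xb \<in> ?S" using \<Lambda>1[of 0] interior_subset by auto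
        then have "xb \<in> frontier U"
          using xb t00 open_U by (auto simp: frontier_def interior_open)
        then have "F 0 \<le> u 0 xb" using bdu[of 0] tT t00 by simp
        then show False using F[of 0] xb(3) tT t00 by simp
      qed
      then have t0pos: "t0 \<in> {0<..T}" using tT by auto
      have \<Lambda>0: "1 < \<Lambda> t0" using \<Lambda>1 tT by simp
      have xbc: "\<Lambda> t0 *\<^sub>R xb \<in> closure (pos_set U (w t0))" using cl_iff[OF tT xb(1) \<Lambda>0] xb(2) by simp
      obtain \<mu> x0 where \<mu>: "\<Lambda> t0 \<le> \<mu>" and x0: "x0 \<in> free_bdry U (u t0)"
        and y0: "\<mu> *\<^sub>R x0 \<in> free_bdry U (w t0)"
        and le: "\<And>x. x \<in> closure U \<Longrightarrow> w t0 (\<mu> *\<^sub>R x) \<le> u t0 x"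
      proof (rule dd.dilation_touching[OF cont[OF tT] nonneg[OF tT] subh[OF tT] bpos[OF tT] bdw[OF tT]
            contu[OF tT] nonnegu[OF tT] superh[OF tT] bdu[OF tT] F[OF tT] \<Lambda>0 xb(1) xbc xb(3)])
        fix \<mu> x0
        assume *: "\<Lambda> t0 \<le> \<mu>" "x0 \<in> free_bdry U (u t0)" "\<mu> *\<^sub>R x0 \<in> free_bdry U (w t0)"
          "\<And>x. x \<in> closure U \<Longrightarrow> w t0 (\<mu> *\<^sub>R x) \<le> u t0 x"
        show thesis by (rule that[OF *])
      qed
      have \<mu>1: "1 < \<mu>" using \<mu> \<Lambda>0 by simp
      define y where "y = \<mu> *\<^sub>R x0"
      define g where "g = G t0 y"
      have yf: "y \<in> free_bdry U (w t0)" using y0 by (simp add: y_def)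
      have x0U: "x0 \<in> U" using x0 by (simp add: free_bdry_def)
      have gsup: "g \<in> superdiff U (w t0) y" unfolding g_def by (rule gradient_superdiff[OF tT yf])
      have gsub: "\<mu> *\<^sub>R g \<in> subdiff U (u t0) x0"
        using gradient_subdiff[OF tT yf] dU(2)[OF _ \<mu>1] le \<mu>1
        by (intro subdiff_dilate[where f = "w t0"]) (auto simp: g_def y_def)
      have g1: "1 - \<mu>m \<le> (norm g)\<^sup>2" using sub tT yf gsup unfolding visc_subsolution_def by blast
      then have "0 < (norm g)\<^sup>2" using \<mu>m by linarith
      then have g0: "0 < norm g" by simp
      have strict: "(norm g)\<^sup>2 < (norm (\<mu> *\<^sub>R g))\<^sup>2"
        using \<mu>1 g0 by (intro power_strict_mono) auto
      have "(norm (\<mu> *\<^sub>R g))\<^sup>2 \<le> 1 + \<mu>p"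
        using super tT x0 gsub unfolding visc_supersolution_def by blast
      then have g2: "(norm g)\<^sup>2 < 1 + \<mu>p" using strict by simp
      let ?Q = "{p :: 'a. (norm p)\<^sup>2 < 1 + \<mu>p}"
      have oQ: "open ?Q" by (intro open_Collect_less continuous_intros)
      have no_vel: "\<not> velocity_pos (\<lambda>s. pos_set U (w s)) t z"
        if tz: "t \<in> {0<..T}" "z \<in> free_bdry U (w t)" "G t z \<in> ?Q" for t z
      proof
        assume v: "velocity_pos (\<lambda>s. pos_set U (w s)) t z"
        have t: "t \<in> {0..T}" using tz(1) by auto
        have "1 + \<mu>p \<le> (norm (G t z))\<^sup>2"
          by (rule subsolution_dynamic_slope[OF open_U sub upper_env_w t tz(2) v gradient_superdiff[OF t tz(2)]])
        then show False using tz(3) by simp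
      qed
      have gy: "G t0 y \<noteq> 0" "G t0 y \<in> ?Q" using g0 g2 by (auto simp: g_def)
      obtain d c H where d: "0 < d" "d < t0" and c: "0 < c" and H: "0 < H"
        and cone: "\<And>t h. t0 - d \<le> t \<Longrightarrow> t \<le> t0 \<Longrightarrow> 0 < h \<Longrightarrow> h \<le> H \<Longrightarrow>
          cball ((1 - h) *\<^sub>R y) (c * h) \<subseteq> pos_set U (w t)"
        by (rule not_expanding[OF t0pos yf gy(1) oQ gy(2)]) (rule no_vel, assumption+, rule that)
      obtain rb where rb: "rb > 0" "ball x0 rb \<subseteq> U" using x0U open_U open_contains_ball by metis
      \<comment> \<open>the speed at which the balls grow: they are then mapped into the balls of \<open>cone\<close>\<close>
      define c2 where "c2 = c * \<epsilon> / (\<mu> * \<Lambda> t0)"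
      have c2: "c2 > 0" using c \<epsilon> \<mu>1 \<Lambda>0 by (simp add: c2_def)
      define m where "m = Min {d, H * \<Lambda> t0 / \<epsilon>, rb / c2}"
      have m: "m > 0" "m \<le> d" "m \<le> H * \<Lambda> t0 / \<epsilon>" "m \<le> rb / c2"
        using d(1) H rb(1) c2 \<Lambda>0 \<epsilon> by (auto simp: m_def)
      define r0 where "r0 = m / 2"
      have r0: "r0 > 0" "r0 < d" "r0 < H * \<Lambda> t0 / \<epsilon>" "r0 < rb / c2"
        using m unfolding r0_def by linarith+
      have "cball x0 (c2 * (t0 - t)) \<subseteq> pos_set U (u t)" if t: "t0 - r0 \<le> t" "t < t0" for t
      proof
        fix x assume x: "x \<in> cball x0 (c2 * (t0 - t))"
        have tT': "t \<in> {0..T}" using t r0 d tT by auto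
        have t0': "0 \<le> t" using tT' by simp
        have \<Lambda>t: "1 < \<Lambda> t" using \<Lambda>1 tT' by simp
        have "c2 * (t0 - t) \<le> c2 * r0" using t c2 by simp
        also have "\<dots> < rb" using r0(4) c2 by (simp add: field_simps)
        finally have xU: "x \<in> U" using x rb(2) by auto
        then have xU': "x \<in> closure U" using closure_subset by blast
        define h where "h = \<epsilon> * (t0 - t) / \<Lambda> t0"
        have h: "0 < h" "h \<le> H"
        proof -
          have "\<epsilon> * (t0 - t) \<le> \<epsilon> * r0" using t \<epsilon> by simp
          also have "\<dots> \<le> H * \<Lambda> t0" using r0(3) \<epsilon> by (simp add: field_simps)
          finally show "h \<le> H" using \<Lambda>0 by (simp add: h_def field_simps)
        qed (use \<epsilon> t \<Lambda>0 in \<open>simp add: h_def\<close>)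
        have ratio: "\<Lambda> t / \<Lambda> t0 = 1 - h" using \<Lambda>0 by (simp add: h_def \<Lambda>_def field_simps)
        have "0 < \<Lambda> t / \<Lambda> t0" using \<Lambda>t \<Lambda>0 by (intro divide_pos_pos) auto
        then have r01: "0 \<le> \<Lambda> t / \<Lambda> t0" "\<Lambda> t / \<Lambda> t0 \<le> 1" using ratio h by linarith+
        then have r02: "0 \<le> \<Lambda> t / \<Lambda> t0 * \<mu>" using \<mu>1 by (intro mult_nonneg_nonneg) auto
        \<comment> \<open>the factor \<open>\<mu> / \<Lambda> t0\<close>, possibly large, is removed at the end by star-shapedness\<close>
        define q where "q = (\<Lambda> t / \<Lambda> t0 * \<mu>) *\<^sub>R x"
        have "q - (1 - h) *\<^sub>R y = (\<Lambda> t / \<Lambda> t0 * \<mu>) *\<^sub>R (x - x0)"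
          unfolding ratio[symmetric] q_def y_def by (simp add: algebra_simps)
        then have "norm (q - (1 - h) *\<^sub>R y) = \<Lambda> t / \<Lambda> t0 * \<mu> * norm (x - x0)"
          using r02 by (simp only: norm_scaleR abs_of_nonneg)
        also have "\<dots> \<le> 1 * \<mu> * (c2 * (t0 - t))"
          using x r01 \<mu>1 by (intro mult_mono) (auto simp: dist_norm norm_minus_commute)
        also have "\<dots> = c * h" using \<mu>1 by (simp add: c2_def h_def)
        finally have "q \<in> cball ((1 - h) *\<^sub>R y) (c * h)" by (simp add: dist_norm norm_minus_commute)
        then have "q \<in> pos_set U (w t)" using cone[of t h] t r0 h by auto
        then have w: "0 < w t ((\<Lambda> t * (\<mu> / \<Lambda> t0)) *\<^sub>R x)" by (simp add: pos_set_def q_def)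
        have "\<Lambda> t * 1 \<le> \<Lambda> t * (\<mu> / \<Lambda> t0)" using \<mu> \<Lambda>0 \<Lambda>t by (intro mult_left_mono) auto
        then have ge: "\<Lambda> t \<le> \<Lambda> t * (\<mu> / \<Lambda> t0)" by simp
        then have "\<Lambda> t * (\<mu> / \<Lambda> t0) < \<rho> t x" using w pos_iff'[OF tT' xU'] \<Lambda>t by simp
        then have "0 < u t x" using good[OF t0' t(2) xU'] ge by simp
        then show "x \<in> pos_set U (u t)" using xU' by (simp add: pos_set_def)
      qed
      then have vel: "velocity_neg (\<lambda>t. pos_set U (u t)) t0 x0"
        unfolding velocity_neg_def using c2 r0 d by (intro exI[of _ c2] conjI exI[of _ r0]) auto
      have "(norm (\<mu> *\<^sub>R g))\<^sup>2 \<le> 1 - \<mu>m"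
        by (rule supersolution_dynamic_slope[OF open_U super envu tT x0 vel gsub])
      then show False using strict g1 by simp
    qed
    have pos: "0 < u t1 x" if "x \<in> U" "0 < w t1 (\<Lambda> t1 *\<^sub>R x)" for x
    proof -
      have xc: "x \<in> closure U" using that(1) closure_subset by blast
      have "\<Lambda> t1 < \<rho> t1 x" using pos_iff'[OF t1 xc] that(2) \<Lambda>1[of t1] t1 by simp
      then show ?thesis using \<open>B = {}\<close> t1 xc by (force simp: B_def)
    qed
    have "w t1 (\<Lambda> t1 *\<^sub>R x1) \<le> u t1 x1"
      by (rule dd.dilation_comparison[OF cont[OF t1] nonneg[OF t1] subh[OF t1] bpos[OF t1] bdw[OF t1]
            contu[OF t1] nonnegu[OF t1] superh[OF t1] bdu[OF t1]])
        (use F[OF t1] \<Lambda>1[of t1] t1 pos x1 in auto)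
    then show ?thesis by (simp add: \<Lambda>_def)
  qed
  have lim: "(\<lambda>n. (1 + inverse (real (Suc n)) * (1 + t1)) *\<^sub>R x1) \<longlonglongrightarrow> (1 + 0 * (1 + t1)) *\<^sub>R x1"
    by (intro tendsto_intros LIMSEQ_inverse_real_of_nat)
  have incl: "(1 + inverse (real (Suc n)) * (1 + t1)) *\<^sub>R x1 \<in> closure U" for n
    using t1 by (intro dU(2) x1) (auto simp: add_pos_nonneg)
  have "(\<lambda>n. w t1 ((1 + inverse (real (Suc n)) * (1 + t1)) *\<^sub>R x1)) \<longlonglongrightarrow> w t1 ((1 + 0 * (1 + t1)) *\<^sub>R x1)"
    by (rule continuous_on_tendsto_compose[OF cont[OF t1] lim]) (use x1 incl in auto)
  then have "w t1 ((1 + 0 * (1 + t1)) *\<^sub>R x1) \<le> u t1 x1"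
    by (rule LIMSEQ_le_const2) (use main in auto)
  then show ?thesis by simp
qed

end

section \<open>Persistence of support bounds for subsolutions\<close>

text \<open>
  If \<open>u\<close> lies, near \<open>s *\<^sub>R z0\<close>, below a multiple of a dilation of \<open>f\<close>, and is positive only where the
  dilation is, then superdifferentials of \<open>f\<close> at \<open>z0\<close> scale to ones of \<open>u\<close>.
\<close>

lemma superdiff_dilate:
  fixes U :: "'a::euclidean_space set"
  assumes p: "p \<in> superdiff U f z0" and s: "s > 0" and c: "c > 0" and r: "r > 0"
    and pos: "\<And>y. y \<in> pos_set U u \<Longrightarrow> y \<in> ball (s *\<^sub>R z0) r \<Longrightarrow> y /\<^sub>R s \<in> pos_set U f"
    and le: "\<And>y. y \<in> closure (pos_set U u) \<Longrightarrow> y \<in> ball (s *\<^sub>R z0) r \<Longrightarrow> u y \<le> c * f (y /\<^sub>R s)"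
  shows "(c / s) *\<^sub>R p \<in> superdiff U u (s *\<^sub>R z0)"
  unfolding superdiff_def
proof (intro CollectI allI impI)
  fix e :: real assume "e > 0"
  then have "e * s / c > 0" using s c by simp
  then obtain d where d: "d > 0" "\<And>x. x \<in> closure (pos_set U f) \<Longrightarrow> norm (x - z0) < d \<Longrightarrow>
      f x \<le> p \<bullet> (x - z0) + (e * s / c) * norm (x - z0)"
    using p unfolding superdiff_def mem_Collect_eq by meson
  have "u y \<le> ((c / s) *\<^sub>R p) \<bullet> (y - s *\<^sub>R z0) + e * norm (y - s *\<^sub>R z0)"
    if y: "y \<in> closure (pos_set U u)" "norm (y - s *\<^sub>R z0) < min r (d * s)" for y
  proof -
    have yb: "y \<in> ball (s *\<^sub>R z0) r" using y(2) by (simp add: dist_norm norm_minus_commute)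
    have "y \<in> closure (ball (s *\<^sub>R z0) r \<inter> pos_set U u)"
      using open_Int_closure_subset[OF open_ball, of "s *\<^sub>R z0" r "pos_set U u"] yb y(1) by blast
    moreover have "(\<lambda>y. y /\<^sub>R s) ` closure (ball (s *\<^sub>R z0) r \<inter> pos_set U u)
        \<subseteq> closure ((\<lambda>y. y /\<^sub>R s) ` (ball (s *\<^sub>R z0) r \<inter> pos_set U u))"
      by (rule continuous_image_closure_subset[of UNIV]) (auto intro!: continuous_intros)
    moreover have "closure ((\<lambda>y. y /\<^sub>R s) ` (ball (s *\<^sub>R z0) r \<inter> pos_set U u)) \<subseteq> closure (pos_set U f)"
      using pos by (intro closure_mono) blast
    ultimately have zc: "y /\<^sub>R s \<in> closure (pos_set U f)" by blast
    have diff: "y /\<^sub>R s - z0 = (1 / s) *\<^sub>R (y - s *\<^sub>R z0)"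
      using s by (simp add: scaleR_diff_right divide_inverse)
    have n: "norm (y /\<^sub>R s - z0) = norm (y - s *\<^sub>R z0) / s" unfolding diff using s by simp
    have "norm (y /\<^sub>R s - z0) < d" unfolding n using y(2) s by (simp add: field_simps)
    from d(2)[OF zc this]
    have "f (y /\<^sub>R s) \<le> (1 / s) * (p \<bullet> (y - s *\<^sub>R z0)) + (e * s / c) * (norm (y - s *\<^sub>R z0) / s)"
      unfolding n unfolding diff by simp
    then have "c * f (y /\<^sub>R s) \<le> c * ((1 / s) * (p \<bullet> (y - s *\<^sub>R z0)) + (e * s / c) * (norm (y - s *\<^sub>R z0) / s))"
      using c by (intro mult_left_mono) auto
    also have "\<dots> = ((c / s) *\<^sub>R p) \<bullet> (y - s *\<^sub>R z0) + e * norm (y - s *\<^sub>R z0)"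
      using s c by (simp add: field_simps)
    finally show ?thesis using le[OF y(1) yb] by simp
  qed
  then show "\<exists>d>0. \<forall>y\<in>closure (pos_set U u). norm (y - s *\<^sub>R z0) < d \<longrightarrow>
      u y \<le> ((c / s) *\<^sub>R p) \<bullet> (y - s *\<^sub>R z0) + e * norm (y - s *\<^sub>R z0)"
    using d(1) r s by (intro exI[of _ "min r (d * s)"]) auto
qed

lemma compact_strict_lower_bound:
  fixes f :: "'a::topological_space \<Rightarrow> real"
  assumes "compact S" "continuous_on S f" "\<And>x. x \<in> S \<Longrightarrow> a < f x"
  obtains m where "a < m" "\<And>x. x \<in> S \<Longrightarrow> m \<le> f x"
proof (cases "S = {}")
  case True then show ?thesis using that[of "a + 1"] by simp
next
  case False
  then obtain x where "x \<in> S" "\<forall>y\<in>S. f x \<le> f y" using continuous_attains_inf assms(1,2) by blast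
  then show ?thesis using that[of "f x"] assms(3) by blast
qed

text \<open>
  A strict upper bound on a compact set persists for nearby times.
\<close>

lemma usc_on_small_on_compact:
  fixes u :: "real \<Rightarrow> 'a::euclidean_space \<Rightarrow> real"
  assumes usc: "usc_on ({0..T} \<times> closure U) (\<lambda>(t, x). u t x)" and t: "t \<in> {0..T}"
    and S: "compact S" "S \<subseteq> closure U" and less: "\<And>x. x \<in> S \<Longrightarrow> u t x < b"
  obtains d where "d > 0" "\<And>s x. s \<in> {0..T} \<Longrightarrow> \<bar>s - t\<bar> < d \<Longrightarrow> x \<in> S \<Longrightarrow> u s x < b"
proof -
  have loc: "\<exists>d>0. \<forall>s y. s \<in> {0..T} \<longrightarrow> y \<in> S \<longrightarrow> dist (s, y) (t, x) < d \<longrightarrow> u s y < b" if x: "x \<in> S" for x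
  proof -
    have "(t, x) \<in> {0..T} \<times> closure U" "(\<lambda>(t, x). u t x) (t, x) < b" using x t S less by auto
    with usc have "eventually (\<lambda>z. (\<lambda>(t, x). u t x) z < b) (at (t, x) within {0..T} \<times> closure U)"
      unfolding usc_on_def by blast
    then obtain d where d: "d > 0" "\<And>z. z \<in> {0..T} \<times> closure U \<Longrightarrow> z \<noteq> (t, x) \<Longrightarrow> dist z (t, x) < d \<Longrightarrow>
        (\<lambda>(t, x). u t x) z < b" unfolding eventually_at by blast
    have "u s y < b" if "s \<in> {0..T}" "y \<in> S" "dist (s, y) (t, x) < d" for s y
      using d(2)[of "(s, y)"] that S less[OF x] by (cases "(s, y) = (t, x)") auto
    then show ?thesis using d(1) by blast
  qed
  have "\<exists>d>0. \<forall>s x. s \<in> {0..T} \<longrightarrow> \<bar>s - t\<bar> < d \<longrightarrow> x \<in> S \<longrightarrow> u s x < b"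
  proof (rule ccontr)
    assume "\<not> ?thesis"
    then have "\<forall>n. \<exists>s x. s \<in> {0..T} \<and> \<bar>s - t\<bar> < inverse (Suc n) \<and> x \<in> S \<and> \<not> u s x < b"
      by (metis inverse_positive_iff_positive of_nat_0_less_iff zero_less_Suc)
    then obtain s x where sx: "\<And>n. s n \<in> {0..T}" "\<And>n. \<bar>s n - t\<bar> < inverse (Suc n)" "\<And>n. x n \<in> S"
      "\<And>n. \<not> u (s n) (x n) < b" by metis
    obtain l k where l: "l \<in> S" "strict_mono (k :: nat \<Rightarrow> nat)" "(x \<circ> k) \<longlonglongrightarrow> l"
      using S(1) sx(3) unfolding compact_def by metis
    have "(\<lambda>n. s n - t) \<longlonglongrightarrow> 0"
      by (rule Lim_null_comparison[OF _ LIMSEQ_inverse_real_of_nat])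
        (use sx(2) in \<open>auto intro!: always_eventually less_imp_le\<close>)
    then have "s \<longlonglongrightarrow> t" by (simp add: LIM_zero_iff)
    then have "(s \<circ> k) \<longlonglongrightarrow> t" using l(2) by (rule LIMSEQ_subseq_LIMSEQ)
    then have zl: "(\<lambda>n. ((s \<circ> k) n, (x \<circ> k) n)) \<longlonglongrightarrow> (t, l)" using l(3) by (rule tendsto_Pair)
    obtain d where d: "d > 0" "\<And>s y. s \<in> {0..T} \<Longrightarrow> y \<in> S \<Longrightarrow> dist (s, y) (t, l) < d \<Longrightarrow> u s y < b"
      using loc[OF l(1)] by blast
    obtain n where "dist ((s \<circ> k) n, (x \<circ> k) n) (t, l) < d"
      using zl d(1) unfolding LIMSEQ_def by blast
    then show False using d(2)[of "s (k n)" "x (k n)"] sx by simp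
  qed
  then show ?thesis using that by blast
qed

lemma superharmonic_on_dilate:
  fixes v :: "'a::euclidean_space \<Rightarrow> real"
  assumes v: "superharmonic_on S v" and s: "s > 0" and c: "c \<ge> 0"
    and S': "\<And>x. x \<in> S' \<Longrightarrow> s *\<^sub>R x \<in> S"
  shows "superharmonic_on S' (\<lambda>x. c * v (s *\<^sub>R x))"
  unfolding superharmonic_on_def subharmonic_on_def
proof (intro conjI allI impI)
  have cv: "continuous_on S (\<lambda>x. - v x)"
    using v unfolding superharmonic_on_def subharmonic_on_def by simp
  have cv': "continuous_on S' (\<lambda>x. - v (s *\<^sub>R x))"
    by (rule continuous_on_compose2[OF cv]) (use S' in \<open>auto intro!: continuous_intros\<close>)
  then have "continuous_on S' (\<lambda>x. c * (- v (s *\<^sub>R x)))" by (rule continuous_on_mult_left)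
  then show "continuous_on S' (\<lambda>x. - (c * v (s *\<^sub>R x)))" by (simp only: mult_minus_right)
  fix x r assume xr: "0 < r \<and> cball x r \<subseteq> S'"
  have sub: "cball (s *\<^sub>R x) (s * r) \<subseteq> S"
  proof
    fix z assume z: "z \<in> cball (s *\<^sub>R x) (s * r)"
    have "norm (s *\<^sub>R x - z) = s * norm (x - z /\<^sub>R s)"
      using s norm_scaleR[of s "x - z /\<^sub>R s"] by (simp add: scaleR_diff_right)
    then have "z /\<^sub>R s \<in> cball x r" using z s by (simp add: dist_norm)
    then show "z \<in> S" using S'[of "z /\<^sub>R s"] xr s by auto
  qed
  let ?B = "cball (s *\<^sub>R x) (s * r)"
  have "- v (s *\<^sub>R x) \<le> integral ?B (\<lambda>x. - v x) / measure lebesgue ?B"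
    using v sub xr s unfolding superharmonic_on_def subharmonic_on_def by simp
  also have "\<dots> = integral (cball x r) (\<lambda>y. - v (s *\<^sub>R y)) / measure lebesgue (cball x r)"
    by (rule mean_cball_dilate)
      (use xr s in \<open>auto intro!: integrable_on_cball_continuous continuous_on_subset[OF cv sub]\<close>)
  finally have "c * (- v (s *\<^sub>R x)) \<le> c * (integral (cball x r) (\<lambda>y. - v (s *\<^sub>R y)) / measure lebesgue (cball x r))"
    using c by (intro mult_left_mono) auto
  also have "\<dots> = integral (cball x r) (\<lambda>y. c * (- v (s *\<^sub>R y))) / measure lebesgue (cball x r)"
    by (simp only: integral_mult_right times_divide_eq_right)
  finally show "- (c * v (s *\<^sub>R x)) \<le> integral (cball x r) (\<lambda>x. - (c * v (s *\<^sub>R x))) / measure lebesgue (cball x r)"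
    by simp
qed

context star_evolution
begin

lemma open_radial_less:
  assumes t: "t \<in> {0..T}" shows "open {x. x \<noteq> 0 \<and> \<rho> t x < a}"
proof -
  have "open ((- {0}) \<inter> (\<lambda>x. \<rho> t x) -` {..<a})"
    by (intro continuous_open_preimage star_body.continuous_on_radial[OF body[OF t]]) auto
  also have "(- {0}) \<inter> (\<lambda>x. \<rho> t x) -` {..<a} = {x. x \<noteq> 0 \<and> \<rho> t x < a}" by auto
  finally show ?thesis .
qed

lemma closed_radial_le:
  assumes t: "t \<in> {0..T}"
  shows "closed {x \<in> closure U. \<rho> t x \<le> a}" and "closed {x \<in> closure U. a \<le> \<rho> t x}"
  using star_body.continuous_on_radial[OF body[OF t] zero_notin_U]
  by (auto intro!: continuous_on_closed_Collect_le continuous_on_const)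

text \<open>
  Suppose that the dilation by \<open>\<Lambda>\<close> of the positivity set of \<open>w t0\<close> contains the closure of that
  of \<open>u t0\<close>.  By upper semicontinuity \<open>u t\<close> is small, for \<open>t\<close> near \<open>t0\<close>, on the boundary of a
  slightly smaller dilation.  A small multiple of a dilation of \<open>w t0\<close> is a supersolution with
  gradient too small for the free boundary of \<open>u t\<close>, and hence a barrier which prevents the
  support of \<open>u t\<close> from jumping outwards.
\<close>

lemma support_persists:
  assumes w_pos: "\<And>x. x \<in> frontier U \<Longrightarrow> 0 < w t0 x"
    and w_super: "superharmonic_on (pos_set U (w t0) \<inter> U) (w t0)"
    and u: "\<And>t. t \<in> {0..T} \<Longrightarrow> continuous_on (closure U) (u t)"
      "\<And>t x. t \<in> {0..T} \<Longrightarrow> x \<in> closure U \<Longrightarrow> 0 \<le> u t x"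
      "\<And>t. t \<in> {0..T} \<Longrightarrow> subharmonic_on (pos_set U (u t) \<inter> U) (u t)"
      "\<And>t. t \<in> {0..T} \<Longrightarrow> bounded (pos_set U (u t))"
    and slope: "\<And>t x p. t \<in> {0..T} \<Longrightarrow> x \<in> free_bdry U (u t) \<Longrightarrow> p \<in> superdiff U (u t) x \<Longrightarrow> q \<le> (norm p)\<^sup>2"
    and q: "0 < q"
    and usc: "usc_on ({0..T} \<times> closure U) (\<lambda>(t, x). u t x)"
    and t0: "t0 \<in> {0..T}" and \<Lambda>: "1 < \<Lambda>"
    and good: "\<And>y. y \<in> closure (pos_set U (u t0)) \<Longrightarrow> 1 < \<Lambda> * \<rho> t0 y"
  obtains d where "d > 0"
    "\<And>t y. t \<in> {0..T} \<Longrightarrow> \<bar>t - t0\<bar> < d \<Longrightarrow> y \<in> closure (pos_set U (u t)) \<Longrightarrow> 1 < \<Lambda> * \<rho> t y"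
proof -
  interpret B: star_body "D t0" by (rule body[OF t0])
  have pc: "closure (pos_set U v) \<subseteq> closure U" for v
    by (intro closure_minimal pos_set_subset_closure closed_closure)
  have nz: "x \<noteq> 0" if "x \<in> closure U" for x by (rule nonzero_on_closure[OF that])
  have crad: "continuous_on S (\<rho> t0)" if "S \<subseteq> closure U" for S
    using that zero_notin_U by (intro B.continuous_on_radial) auto
  \<comment> \<open>strict inequalities on compact sets hold with a factor to spare, which \<open>\<beta> ^ 3\<close> does not exceed\<close>
  have cu: "compact (closure (pos_set U (u t0)))" using u(4)[OF t0] by simp
  have "continuous_on (closure (pos_set U (u t0))) (\<lambda>y. \<Lambda> * \<rho> t0 y)"
    by (intro continuous_intros crad pc)
  then obtain m where m: "1 < m" "\<And>y. y \<in> closure (pos_set U (u t0)) \<Longrightarrow> m \<le> \<Lambda> * \<rho> t0 y"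
    using compact_strict_lower_bound[where f = "\<lambda>y. \<Lambda> * \<rho> t0 y" and a = 1, OF cu _ good] by blast
  have cK: "star_body (- U)" using star_K bounded_K by (simp add: star_body_def)
  have fU: "frontier U \<subseteq> closure U" by (auto simp: frontier_def)
  have "compact (frontier U)" using bounded_K star_body.frontier_compact[OF cK] by (simp add: frontier_complement)
  moreover have "1 < \<rho> t0 x" if "x \<in> frontier U" for x
    using pos_imp_interior[OF t0 _ w_pos[OF that]] that fU B.in_interior_iff nz by blast
  ultimately obtain mK where mK: "1 < mK" "\<And>y. y \<in> frontier U \<Longrightarrow> mK \<le> \<rho> t0 y"
    using compact_strict_lower_bound[of "frontier U" "\<rho> t0" 1] crad[OF fU] by blast
  have in_U: "x \<in> U" if x: "x \<noteq> 0" "\<rho> t0 x < mK" for x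
  proof (rule ccontr)
    assume "x \<notin> U"
    then have "x \<in> closure (- U)" using closure_subset by blast
    then have s: "1 \<le> radial (- U) x" using star_body.in_closure_iff[OF cK x(1)] by simp
    have "radial (- U) x *\<^sub>R x \<in> frontier U"
      using star_body.radial_frontier_pos(1)[OF cK x(1)] by (simp add: frontier_complement)
    then have "mK \<le> \<rho> t0 x / radial (- U) x" using mK(2) B.radial_scale[OF x(1)] s by fastforce
    then have "mK * radial (- U) x \<le> \<rho> t0 x" using s by (simp add: field_simps)
    moreover have "mK * 1 \<le> mK * radial (- U) x" using s mK by (intro mult_left_mono) auto
    ultimately show False using x(2) by simp
  qed
  define \<gamma> where "\<gamma> = (1 + min \<Lambda> (min m mK)) / 2"
  have \<gamma>: "1 < \<gamma>" "\<gamma> < \<Lambda>" "\<gamma> < m" "\<gamma> < mK" using \<Lambda> m(1) mK(1) by (auto simp: \<gamma>_def min_def)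
  define \<beta> where "\<beta> = root 3 \<gamma>"
  have \<beta>: "1 < \<beta>" "\<beta> ^ 3 = \<gamma>" using \<gamma> by (auto simp: \<beta>_def)
  have \<beta>\<gamma>: "\<beta> \<le> \<gamma>" using \<beta> power_increasing[of 1 3 \<beta>] by simp
  define a where "a = \<gamma> / \<Lambda>"
  define \<kappa> where "\<kappa> = \<Lambda> / \<beta>\<^sup>2"
  have \<kappa>: "0 < \<kappa>" "\<kappa> * a = \<beta>" "\<kappa> * \<beta> = \<Lambda> / \<beta>"
    using \<Lambda> \<beta> by (auto simp: \<kappa>_def a_def power2_eq_square power3_eq_cube field_simps)
  have a: "0 < a" "a < 1" using \<gamma> \<Lambda> by (auto simp: a_def)
  \<comment> \<open>outside a dilation of \<open>D t0\<close> so large that \<open>u t0\<close> vanishes on its boundary\<close>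
  define V where "V = {x. x \<noteq> 0 \<and> \<rho> t0 x < a}"
  have oV: "open V" unfolding V_def by (rule open_radial_less[OF t0])
  have VU: "V \<subseteq> U" using in_U a mK by (auto simp: V_def)
  have clV: "closure V \<subseteq> {x \<in> closure U. \<rho> t0 x \<le> a}"
    by (rule closure_minimal[OF _ closed_radial_le(1)[OF t0]]) (use VU closure_subset[of U] in \<open>auto simp: V_def\<close>)
  have clVU: "closure V \<subseteq> U" using clV in_U nz a mK by force
  have clVc: "closure V \<subseteq> closure U" using clV by blast
  have frV: "x \<in> closure V" "x \<in> U" "\<rho> t0 x = a" if "x \<in> frontier V" for x
  proof -
    show x: "x \<in> closure V" using that by (simp add: frontier_def)
    then show "x \<in> U" using clVU by blast
    have "x \<notin> V" using that oV by (simp add: frontier_def interior_open)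
    then show "\<rho> t0 x = a" using x clV nz by (force simp: V_def)
  qed
  have cfV: "compact (frontier V)"
  proof -
    have "frontier V \<subseteq> (\<lambda>x. (1 / a) *\<^sub>R x) ` frontier (D t0)"
    proof
      fix x assume x: "x \<in> frontier V"
      have "\<rho> t0 x *\<^sub>R x \<in> frontier (D t0)"
        using B.radial_frontier_pos(1) frV(1)[OF x] clVc nz by blast
      then have "a *\<^sub>R x \<in> frontier (D t0)" using frV(3)[OF x] by simp
      moreover have "x = (1 / a) *\<^sub>R (a *\<^sub>R x)" using a by simp
      ultimately show "x \<in> (\<lambda>x. (1 / a) *\<^sub>R x) ` frontier (D t0)" by blast
    qed
    then have "bounded (frontier V)"
      using bounded_scaling[OF compact_imp_bounded[OF B.frontier_compact]] bounded_subset by blast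
    then show ?thesis by (simp add: compact_eq_bounded_closed frontier_closed)
  qed
  obtain r where "dilation_domain U r" using U_away by blast
  then interpret dd: dilation_domain U r .
  have dilV: "\<mu> *\<^sub>R x \<in> V" if "x \<in> closure V" "1 < \<mu>" for x \<mu>
  proof -
    have x: "x \<noteq> 0" "\<rho> t0 x \<le> a" using clV nz that(1) by auto
    have "\<rho> t0 x / \<mu> < a"
    proof -
      have "\<rho> t0 x \<le> a * 1" using x by simp
      also have "\<dots> < a * \<mu>" using a that(2) by (intro mult_strict_left_mono) auto
      finally show ?thesis using that(2) by (simp add: field_simps)
    qed
    then show ?thesis using B.radial_scale[OF x(1), of \<mu>] x(1) that(2) by (simp add: V_def)
  qed
  interpret dV: dilation_domain V r
    using oV dd.r_pos dd.away VU dilV by unfold_locales auto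
  \<comment> \<open>positive on \<open>frontier V\<close>, where the radial function of the dilated set is \<open>\<kappa> * a = \<beta> > 1\<close>\<close>
  define h0 where "h0 x = w t0 ((1 / \<kappa>) *\<^sub>R x)" for x
  have rk: "\<rho> t0 ((1 / \<kappa>) *\<^sub>R x) = \<kappa> * \<rho> t0 x" if "x \<in> closure V" for x
    using B.radial_scale[of x "1 / \<kappa>"] nz that clVc \<kappa> by auto
  have in_U': "(1 / \<kappa>) *\<^sub>R x \<in> U" if x: "x \<in> closure V" for x
  proof (rule in_U)
    show "(1 / \<kappa>) *\<^sub>R x \<noteq> 0" using nz x clVc \<kappa> by auto
    have "\<kappa> * \<rho> t0 x \<le> \<kappa> * a" using clV x \<kappa>(1) by (intro mult_left_mono) auto
    then show "\<rho> t0 ((1 / \<kappa>) *\<^sub>R x) < mK" unfolding rk[OF x] using \<kappa>(2) \<beta>\<gamma> \<gamma> by simp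
  qed
  have h0_pos: "0 < h0 x \<longleftrightarrow> 1 < \<kappa> * \<rho> t0 x" if "x \<in> closure V" for x
    using pos_iff[OF t0 in_U'[OF that]] rk[OF that] by (simp add: h0_def)
  have h0_nonneg: "0 \<le> h0 x" if "x \<in> closure V" for x
    using nonneg[OF t0, of "(1 / \<kappa>) *\<^sub>R x"] in_U'[OF that] closure_subset[of U] by (auto simp: h0_def)
  have ch0: "continuous_on (closure V) h0"
    unfolding h0_def
    by (rule continuous_on_compose2[OF cont[OF t0]])
      (use in_U' closure_subset[of U] in \<open>auto intro!: continuous_intros\<close>)
  obtain m1 where m1: "0 < m1" "\<And>x. x \<in> frontier V \<Longrightarrow> m1 \<le> h0 x"
  proof (rule compact_strict_lower_bound[OF cfV])
    show "continuous_on (frontier V) h0" using ch0 frV(1) continuous_on_subset by blast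
    show "0 < h0 x" if "x \<in> frontier V" for x
      using h0_pos[OF frV(1)[OF that]] frV(3)[OF that] \<kappa>(2) \<beta>(1) by simp
  qed (rule that)
  obtain M where M: "\<And>z. z \<in> free_bdry U (w t0) \<Longrightarrow> norm (G t0 z) \<le> M"
  proof -
    let ?S = "frontier (D t0)"
    have "?S \<subseteq> U"
    proof
      fix z assume z: "z \<in> ?S"
      then have "z \<noteq> 0" using B.zero_interior by (auto simp: frontier_def)
      then show "z \<in> U" using in_U B.in_frontier_iff z mK by auto
    qed
    then have "?S \<subseteq> closure (pos_set U (w t0))"
      using closure_pos_iff[OF t0] B.in_frontier_iff nz closure_subset[of U] by fastforce
    then have sub: "(\<lambda>z. (t0, z)) ` ?S \<subseteq> {(t, x). t \<in> {0..T} \<and> x \<in> closure (pos_set U (w t))}"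
      using t0 by auto
    have "continuous_on ?S (\<lambda>z. (\<lambda>(t, x). G t x) (t0, z))"
      by (rule continuous_on_compose2[OF cont_gradient _ sub]) (intro continuous_intros)
    then have "bounded ((\<lambda>z. G t0 z) ` ?S)"
      using compact_continuous_image B.frontier_compact compact_imp_bounded by fastforce
    then obtain M where "\<And>z. z \<in> ?S \<Longrightarrow> norm (G t0 z) \<le> M" unfolding bounded_iff by auto
    moreover have "z \<in> ?S" if "z \<in> free_bdry U (w t0)" for z
      using that free_bdry_radial[OF t0] B.in_frontier_iff nz closure_subset[of U] by blast
    ultimately show ?thesis using that by blast
  qed
  define N where "N = \<bar>M\<bar> + 1"
  have N: "0 < N" "M \<le> N" by (auto simp: N_def)
  \<comment> \<open>gives \<open>c * h0\<close> a gradient of norm at most \<open>sqrt q / 2\<close> on its free boundary\<close>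
  define c where "c = \<kappa> * sqrt q / (2 * N)"
  have c: "0 < c" using \<kappa> q N by (simp add: c_def)
  define h where "h x = c * h0 x" for x
  have h_pos: "0 < h x \<longleftrightarrow> 0 < h0 x" for x using c by (simp add: h_def zero_less_mult_iff)
  have "u t0 x < c * m1" if x: "x \<in> frontier V" for x
  proof -
    have "x \<notin> pos_set U (u t0)"
    proof
      assume "x \<in> pos_set U (u t0)"
      then have "m \<le> \<Lambda> * \<rho> t0 x" using m(2) closure_subset by blast
      then show False using frV(3)[OF x] \<gamma> \<Lambda> by (simp add: a_def)
    qed
    then have "u t0 x \<le> 0" using frV(2)[OF x] closure_subset[of U] by (auto simp: pos_set_def)
    then show ?thesis using c m1 by (smt (verit) mult_pos_pos)
  qed
  moreover have "frontier V \<subseteq> closure U" using frV(1) clVc by blast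
  ultimately obtain d1 where d1: "d1 > 0"
    "\<And>s x. s \<in> {0..T} \<Longrightarrow> \<bar>s - t0\<bar> < d1 \<Longrightarrow> x \<in> frontier V \<Longrightarrow> u s x < c * m1"
    using usc_on_small_on_compact[OF usc t0 cfV] by blast
  obtain d2 where d2: "d2 > 0"
    "\<And>s x. s \<in> {0..T} \<Longrightarrow> \<bar>s - t0\<bar> < d2 \<Longrightarrow> x \<noteq> 0 \<Longrightarrow> \<bar>\<rho> t0 x / \<rho> s x - 1\<bar> < \<beta> - 1"
    using radial_ratio[OF t0, of "\<beta> - 1"] \<beta>(1) by auto
  show ?thesis
  proof (rule that[of "min d1 d2"])
    fix t y assume t: "t \<in> {0..T}" "\<bar>t - t0\<bar> < min d1 d2" and y: "y \<in> closure (pos_set U (u t))"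
    have f: "continuous_on (closure V) (u t)" "\<And>x. x \<in> closure V \<Longrightarrow> 0 \<le> u t x"
      "bounded (pos_set V (u t))" "\<And>x. x \<in> frontier V \<Longrightarrow> u t x \<le> c * m1"
      using continuous_on_subset[OF u(1)[OF t(1)] clVc] u(2)[OF t(1)] clVc d1(2)[OF t(1)] t(2)
        bounded_subset[OF u(4)[OF t(1)], of "pos_set V (u t)"]
      by (auto simp: pos_set_def intro: less_imp_le)
    have f3: "subharmonic_on (pos_set V (u t) \<inter> V) (u t)"
    proof -
      have "pos_set V (u t) \<inter> V \<subseteq> pos_set U (u t) \<inter> U" using VU clVc by (auto simp: pos_set_def)
      then show ?thesis using u(3)[OF t(1)] unfolding subharmonic_on_def
        by (meson continuous_on_subset order_trans)
    qed
    have hh: "continuous_on (closure V) h" "\<And>x. x \<in> closure V \<Longrightarrow> 0 \<le> h x"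
      "\<And>x. x \<in> frontier V \<Longrightarrow> c * m1 \<le> h x"
      using ch0 h0_nonneg c m1(2) unfolding h_def by (auto intro!: continuous_intros)
    have h3: "superharmonic_on (pos_set V h \<inter> V) h"
      unfolding h_def[abs_def] h0_def
    proof (rule superharmonic_on_dilate[OF w_super])
      show "(1 / \<kappa>) *\<^sub>R x \<in> pos_set U (w t0) \<inter> U" if "x \<in> pos_set V (\<lambda>x. c * w t0 ((1 / \<kappa>) *\<^sub>R x)) \<inter> V" for x
        using that in_U'[of x] closure_subset[of U] c by (auto simp: pos_set_def zero_less_mult_iff)
    qed (use \<kappa> c in auto)
    have no_touch: "0 < h x" if x: "x \<in> closure V" "\<beta> *\<^sub>R x \<in> closure (pos_set V (u t))" for x
    proof (rule ccontr)
      assume "\<not> 0 < h x"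
      then have hx: "h x \<le> 0" by simp
      have cm: "0 < c * m1" using c m1 by simp
      show False
      proof (rule dV.dilation_touching[OF f(1,2) f3 f(3,4) hh(1,2) h3 hh(3) cm \<beta>(1) x hx])
        fix \<mu> x0
        assume \<mu>: "\<beta> \<le> \<mu>" and x0: "x0 \<in> free_bdry V h" and y1: "\<mu> *\<^sub>R x0 \<in> free_bdry V (u t)"
          and le: "\<And>x. x \<in> closure V \<Longrightarrow> u t (\<mu> *\<^sub>R x) \<le> h x"
          and pos: "\<And>x. x \<in> V \<Longrightarrow> 0 < u t (\<mu> *\<^sub>R x) \<Longrightarrow> 0 < h x"
        have \<mu>1: "1 < \<mu>" using \<mu> \<beta> by simp
        have x0': "x0 \<in> V" "h x0 = 0" "x0 \<in> closure (pos_set V h)"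
          using x0 free_bdry_iff[OF oV hh(1,2)] by auto
        have x0c: "x0 \<in> closure V" using x0'(1) closure_subset by blast
        define z0 where "z0 = (1 / \<kappa>) *\<^sub>R x0"
        have "pos_set V h \<subseteq> {x \<in> closure U. 1 / \<kappa> \<le> \<rho> t0 x}"
          using h_pos h0_pos clVc \<kappa>(1) by (auto simp: pos_set_def field_simps)
        then have "closure (pos_set V h) \<subseteq> {x \<in> closure U. 1 / \<kappa> \<le> \<rho> t0 x}"
          by (rule closure_minimal[OF _ closed_radial_le(2)[OF t0]])
        then have "1 \<le> \<kappa> * \<rho> t0 x0" using x0'(3) \<kappa>(1) by (auto simp: field_simps)
        moreover have "\<not> 1 < \<kappa> * \<rho> t0 x0" using h0_pos[OF x0c] h_pos[of x0] x0'(2) by simp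
        ultimately have "\<rho> t0 z0 = 1" using rk[OF x0c] by (simp add: z0_def)
        then have z0: "z0 \<in> free_bdry U (w t0)"
          using free_bdry_radial[OF t0] in_U'[OF x0c] by (simp add: z0_def)
        have s: "0 < \<kappa> * \<mu>" using \<kappa> \<mu>1 by simp
        have yz: "\<mu> *\<^sub>R x0 = (\<kappa> * \<mu>) *\<^sub>R z0" using \<kappa> by (simp add: z0_def)
        have "\<mu> *\<^sub>R x0 \<in> V" "u t (\<mu> *\<^sub>R x0) = 0" "\<mu> *\<^sub>R x0 \<in> closure (pos_set V (u t))"
          using y1 free_bdry_iff[OF oV f(1,2)] by auto
        moreover have "pos_set V (u t) \<subseteq> pos_set U (u t)" using clVc by (auto simp: pos_set_def)
        ultimately have yf: "\<mu> *\<^sub>R x0 \<in> free_bdry U (u t)"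
          using free_bdry_iff[OF open_U u(1)[OF t(1)] u(2)[OF t(1)]] VU closure_mono by blast
        obtain r' where r': "r' > 0" "ball x0 r' \<subseteq> V" using x0'(1) oV open_contains_ball by metis
        have pull_in: "y /\<^sub>R \<mu> \<in> V" if "y \<in> ball (\<mu> *\<^sub>R x0) r'" for y
        proof -
          have "norm (\<mu> *\<^sub>R x0 - y) = \<mu> * norm (x0 - y /\<^sub>R \<mu>)"
            using \<mu>1 norm_scaleR[of \<mu> "x0 - y /\<^sub>R \<mu>"] by (simp add: scaleR_diff_right)
          then have "\<mu> * norm (x0 - y /\<^sub>R \<mu>) < r'" using that by (simp add: dist_norm)
          moreover have "1 * norm (x0 - y /\<^sub>R \<mu>) \<le> \<mu> * norm (x0 - y /\<^sub>R \<mu>)"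
            using \<mu>1 by (intro mult_right_mono) auto
          ultimately show ?thesis using r'(2) by (auto simp: dist_norm)
        qed
        have scl: "y /\<^sub>R (\<kappa> * \<mu>) = (1 / \<kappa>) *\<^sub>R (y /\<^sub>R \<mu>)" for y :: 'a
          by (simp add: divide_inverse mult.commute)
        have inv: "\<mu> *\<^sub>R (y /\<^sub>R \<mu>) = y" for y :: 'a using \<mu>1 by simp
        have "(c / (\<kappa> * \<mu>)) *\<^sub>R G t0 z0 \<in> superdiff U (u t) ((\<kappa> * \<mu>) *\<^sub>R z0)"
        proof (rule superdiff_dilate[OF gradient_superdiff[OF t0 z0] s c r'(1)])
          fix y assume y: "y \<in> ball ((\<kappa> * \<mu>) *\<^sub>R z0) r'"
          then have yV: "y /\<^sub>R \<mu> \<in> V" using pull_in yz by simp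
          then have yc: "y /\<^sub>R \<mu> \<in> closure V" using closure_subset by blast
          show "y /\<^sub>R (\<kappa> * \<mu>) \<in> pos_set U (w t0)" if "y \<in> pos_set U (u t)"
          proof -
            have "0 < u t (\<mu> *\<^sub>R (y /\<^sub>R \<mu>))" unfolding inv using that by (simp add: pos_set_def)
            then have "0 < h0 (y /\<^sub>R \<mu>)" using pos[OF yV] h_pos by blast
            then show ?thesis unfolding scl
              using in_U'[OF yc] closure_subset[of U] by (auto simp: pos_set_def h0_def)
          qed
          show "u t y \<le> c * w t0 (y /\<^sub>R (\<kappa> * \<mu>))"
            using le[OF yc] unfolding inv scl h_def h0_def .
        qed
        then have "q \<le> (norm ((c / (\<kappa> * \<mu>)) *\<^sub>R G t0 z0))\<^sup>2" using slope[OF t(1) yf] unfolding yz by blast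
        moreover have "norm ((c / (\<kappa> * \<mu>)) *\<^sub>R G t0 z0) < sqrt q"
        proof -
          have "norm ((c / (\<kappa> * \<mu>)) *\<^sub>R G t0 z0) = c / (\<kappa> * \<mu>) * norm (G t0 z0)"
            using c s by (simp only: norm_scaleR abs_of_pos divide_pos_pos)
          also have "\<dots> \<le> c / (\<kappa> * \<mu>) * N"
            using M[OF z0] N c s by (intro mult_left_mono) auto
          also have "\<dots> = sqrt q / (2 * \<mu>)" using \<kappa>(1) \<mu>1 N by (simp add: c_def field_simps)
          also have "\<dots> < sqrt q" using \<mu>1 q by (simp add: field_simps)
          finally show ?thesis .
        qed
        then have "(norm ((c / (\<kappa> * \<mu>)) *\<^sub>R G t0 z0))\<^sup>2 < (sqrt q)\<^sup>2"
          by (intro power_strict_mono) auto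
        ultimately show False using q by simp
      qed
    qed
    have yU: "y \<in> closure U" using y pc by blast
    have y0: "y \<noteq> 0" by (rule nz[OF yU])
    have "\<beta> \<le> \<Lambda> * \<rho> t0 y"
    proof (cases "\<beta> * \<rho> t0 y < a")
      case True
      define x where "x = (1 / \<beta>) *\<^sub>R y"
      have x: "x \<noteq> 0" "\<rho> t0 x = \<beta> * \<rho> t0 y" "y = \<beta> *\<^sub>R x"
        using y0 \<beta>(1) B.radial_scale[OF y0, of "1 / \<beta>"] by (auto simp: x_def)
      then have xV: "x \<in> V" using True by (simp add: V_def)
      then have xc: "x \<in> closure V" using closure_subset by blast
      have yV: "y \<in> V" unfolding x(3) by (rule dilV[OF xc \<beta>(1)])
      have "y \<in> closure (V \<inter> pos_set U (u t))"
        using open_Int_closure_subset[OF oV, of "pos_set U (u t)"] yV y by blast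
      moreover have "V \<inter> pos_set U (u t) \<subseteq> pos_set V (u t)" using closure_subset[of V] by (auto simp: pos_set_def)
      ultimately have "\<beta> *\<^sub>R x \<in> closure (pos_set V (u t))" using closure_mono x(3) by blast
      then have "0 < h x" using no_touch[OF xc] by simp
      then have "1 < \<kappa> * (\<beta> * \<rho> t0 y)" using h_pos h0_pos[OF xc] x(2) by simp
      then have "1 < (\<Lambda> / \<beta>) * \<rho> t0 y" using \<kappa>(3) by (simp add: mult.assoc[symmetric])
      then show ?thesis using \<beta>(1) by (simp add: field_simps)
    next
      case False
      then have "\<gamma> \<le> \<beta> * (\<Lambda> * \<rho> t0 y)" using \<Lambda> by (simp add: a_def field_simps)
      then have "\<beta> * \<beta>\<^sup>2 \<le> \<beta> * (\<Lambda> * \<rho> t0 y)" using \<beta>(2) by (simp add: power2_eq_square power3_eq_cube)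
      then have "\<beta>\<^sup>2 \<le> \<Lambda> * \<rho> t0 y" using \<beta>(1) by simp
      moreover have "\<beta> \<le> \<beta>\<^sup>2" using \<beta>(1) by (simp add: power2_eq_square)
      ultimately show ?thesis by simp
    qed
    moreover have rt: "0 < \<rho> t y" by (rule radial_pos[OF t(1) y0])
    moreover have "\<rho> t0 y < \<beta> * \<rho> t y"
    proof -
      have "\<rho> t0 y / \<rho> t y < \<beta>" using d2(2)[OF t(1) _ y0] t(2) by force
      then show ?thesis using rt by (simp add: field_simps)
    qed
    then have "\<Lambda> * \<rho> t0 y < \<beta> * (\<Lambda> * \<rho> t y)"
      using \<Lambda> mult_strict_left_mono[of "\<rho> t0 y" "\<beta> * \<rho> t y" \<Lambda>] by (simp add: mult.left_commute)
    ultimately have "\<beta> * 1 < \<beta> * (\<Lambda> * \<rho> t y)" by linarith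
    then show "1 < \<Lambda> * \<rho> t y" using \<beta>(1) mult_less_cancel_left_pos[of \<beta> 1] by simp
  qed (use d1 d2 in auto)
qed

end

section \<open>Comparison with a regular supersolution\<close>

context star_evolution
begin

lemma regular_supersolution_above:
  assumes super: "visc_supersolution U T \<mu>m \<mu>p F w" and sub: "visc_subsolution U T \<mu>m \<mu>p F u"
    and usc: "usc_on ({0..T} \<times> closure U) (\<lambda>(t, x). u t x)"
    and bpos: "\<And>t. t \<in> {0..T} \<Longrightarrow> bounded (pos_set U (u t))"
    and init: "\<And>x. x \<in> closure U \<Longrightarrow> u 0 x \<le> w 0 x"
    and \<mu>m: "\<mu>m < 1" and F: "\<And>t. t \<in> {0..T} \<Longrightarrow> 0 < F t"
    and t1: "t1 \<in> {0..T}" and x1: "x1 \<in> closure U"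
  shows "u t1 x1 \<le> w t1 x1"
proof -
  obtain r where "dilation_domain U r" using U_away by blast
  then interpret dd: dilation_domain U r .
  have contu: "continuous_on (closure U) (u t)" and nonnegu: "\<And>x. x \<in> closure U \<Longrightarrow> 0 \<le> u t x"
    and bdu: "\<And>x. x \<in> frontier U \<Longrightarrow> u t x \<le> F t"
    and subh: "subharmonic_on (pos_set U (u t) \<inter> U) (u t)" if "t \<in> {0..T}" for t
    using sub that unfolding visc_subsolution_def bounded_evolution_def by blast+
  have bdw: "\<And>x. x \<in> frontier U \<Longrightarrow> F t \<le> w t x"
    and superh: "superharmonic_on (pos_set U (w t) \<inter> U) (w t)" if "t \<in> {0..T}" for t
    using super that unfolding visc_supersolution_def by blast+
  have slope: "1 - \<mu>m \<le> (norm p)\<^sup>2"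
    if "t \<in> {0..T}" "x \<in> free_bdry U (u t)" "p \<in> superdiff U (u t) x" for t x p
    using sub that unfolding visc_subsolution_def by blast
  have usc': "eventually (\<lambda>(s, y). u s y < c) (at (t, x) within {0..T} \<times> closure U)"
    if "t \<in> {0..T}" "x \<in> closure U" "u t x < c" for t x c
  proof -
    have "(t, x) \<in> {0..T} \<times> closure U" "(\<lambda>(t, x). u t x) (t, x) < c" using that by auto
    with usc have "eventually (\<lambda>z. (\<lambda>(t, x). u t x) z < c) (at (t, x) within {0..T} \<times> closure U)"
      unfolding usc_on_def by blast
    then show ?thesis by (rule eventually_mono) auto
  qed
  have envu: "upper_env U T u t x = u t x" if "t \<in> {0..T}" "x \<in> U" for t x
    by (rule upper_env_eq[where u = u, OF open_U that(1) _ contu[OF that(1)] usc'[OF that(1)]])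
      (use that(2) closure_subset in auto)
  have dU: "\<mu> *\<^sub>R x \<in> U" "\<mu> *\<^sub>R x \<in> closure U" if "x \<in> closure U" "1 < \<mu>" for x \<mu>
    using dilate_U[OF that] closure_subset by auto
  have pc: "x \<in> closure U" if "x \<in> closure (pos_set U v)" for x v
    using that closure_minimal[OF pos_set_subset_closure closed_closure] by blast
  have pos_w: "0 < w t x \<longleftrightarrow> 1 < \<rho> t x" if t: "t \<in> {0..T}" and x: "x \<in> closure U" for t x
  proof (cases "x \<in> U")
    case True then show ?thesis by (rule pos_iff[OF t])
  next
    case False
    then have "x \<in> frontier U" using x open_U by (simp add: frontier_def interior_open)
    then have "0 < w t x" using bdw[OF t] F[OF t] by fastforce
    then show ?thesis
      using pos_imp_interior[OF t x] star_body.in_interior_iff[OF body[OF t] nonzero_on_closure[OF x]] by simp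
  qed
  have out: "1 < \<rho> t x" if t: "t \<in> {0..T}" and x: "x \<notin> U" "x \<noteq> 0" for t x
  proof (cases "x \<in> closure U")
    case True
    then have "x \<in> frontier U" using x open_U by (simp add: frontier_def interior_open)
    then show ?thesis using pos_w[OF t True] bdw[OF t] F[OF t] by fastforce
  next
    case False
    then have "x \<in> interior (- U)" by (simp add: interior_closure)
    then have "x \<in> interior (D t)" using interior_mono[of "- U" "D t"] by blast
    then show ?thesis using star_body.in_interior_iff[OF body[OF t] x(2)] by simp
  qed
  have main: "u t1 ((1 + \<epsilon> * (1 + t1)) *\<^sub>R x1) \<le> w t1 x1" if \<epsilon>: "\<epsilon> > 0" for \<epsilon> :: real
  proof -
    define \<Lambda> where "\<Lambda> t = 1 + \<epsilon> * (1 + t)" for t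
    have \<Lambda>1: "1 < \<Lambda> t" if "0 \<le> t" for t using \<epsilon> that by (simp add: \<Lambda>_def add_pos_nonneg)
    \<comment> \<open>times at which the support of the dilation of \<open>u\<close> reaches the zero set of \<open>w\<close>\<close>
    define B where "B = {t \<in> {0..T}. \<exists>y\<in>closure (pos_set U (u t)). \<Lambda> t * \<rho> t y \<le> 1}"
    have "B = {}"
    proof (rule ccontr)
      assume "B \<noteq> {}"
      have bB: "bdd_below B" unfolding B_def by (rule bdd_belowI[of _ 0]) auto
      define t0 where "t0 = Inf B"
      obtain tb where tb: "tb \<in> B" using \<open>B \<noteq> {}\<close> by blast
      have t0_le: "t0 \<le> s" if "s \<in> B" for s unfolding t0_def using that bB by (rule cInf_lower)
      have "0 \<le> t0" unfolding t0_def using \<open>B \<noteq> {}\<close> by (intro cInf_greatest) (auto simp: B_def)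
      moreover have "t0 \<le> T" using t0_le[OF tb] tb by (auto simp: B_def)
      ultimately have tT: "t0 \<in> {0..T}" by simp
      have \<Lambda>0: "1 < \<Lambda> t0" using \<Lambda>1 tT by simp
      have good: "1 < \<Lambda> t * \<rho> t y" if "0 \<le> t" "t < t0" "y \<in> closure (pos_set U (u t))" for t y
        using t0_le[of t] that tT by (force simp: B_def)
      have t0B: "t0 \<in> B"
      proof (rule ccontr)
        assume "t0 \<notin> B"
        then have g: "1 < \<Lambda> t0 * \<rho> t0 y" if "y \<in> closure (pos_set U (u t0))" for y
          using that tT by (force simp: B_def)
        have wp: "0 < w t0 x" if "x \<in> frontier U" for x using bdw[OF tT that] F[OF tT] by simp
        have q: "0 < 1 - \<mu>m" using \<mu>m by simp
        obtain d where d: "d > 0"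
          "\<And>t y. t \<in> {0..T} \<Longrightarrow> \<bar>t - t0\<bar> < d \<Longrightarrow> y \<in> closure (pos_set U (u t)) \<Longrightarrow> 1 < \<Lambda> t0 * \<rho> t y"
        proof (rule support_persists[OF wp superh[OF tT] contu nonnegu subh bpos slope q usc tT \<Lambda>0 g])
          fix d :: real
          assume "d > 0" "\<And>t y. t \<in> {0..T} \<Longrightarrow> \<bar>t - t0\<bar> < d \<Longrightarrow> y \<in> closure (pos_set U (u t)) \<Longrightarrow> 1 < \<Lambda> t0 * \<rho> t y"
          then show thesis by (rule that)
        qed
        have "t0 + d \<le> s" if s: "s \<in> B" for s
        proof (rule ccontr)
          assume "\<not> t0 + d \<le> s"
          then have sd: "\<bar>s - t0\<bar> < d" using t0_le[OF s] by simp
          obtain y where y: "s \<in> {0..T}" "y \<in> closure (pos_set U (u s))" "\<Lambda> s * \<rho> s y \<le> 1"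
            using s by (auto simp: B_def)
          have "0 < \<rho> s y" using radial_pos[OF y(1)] nonzero_on_closure pc[OF y(2)] by blast
          then have "\<Lambda> t0 * \<rho> s y \<le> \<Lambda> s * \<rho> s y"
            using t0_le[OF s] \<epsilon> by (intro mult_right_mono) (auto simp: \<Lambda>_def)
          then show False using d(2)[OF y(1) sd y(2)] y(3) by simp
        qed
        then have "t0 + d \<le> Inf B" using \<open>B \<noteq> {}\<close> by (intro cInf_greatest)
        then show False using d(1) by (simp add: t0_def)
      qed
      then obtain yb where yb: "yb \<in> closure (pos_set U (u t0))" "\<Lambda> t0 * \<rho> t0 yb \<le> 1"
        by (auto simp: B_def)
      have yb0: "yb \<noteq> 0" using nonzero_on_closure[OF pc[OF yb(1)]] .
      have "t0 \<noteq> 0"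
      proof
        assume t00: "t0 = 0"
        have "pos_set U (u 0) \<subseteq> D 0" using init by (force simp: pos_set_def)
        then have "yb \<in> closure (D 0)" using closure_mono yb(1) t00 by blast
        then have "1 \<le> \<rho> t0 yb"
          using star_body.in_closure_iff[OF body yb0, of 0] tT t00 by simp
        then have "1 * 1 < \<Lambda> t0 * \<rho> t0 yb" using \<Lambda>0 by (intro mult_less_le_imp_less) auto
        then show False using yb(2) by simp
      qed
      then have t0pos: "t0 \<in> {0<..T}" using tT by auto
      define xb where "xb = (1 / \<Lambda> t0) *\<^sub>R yb"
      have \<rho>xb: "\<rho> t0 xb = \<Lambda> t0 * \<rho> t0 yb"
        using radial_dilate[OF tT yb0, of "1 / \<Lambda> t0"] \<Lambda>0 by (simp add: xb_def)
      have "xb \<noteq> 0" using yb0 \<Lambda>0 by (simp add: xb_def)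
      then have xbU: "xb \<in> U" using out[OF tT, of xb] \<rho>xb yb(2) by fastforce
      then have xb: "xb \<in> closure U" using closure_subset by blast
      have xbc: "\<Lambda> t0 *\<^sub>R xb \<in> closure (pos_set U (u t0))" using yb(1) \<Lambda>0 by (simp add: xb_def)
      have wxb: "w t0 xb \<le> 0" using pos_w[OF tT xb] \<rho>xb yb(2) by simp
      obtain \<mu> x0 where \<mu>: "\<Lambda> t0 \<le> \<mu>" and x0: "x0 \<in> free_bdry U (w t0)"
        and y0: "\<mu> *\<^sub>R x0 \<in> free_bdry U (u t0)"
        and le: "\<And>x. x \<in> closure U \<Longrightarrow> u t0 (\<mu> *\<^sub>R x) \<le> w t0 x"
        and pos: "\<And>x. x \<in> U \<Longrightarrow> 0 < u t0 (\<mu> *\<^sub>R x) \<Longrightarrow> 0 < w t0 x"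
      proof (rule dd.dilation_touching[OF contu[OF tT] nonnegu[OF tT] subh[OF tT] bpos[OF tT] bdu[OF tT]
            cont[OF tT] nonneg[OF tT] superh[OF tT] bdw[OF tT] F[OF tT] \<Lambda>0 xb xbc wxb])
        fix \<mu> x0
        assume *: "\<Lambda> t0 \<le> \<mu>" "x0 \<in> free_bdry U (w t0)" "\<mu> *\<^sub>R x0 \<in> free_bdry U (u t0)"
          "\<And>x. x \<in> closure U \<Longrightarrow> u t0 (\<mu> *\<^sub>R x) \<le> w t0 x"
          "\<And>x. x \<in> U \<Longrightarrow> 0 < u t0 (\<mu> *\<^sub>R x) \<Longrightarrow> 0 < w t0 x"
        show thesis by (rule that[OF *])
      qed
      have \<mu>1: "1 < \<mu>" using \<mu> \<Lambda>0 by simp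
      define y where "y = \<mu> *\<^sub>R x0"
      define g where "g = G t0 x0"
      have yf: "y \<in> free_bdry U (u t0)" using y0 by (simp add: y_def)
      have x0U: "x0 \<in> U" using x0 by (simp add: free_bdry_def)
      have gsub: "g \<in> subdiff U (w t0) x0" unfolding g_def by (rule gradient_subdiff[OF tT x0])
      obtain r' where r': "r' > 0" "ball x0 r' \<subseteq> U" using x0U open_U open_contains_ball by metis
      have inv: "\<mu> *\<^sub>R (z /\<^sub>R \<mu>) = z" for z :: 'a using \<mu>1 by simp
      have pull_in: "z /\<^sub>R \<mu> \<in> U" if "z \<in> ball (\<mu> *\<^sub>R x0) r'" for z
      proof -
        have "norm (\<mu> *\<^sub>R x0 - z) = \<mu> * norm (x0 - z /\<^sub>R \<mu>)"
          using \<mu>1 norm_scaleR[of \<mu> "x0 - z /\<^sub>R \<mu>"] by (simp add: scaleR_diff_right)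
        then have "\<mu> * norm (x0 - z /\<^sub>R \<mu>) < r'" using that by (simp add: dist_norm)
        moreover have "1 * norm (x0 - z /\<^sub>R \<mu>) \<le> \<mu> * norm (x0 - z /\<^sub>R \<mu>)"
          using \<mu>1 by (intro mult_right_mono) auto
        ultimately show ?thesis using r'(2) by (auto simp: dist_norm)
      qed
      have gsup: "(1 / \<mu>) *\<^sub>R g \<in> superdiff U (u t0) y"
        unfolding g_def y_def
      proof (rule superdiff_dilate[OF gradient_superdiff[OF tT x0] _ _ r'(1)])
        fix z assume z: "z \<in> ball (\<mu> *\<^sub>R x0) r'"
        have zU: "z /\<^sub>R \<mu> \<in> U" by (rule pull_in[OF z])
        then have zc: "z /\<^sub>R \<mu> \<in> closure U" using closure_subset by blast
        show "z /\<^sub>R \<mu> \<in> pos_set U (w t0)" if "z \<in> pos_set U (u t0)"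
        proof -
          have "0 < u t0 (\<mu> *\<^sub>R (z /\<^sub>R \<mu>))" unfolding inv using that by (simp add: pos_set_def)
          then show ?thesis using pos[OF zU] zc by (simp add: pos_set_def)
        qed
        show "u t0 z \<le> 1 * w t0 (z /\<^sub>R \<mu>)" using le[OF zc] unfolding inv by simp
      qed (use \<mu>1 in auto)
      have g1': "1 - \<mu>m \<le> (norm ((1 / \<mu>) *\<^sub>R g))\<^sup>2" by (rule slope[OF tT yf gsup])
      have g0: "norm g \<noteq> 0" using g1' \<mu>m by auto
      have "norm ((1 / \<mu>) *\<^sub>R g) < norm g" using \<mu>1 g0 by (simp add: field_simps)
      then have strict: "(norm ((1 / \<mu>) *\<^sub>R g))\<^sup>2 < (norm g)\<^sup>2"
        by (intro power_strict_mono) auto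
      have g1: "1 - \<mu>m < (norm g)\<^sup>2" using g1' strict by simp
      have g2: "(norm g)\<^sup>2 \<le> 1 + \<mu>p" using super tT x0 gsub unfolding visc_supersolution_def by blast
      let ?Q = "{p :: 'a. 1 - \<mu>m < (norm p)\<^sup>2}"
      have oQ: "open ?Q" by (intro open_Collect_less continuous_intros)
      have no_vel: "\<not> velocity_neg (\<lambda>s. pos_set U (w s)) t z"
        if tz: "t \<in> {0<..T}" "z \<in> free_bdry U (w t)" "G t z \<in> ?Q" for t z
      proof
        assume v: "velocity_neg (\<lambda>s. pos_set U (w s)) t z"
        have t: "t \<in> {0..T}" using tz(1) by auto
        have "(norm (G t z))\<^sup>2 \<le> 1 - \<mu>m"
          by (rule supersolution_dynamic_slope[OF open_U super lower_env_w t tz(2) v gradient_subdiff[OF t tz(2)]])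
        then show False using tz(3) by simp
      qed
      have gx: "G t0 x0 \<noteq> 0" "G t0 x0 \<in> ?Q" using g0 g1 by (auto simp: g_def)
      obtain d c H where d: "0 < d" "d < t0" and c: "0 < c" and H: "0 < H"
        and cone: "\<And>t h. t0 - d \<le> t \<Longrightarrow> t \<le> t0 \<Longrightarrow> 0 < h \<Longrightarrow> h \<le> H \<Longrightarrow>
          cball ((1 + h) *\<^sub>R x0) (c * h) \<inter> pos_set U (w t) = {}"
        by (rule not_contracting[OF t0pos x0 gx(1) oQ gx(2)]) (rule no_vel, assumption+, rule that)
      obtain rb where rb: "rb > 0" "ball x0 rb \<subseteq> U" using x0U open_U open_contains_ball by metis
      define n where "n = norm x0 + c"
      have n: "n > 0" using c by (simp add: n_def add_nonneg_pos)
      \<comment> \<open>the speed at which the balls grow: they are then mapped into the balls of \<open>cone\<close>\<close>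
      define c2 where "c2 = c * \<epsilon>"
      have c2: "c2 > 0" using c \<epsilon> by (simp add: c2_def)
      define m where "m = Min {d, H / \<epsilon>, rb / (\<epsilon> * n)}"
      have m: "m > 0" "m \<le> d" "m \<le> H / \<epsilon>" "m \<le> rb / (\<epsilon> * n)"
        using d(1) H rb(1) \<epsilon> n by (auto simp: m_def)
      define r0 where "r0 = m / 2"
      have r0: "r0 > 0" "r0 < d" "r0 < H / \<epsilon>" "r0 < rb / (\<epsilon> * n)"
        using m unfolding r0_def by linarith+
      have "cball y (c2 * (t0 - t)) \<subseteq> - pos_set U (u t)" if t: "t0 - r0 \<le> t" "t < t0" for t
      proof
        fix x assume x: "x \<in> cball y (c2 * (t0 - t))"
        have tT': "t \<in> {0..T}" using t r0 d tT by auto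
        have t0': "0 \<le> t" using tT' by simp
        have \<Lambda>t: "1 < \<Lambda> t" using \<Lambda>1 tT' by simp
        show "x \<in> - pos_set U (u t)"
        proof
          assume xp: "x \<in> pos_set U (u t)"
          then have xc: "x \<in> closure (pos_set U (u t))" using closure_subset by blast
          have x_0: "x \<noteq> 0" using nonzero_on_closure[OF pc[OF xc]] .
          have gx: "1 < \<Lambda> t * \<rho> t x" by (rule good[OF t0' t(2) xc])
          define h where "h = \<epsilon> * (t0 - t) / \<Lambda> t"
          have h: "h > 0" using \<epsilon> t \<Lambda>t by (simp add: h_def)
          have "h \<le> \<epsilon> * (t0 - t)"
            using divide_left_mono[of 1 "\<Lambda> t" "\<epsilon> * (t0 - t)"] \<Lambda>t \<epsilon> t by (simp add: h_def)
          also have "\<dots> \<le> \<epsilon> * r0" using t \<epsilon> by simp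
          finally have hr: "h \<le> \<epsilon> * r0" .
          have hH: "h \<le> H"
          proof -
            have "\<epsilon> * r0 \<le> H" using r0(3) \<epsilon> by (simp add: field_simps)
            then show ?thesis using hr by simp
          qed
          have hn: "h * n < rb"
          proof -
            have "h * n \<le> \<epsilon> * r0 * n" using hr n by (intro mult_right_mono) auto
            also have "\<dots> < rb" using r0(4) \<epsilon> n by (simp add: field_simps)
            finally show ?thesis .
          qed
          have ratio: "\<Lambda> t0 / \<Lambda> t = 1 + h" using \<Lambda>t by (simp add: h_def \<Lambda>_def field_simps)
          define a where "a = \<Lambda> t0 / (\<mu> * \<Lambda> t)"
          have a: "0 < a" using \<Lambda>0 \<Lambda>t \<mu>1 by (simp add: a_def)
          have a\<mu>: "a * \<mu> = 1 + h" using \<mu>1 ratio by (simp add: a_def)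
          have a\<Lambda>: "a * \<Lambda> t \<le> 1" using \<mu> \<mu>1 \<Lambda>t by (simp add: a_def)
          \<comment> \<open>\<open>q\<close> is \<open>x / \<Lambda> t\<close> moved towards the origin by the factor \<open>\<Lambda> t0 / \<mu> \<le> 1\<close>\<close>
          define q where "q = a *\<^sub>R x"
          define b where "b = a *\<^sub>R (x - y)"
          have qeq: "q = x0 + h *\<^sub>R x0 + b"
          proof -
            have "a *\<^sub>R y = (1 + h) *\<^sub>R x0" using a\<mu> by (simp add: y_def)
            moreover have "q = a *\<^sub>R y + b" by (simp add: q_def b_def scaleR_diff_right)
            ultimately show ?thesis by (simp add: scaleR_add_left)
          qed
          have nb: "norm b \<le> c * h"
          proof -
            have "norm b = a * norm (x - y)" using a by (simp add: b_def)
            also have "\<dots> \<le> a * (c2 * (t0 - t))"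
              using x a by (intro mult_left_mono) (auto simp: dist_norm norm_minus_commute)
            also have "\<dots> = (a * \<Lambda> t) * (c * h)" using \<Lambda>t by (simp add: c2_def h_def)
            also have "\<dots> \<le> 1 * (c * h)" using a\<Lambda> c h by (intro mult_right_mono) auto
            finally show ?thesis by simp
          qed
          have "norm (q - x0) \<le> h * norm x0 + norm b"
            unfolding qeq using norm_triangle_ineq[of "h *\<^sub>R x0" b] h by (simp add: add.assoc)
          also have "\<dots> \<le> h * n" using nb by (simp add: n_def algebra_simps)
          finally have "q \<in> ball x0 rb" using hn by (simp add: dist_norm norm_minus_commute)
          then have qU: "q \<in> U" using rb(2) by blast
          have "a \<le> 1 / \<Lambda> t" using a\<Lambda> \<Lambda>t by (simp add: field_simps)
          then have "a < \<rho> t x" using gx \<Lambda>t by (smt (verit) divide_less_eq mult.commute)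
          then have "1 < \<rho> t q" using radial_dilate[OF tT' x_0 a] a by (simp add: q_def)
          then have "q \<in> pos_set U (w t)"
            using pos_iff[OF tT' qU] qU closure_subset[of U] by (auto simp: pos_set_def)
          moreover have "q \<in> cball ((1 + h) *\<^sub>R x0) (c * h)"
            using nb unfolding qeq by (simp add: dist_norm scaleR_add_left)
          ultimately show False using cone[of t h] t r0 h hH by auto
        qed
      qed
      then have vel: "velocity_pos (\<lambda>t. pos_set U (u t)) t0 y"
        unfolding velocity_pos_def using c2 r0 d by (intro exI[of _ c2] conjI exI[of _ r0]) auto
      have "1 + \<mu>p \<le> (norm ((1 / \<mu>) *\<^sub>R g))\<^sup>2"
        by (rule subsolution_dynamic_slope[OF open_U sub envu tT yf vel gsup])
      then show False using strict g2 by simp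
    qed
    have \<Lambda>t1: "1 < \<Lambda> t1" using \<Lambda>1 t1 by simp
    have pos: "0 < w t1 x" if x: "x \<in> U" "0 < u t1 (\<Lambda> t1 *\<^sub>R x)" for x
    proof -
      have xc: "x \<in> closure U" using x(1) closure_subset by blast
      have "\<Lambda> t1 *\<^sub>R x \<in> pos_set U (u t1)" using x(2) dU(2)[OF xc \<Lambda>t1] by (simp add: pos_set_def)
      then have "\<Lambda> t1 *\<^sub>R x \<in> closure (pos_set U (u t1))" using closure_subset by blast
      then have "1 < \<Lambda> t1 * \<rho> t1 (\<Lambda> t1 *\<^sub>R x)" using \<open>B = {}\<close> t1 by (force simp: B_def)
      then have "1 < \<rho> t1 x" using radial_dilate[OF t1 nonzero_on_closure[OF xc], of "\<Lambda> t1"] \<Lambda>t1 by simp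
      then show ?thesis using pos_w[OF t1 xc] by simp
    qed
    have "u t1 (\<Lambda> t1 *\<^sub>R x1) \<le> w t1 x1"
      by (rule dd.dilation_comparison[OF contu[OF t1] nonnegu[OF t1] subh[OF t1] bpos[OF t1] bdu[OF t1]
            cont[OF t1] nonneg[OF t1] superh[OF t1] bdw[OF t1]])
        (use F[OF t1] \<Lambda>t1 pos x1 in auto)
    then show ?thesis by (simp add: \<Lambda>_def)
  qed
  have lim: "(\<lambda>n. (1 + inverse (real (Suc n)) * (1 + t1)) *\<^sub>R x1) \<longlonglongrightarrow> (1 + 0 * (1 + t1)) *\<^sub>R x1"
    by (intro tendsto_intros LIMSEQ_inverse_real_of_nat)
  have incl: "(1 + inverse (real (Suc n)) * (1 + t1)) *\<^sub>R x1 \<in> closure U" for n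
    using t1 by (intro dU(2) x1) (auto simp: add_pos_nonneg)
  have "(\<lambda>n. u t1 ((1 + inverse (real (Suc n)) * (1 + t1)) *\<^sub>R x1)) \<longlonglongrightarrow> u t1 ((1 + 0 * (1 + t1)) *\<^sub>R x1)"
    by (rule continuous_on_tendsto_compose[OF contu[OF t1] lim]) (use x1 incl in auto)
  then have "u t1 ((1 + 0 * (1 + t1)) *\<^sub>R x1) \<le> w t1 x1"
    by (rule LIMSEQ_le_const2) (use main in auto)
  then show ?thesis by simp
qed

end

section \<open>The comparison principle\<close>

theorem proposition4p20:
  fixes U :: "'a::euclidean_space set"
    and T \<mu>m \<mu>p :: real
    and F F' :: "real \<Rightarrow> real"
  assumes "open U" and "connected U" and "compact (- U)"
    and "strongly_star_shaped (- U)"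
    and "0 < \<mu>m" and "\<mu>m < 1" and "0 < \<mu>p" and "0 < T"
    and "\<And>t. t \<in> {0..T} \<Longrightarrow> (F has_real_derivative F' t) (at t within {0..T})"
    and "continuous_on {0..T} F'"
    and "\<And>t. t \<in> {0..T} \<Longrightarrow> 0 < F t"
    and "discrete {t \<in> {0<..<T}. F' t = 0}"
  shows "(\<forall>w u.
           visc_subsolution U T \<mu>m \<mu>p F w \<and>
           visc_supersolution U T \<mu>m \<mu>p F u \<and>
           lsc_on ({0..T} \<times> closure U) (\<lambda>(t, x). u t x) \<and>
           strongly_star_shaped_fun U (w 0) \<and> strongly_star_shaped_fun U (u 0) \<and>
           (\<forall>x\<in>closure U. w 0 x \<le> u 0 x) \<and>
           regular_evolution U T w \<and> piecewise_monotone_in_time U T w \<longrightarrow>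
           (\<forall>t\<in>{0..T}. \<forall>x\<in>closure U. w t x \<le> u t x)) \<and>
         (\<forall>w u.
           visc_supersolution U T \<mu>m \<mu>p F w \<and>
           visc_subsolution U T \<mu>m \<mu>p F u \<and>
           (\<forall>t\<in>{0..T}. bounded (pos_set U (u t) \<union> - U)) \<and>
           usc_on ({0..T} \<times> closure U) (\<lambda>(t, x). u t x) \<and>
           strongly_star_shaped_fun U (w 0) \<and> strongly_star_shaped_fun U (u 0) \<and>
           (\<forall>x\<in>closure U. w 0 x \<ge> u 0 x) \<and>
           regular_evolution U T w \<and> piecewise_monotone_in_time U T w \<longrightarrow>
           (\<forall>t\<in>{0..T}. \<forall>x\<in>closure U. w t x \<ge> u t x))"
proof (rule conjI; intro allI impI ballI; elim conjE)
  fix w u t x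
  assume w: "visc_subsolution U T \<mu>m \<mu>p F w" and u: "visc_supersolution U T \<mu>m \<mu>p F u"
    and lsc: "lsc_on ({0..T} \<times> closure U) (\<lambda>(t, x). u t x)"
    and u0: "strongly_star_shaped_fun U (u 0)" and le: "\<forall>x\<in>closure U. w 0 x \<le> u 0 x"
    and reg: "regular_evolution U T w" and t: "t \<in> {0..T}" and x: "x \<in> closure U"
  have "bounded_evolution U T w" using w by (simp add: visc_subsolution_def)
  then obtain G L where "star_evolution U T w G L"
    using star_evolutionI[OF assms(1,3,4) _ reg] by blast
  then interpret star_evolution U T w G L .
  show "w t x \<le> u t x"
    by (rule regular_subsolution_below[OF w u lsc u0 _ assms(6) assms(11) t x]) (use le in auto)
next
  fix w u t x
  assume w: "visc_supersolution U T \<mu>m \<mu>p F w" and u: "visc_subsolution U T \<mu>m \<mu>p F u"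
    and b: "\<forall>t\<in>{0..T}. bounded (pos_set U (u t) \<union> - U)"
    and usc: "usc_on ({0..T} \<times> closure U) (\<lambda>(t, x). u t x)"
    and le: "\<forall>x\<in>closure U. u 0 x \<le> w 0 x"
    and reg: "regular_evolution U T w" and t: "t \<in> {0..T}" and x: "x \<in> closure U"
  have "bounded_evolution U T w" using w by (simp add: visc_supersolution_def)
  then obtain G L where "star_evolution U T w G L"
    using star_evolutionI[OF assms(1,3,4) _ reg] by blast
  then interpret star_evolution U T w G L .
  show "u t x \<le> w t x"
    by (rule regular_supersolution_above[OF w u usc _ _ assms(6) assms(11) t x])
      (use le b in \<open>auto intro: bounded_subset\<close>)
qed

end
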